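(* Let $u \ge 2$ be an integer, $U = \{1,\dots,u\}$, and let a weight vector $w \in (0,1]^u$ be given. For every choice of $0<\beta<1$ and every privacy parameter $\varepsilon = O(1)$ (i.e. $\varepsilon>0$ bounded by an absolute constant) there exist a distribution $\mathcal{H}$ over GF(2)-linear maps (matrices over GF(2)) $H:\{0,1\}^u \to \{0,1\}^\tau$, where $\tau = O\left(\log^2(u)\,\varepsilon^{-2}\beta^{-2}\right)$, and a distribution $\mathcal{N}_\varepsilon$ over noise vectors $\varphi \in \{0,1\}^\tau$ such that, for every $x \in \{0,1\}^u$: 1. For $H \sim \mathcal{H}$ and $\varphi \sim \mathcal{N}_\varepsilon$, given $Hx+\varphi$ (addition over GF(2)) one can compute, in time $O(\tau)$, an estimate $\hat{w}$ of $\Vert x\circ w\Vert_1$ that with probability $1-1/u$ satisfies $$\left|\hat{w} - \Vert x\circ w\Vert_1\right| < \beta \Vert x\circ w\Vert_1 + O\left(\log(u)\,\varepsilon^{-2}\beta^{-2}\right).$$ 2. For every $H$ in the support of $\mathcal{H}$, the randomized mechanism $x \mapsto Hx+\varphi$ with $\varphi\sim\mathcal{N}_\varepsilon$ is $\varepsilon$-differentially private over the choice of $\varphi$, and $Hx+\varphi$ can be computed in time $O(\Vert x\Vert_0 \log(u) + \tau)$, including the time for sampling $\varphi$.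
   Context: $x\circ w$ denotes the entrywise (Hadamard) product, $\Vert\cdot\Vert_1$ the $\ell_1$ norm and $\Vert x\Vert_0$ the number of nonzero entries of $x$; $\log$ is base 2. A vector $x\in\{0,1\}^u$ is identified with the set $\{j : x_j = 1\}\subseteq U$. Differential privacy: a randomized mechanism $\mathcal{M}$ on subsets of $U$ is $\varepsilon$-differentially private if for any two neighboring sets $S,T$ (one is a subset of the other and their sizes differ by exactly 1) and every set $W$ of outputs, $\Pr[\mathcal{M}(S)\in W] \le e^{\varepsilon}\Pr[\mathcal{M}(T)\in W]$. Computational model: the distribution $\mathcal{H}$ may be defined via fully random hash functions, which are assumed to be available as an oracle and evaluable in constant time (their storage is not counted); input vectors are given in a sparse representation so that the nonzero entries of $x$ can be listed in time $O(\Vert x\Vert_0)$. *)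

theory Defs
  imports
    "HOL-Probability.Probability"
    "HOL-Library.Z2"
    "HOL-Library.More_List"
    "Jordan_Normal_Form.Matrix"
begin

text \<open>
  The field \<open>GF(2)\<close> is the type \<^typ>\<open>bit\<close>; elements of \<open>{0,1}\<^sup>u\<close> are the vectors in
  \<open>carrier_vec u\<close> over it, and the universe is indexed as \<open>{0..<u}\<close>.
\<close>

definition real_vec :: "bit vec \<Rightarrow> real vec" where
  "real_vec x = map_vec (\<lambda>b. of_bool (b = 1)) x"

definition hadamard :: "real vec \<Rightarrow> real vec \<Rightarrow> real vec"  (infixl "\<circ>\<^sub>H" 70) where
  "v \<circ>\<^sub>H w = vec (dim_vec v) (\<lambda>j. v $ j * w $ j)"

definition l1_norm :: "real vec \<Rightarrow> real" where
  "l1_norm v = (\<Sum>j<dim_vec v. \<bar>v $ j\<bar>)"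

definition l0_norm :: "bit vec \<Rightarrow> nat" where
  "l0_norm x = card {j. j < dim_vec x \<and> x $ j \<noteq> 0}"

definition set_vec01 :: "nat \<Rightarrow> nat set \<Rightarrow> bit vec" where
  "set_vec01 u S = vec u (\<lambda>j. of_bool (j \<in> S))"

definition neighboring :: "'a set \<Rightarrow> 'a set \<Rightarrow> bool" where
  "neighboring S T \<longleftrightarrow>
     S \<subseteq> T \<and> card T = card S + 1 \<or> T \<subseteq> S \<and> card S = card T + 1"

definition differentially_private ::
  "real \<Rightarrow> 'a set \<Rightarrow> ('a set \<Rightarrow> 'b pmf) \<Rightarrow> bool" where
  "differentially_private \<epsilon> U M \<longleftrightarrow>
     (\<forall>S T W. S \<subseteq> U \<and> T \<subseteq> U \<and> neighboring S T \<longrightarrow>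
        measure_pmf.prob (M S) W \<le> exp \<epsilon> * measure_pmf.prob (M T) W)"

text \<open>
  A randomized real RAM with a hash oracle.  The memory consists of numbered arrays of natural
  numbers and numbered arrays of reals; a program mentions only finitely many of them.  Array
  accesses may use computed indices.  Integer arithmetic is restricted to addition and (truncated)
  subtraction, real arithmetic to the field operations; there is no conversion from reals to
  integers, and the only constants in a program are natural numbers.
\<close>

record mstate =
  imem :: "nat \<Rightarrow> nat \<Rightarrow> nat"
  rmem :: "nat \<Rightarrow> nat \<Rightarrow> real"

datatype iexp =
    INum nat
  | ILoad nat iexp
  | IPlus iexp iexp
  | IMinus iexp iexp

datatype rexp =
    RInt iexp
  | RLoad nat iexp
  | RPlus rexp rexp
  | RMinus rexp rexp
  | RTimes rexp rexp
  | RDivide rexp rexp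

datatype bexp =
    ILess iexp iexp
  | RLess rexp rexp
  | BNot bexp
  | BAnd bexp bexp

text \<open>
  \<open>IStore a i e\<close> and \<open>RStore a i e\<close> assign \<open>e\<close> to the cell with index \<open>i\<close> of array \<open>a\<close>.
  \<open>Hash a i f k\<close> stores there the value of the \<open>f\<close>-th hash function on the key \<open>k\<close>, and
  \<open>Rand a i n\<close> a fresh uniformly random element of \<open>{0..<n}\<close>.
\<close>

datatype com =
    Skip
  | IStore nat iexp iexp
  | RStore nat iexp rexp
  | Hash nat iexp iexp iexp
  | Rand nat iexp iexp
  | Seq com com
  | Cond bexp com com
  | While bexp com

primrec ieval :: "mstate \<Rightarrow> iexp \<Rightarrow> nat" where
  "ieval s (INum n) = n"
| "ieval s (ILoad a e) = imem s a (ieval s e)"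
| "ieval s (IPlus e f) = ieval s e + ieval s f"
| "ieval s (IMinus e f) = ieval s e - ieval s f"

primrec reval :: "mstate \<Rightarrow> rexp \<Rightarrow> real" where
  "reval s (RInt e) = real (ieval s e)"
| "reval s (RLoad a e) = rmem s a (ieval s e)"
| "reval s (RPlus e f) = reval s e + reval s f"
| "reval s (RMinus e f) = reval s e - reval s f"
| "reval s (RTimes e f) = reval s e * reval s f"
| "reval s (RDivide e f) = reval s e / reval s f"

primrec beval :: "mstate \<Rightarrow> bexp \<Rightarrow> bool" where
  "beval s (ILess e f) \<longleftrightarrow> ieval s e < ieval s f"
| "beval s (RLess e f) \<longleftrightarrow> reval s e < reval s f"
| "beval s (BNot b) \<longleftrightarrow> \<not> beval s b"
| "beval s (BAnd b c) \<longleftrightarrow> beval s b \<and> beval s c"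

definition istore :: "nat \<Rightarrow> nat \<Rightarrow> nat \<Rightarrow> mstate \<Rightarrow> mstate" where
  "istore a i n s = s\<lparr>imem := (imem s)(a := (imem s a)(i := n))\<rparr>"

definition rstore :: "nat \<Rightarrow> nat \<Rightarrow> real \<Rightarrow> mstate \<Rightarrow> mstate" where
  "rstore a i x s = s\<lparr>rmem := (rmem s)(a := (rmem s a)(i := x))\<rparr>"

text \<open>
  \<open>runs h c s t D\<close>: with hash oracle \<open>h\<close>, every execution of \<open>c\<close> from the state \<open>s\<close> halts after at
  most \<open>t\<close> steps, and \<open>D\<close> is the distribution of the final state.  Each elementary command and
  each test costs one step; as the expressions in a fixed program have constant size, this is unit
  cost per arithmetic operation, memory access, hash evaluation and random choice, up to a constant
  factor.
\<close>

inductive runs ::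
  "(nat \<times> nat \<Rightarrow> nat) \<Rightarrow> com \<Rightarrow> mstate \<Rightarrow> nat \<Rightarrow> mstate pmf \<Rightarrow> bool"
  for h :: "nat \<times> nat \<Rightarrow> nat"
where
  runs_Skip: "runs h Skip s 1 (return_pmf s)"
| runs_IStore: "runs h (IStore a i e) s 1 (return_pmf (istore a (ieval s i) (ieval s e) s))"
| runs_RStore: "runs h (RStore a i e) s 1 (return_pmf (rstore a (ieval s i) (reval s e) s))"
| runs_Hash: "runs h (Hash a i f k) s 1
    (return_pmf (istore a (ieval s i) (h (ieval s f, ieval s k)) s))"
| runs_Rand: "0 < ieval s n \<Longrightarrow> runs h (Rand a i n) s 1
    (map_pmf (\<lambda>v. istore a (ieval s i) v s) (pmf_of_set {0..<ieval s n}))"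
| runs_Seq: "runs h c s t D \<Longrightarrow> (\<And>s'. s' \<in> set_pmf D \<Longrightarrow> runs h d s' t' (E s')) \<Longrightarrow>
    runs h (Seq c d) s (t + t') (bind_pmf D E)"
| runs_CondTrue: "beval s b \<Longrightarrow> runs h c s t D \<Longrightarrow> runs h (Cond b c d) s (t + 1) D"
| runs_CondFalse: "\<not> beval s b \<Longrightarrow> runs h d s t D \<Longrightarrow> runs h (Cond b c d) s (t + 1) D"
| runs_WhileFalse: "\<not> beval s b \<Longrightarrow> runs h (While b c) s 1 (return_pmf s)"
| runs_WhileTrue: "beval s b \<Longrightarrow> runs h c s t D \<Longrightarrow>
    (\<And>s'. s' \<in> set_pmf D \<Longrightarrow> runs h (While b c) s' t' (E s')) \<Longrightarrow>
    runs h (While b c) s (t + t' + 1) (bind_pmf D E)"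
| runs_weaken: "runs h c s t D \<Longrightarrow> t \<le> t' \<Longrightarrow> runs h c s t' D"

definition computes_within ::
  "(nat \<times> nat \<Rightarrow> nat) \<Rightarrow> com \<Rightarrow> mstate \<Rightarrow> real \<Rightarrow> (mstate \<Rightarrow> 'a) \<Rightarrow> 'a pmf \<Rightarrow> bool" where
  "computes_within h c s T out P \<longleftrightarrow>
     (\<exists>t D. runs h c s t D \<and> real t \<le> T \<and> map_pmf out D = P)"

text \<open>
  Memory layout of inputs and outputs.  The public parameters and the length of the proper input
  \<open>zs\<close> are in the arrays number 0, \<open>zs\<close> and the weights in the arrays number 1; all other cells
  are 0.  Results are left in the arrays number 2.
\<close>

definition input_state ::
  "nat \<Rightarrow> real vec \<Rightarrow> real \<Rightarrow> real \<Rightarrow> nat \<Rightarrow> nat list \<Rightarrow> mstate" where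
  "input_state u w \<beta> \<epsilon> \<tau> zs =
     \<lparr>imem = (\<lambda>_ _. 0)(0 := nth_default 0 [u, \<tau>, length zs], 1 := nth_default 0 zs),
      rmem = (\<lambda>_ _. 0)(0 := nth_default 0 [\<beta>, \<epsilon>], 1 := nth_default 0 (list_of_vec w))\<rparr>"

definition real_output :: "mstate \<Rightarrow> real" where
  "real_output s = rmem s 2 0"

definition vec_output :: "nat \<Rightarrow> mstate \<Rightarrow> nat list" where
  "vec_output \<tau> s = map (imem s 2) [0..<\<tau>]"

definition bits_of_vec :: "bit vec \<Rightarrow> nat list" where
  "bits_of_vec y = map (\<lambda>b. of_bool (b = 1)) (list_of_vec y)"

definition sparse_rep :: "bit vec \<Rightarrow> nat list \<Rightarrow> bool" where
  "sparse_rep x zs \<longleftrightarrow> distinct zs \<and> set zs = {j. j < dim_vec x \<and> x $ j \<noteq> 0}"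

text \<open>
  Independent fully random hash functions \<open>h\<^sub>f : {0..<u} \<rightarrow> {0..<r f}\<close> for \<open>f < k\<close>.
\<close>

definition hash_functions :: "nat \<Rightarrow> (nat \<Rightarrow> nat) \<Rightarrow> nat \<Rightarrow> (nat \<times> nat \<Rightarrow> nat) pmf" where
  "hash_functions k r u = Pi_pmf ({0..<k} \<times> {0..<u}) 0 (\<lambda>(f, j). pmf_of_set {0..<r f})"

text \<open>The final distribution does not depend on the derivation or on the time bound.\<close>

lemma runs_unique:
  assumes "runs h c s t D" and "runs h c s t' D'"
  shows "D = D'"
  using assms
proof (induction arbitrary: t' D' rule: runs.induct)
  case (runs_Skip s)
  then show ?case by (induction "Skip" s t' D' rule: runs.induct) auto
next
  case (runs_IStore a i e s)
  then show ?case by (induction "IStore a i e" s t' D' rule: runs.induct) auto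
next
  case (runs_RStore a i e s)
  then show ?case by (induction "RStore a i e" s t' D' rule: runs.induct) auto
next
  case (runs_Hash a i f k s)
  then show ?case by (induction "Hash a i f k" s t' D' rule: runs.induct) auto
next
  case (runs_Rand s n a i)
  from runs_Rand(2) show ?case by (induction "Rand a i n" s t' D' rule: runs.induct) auto
next
  case (runs_Seq c s t D d t2 E)
  from runs_Seq.prems have "\<exists>t3 t4 D3 E3. runs h c s t3 D3 \<and>
    (\<forall>s'\<in>set_pmf D3. runs h d s' t4 (E3 s')) \<and> D' = bind_pmf D3 E3"
  proof (induction "Seq c d" s t' D' rule: runs.induct)
    case (runs_Seq s t D t2 E)
    then show ?case
      by (intro exI[of _ t] exI[of _ t2] exI[of _ D] exI[of _ E]) simp
  qed simp_all
  then obtain t3 t4 D3 E3 where *: "runs h c s t3 D3"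
    "\<forall>s'\<in>set_pmf D3. runs h d s' t4 (E3 s')" "D' = bind_pmf D3 E3"
    by (elim exE conjE)
  have D: "D = D3" using runs_Seq.IH(1) *(1) .
  have "E s' = E3 s'" if "s' \<in> set_pmf D" for s'
    using runs_Seq.IH(2)[OF that] *(2) that D by blast
  then show ?case unfolding *(3) D[symmetric] by (intro bind_pmf_cong) auto
next
  case (runs_CondTrue s b c t D d)
  from runs_CondTrue.prems runs_CondTrue.hyps(1) have "\<exists>t3. runs h c s t3 D'"
    by (induction "Cond b c d" s t' D' rule: runs.induct) auto
  then show ?case using runs_CondTrue.IH by blast
next
  case (runs_CondFalse s b d t D c)
  from runs_CondFalse.prems runs_CondFalse.hyps(1) have "\<exists>t3. runs h d s t3 D'"
    by (induction "Cond b c d" s t' D' rule: runs.induct) auto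
  then show ?case using runs_CondFalse.IH by blast
next
  case (runs_WhileFalse s b c)
  from runs_WhileFalse.prems runs_WhileFalse.hyps show ?case
    by (induction "While b c" s t' D' rule: runs.induct) auto
next
  case (runs_WhileTrue s b c t D t2 E)
  from runs_WhileTrue.prems runs_WhileTrue.hyps(1)
  have "\<exists>t3 t4 D3 E3. runs h c s t3 D3 \<and>
    (\<forall>s'\<in>set_pmf D3. runs h (While b c) s' t4 (E3 s')) \<and> D' = bind_pmf D3 E3"
  proof (induction "While b c" s t' D' rule: runs.induct)
    case (runs_WhileTrue s t D t2 E)
    then show ?case
      by (intro exI[of _ t] exI[of _ t2] exI[of _ D] exI[of _ E]) simp
  qed simp_all
  then obtain t3 t4 D3 E3 where *: "runs h c s t3 D3"
    "\<forall>s'\<in>set_pmf D3. runs h (While b c) s' t4 (E3 s')" "D' = bind_pmf D3 E3"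
    by (elim exE conjE)
  have D: "D = D3" using runs_WhileTrue.IH(1) *(1) .
  have "E s' = E3 s'" if "s' \<in> set_pmf D" for s'
    using runs_WhileTrue.IH(2)[OF that] *(2) that D by blast
  then show ?case unfolding *(3) D[symmetric] by (intro bind_pmf_cong) auto
next
  case (runs_weaken c s t D t2)
  then show ?case by blast
qed

end

theory Submission
  imports Defs
begin

text \<open>
  Every key \<open>j\<close> is sent to at most one row of the sketch, so adding or removing a key flips at most one
  bit, and randomized response on the individual bits (a bit is flipped with probability
  \<open>n / (2 * n + 1)\<close>, where \<open>n = \<lceil>1 / \<epsilon>\<rceil>\<close>) gives privacy.  The rows form \<open>L \<approx> log u\<close> levels of \<open>m\<close> buckets;
  a key reaches level \<open>l\<close> with probability about \<open>w\<^sub>j * 2 ^ l / 2 ^ L\<close>, and then a uniform bucket.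

  Write bits as signs and let \<open>Z\<close> be the sum of the signs in one level.  A key that is sampled with
  probability \<open>q\<close> negates a random sign, as in an Ehrenfest urn, so it multiplies the expectation of
  \<open>Z\<close> by \<open>1 - 2 * q / m\<close> and turns the moment generating function at \<open>\<lambda>\<close> into, essentially, the one
  at \<open>\<lambda> - (q / m) * sinh (2 * \<lambda>)\<close>.  The loss in each step is paid for by the decrease of \<open>\<lambda>\<^sup>2\<close>; hence
  \<open>Z\<close> has sub-Gaussian tails of variance \<open>O(m)\<close> around \<open>m * \<rho> / (2 * n + 1)\<close>, where
  \<open>\<rho> = (\<Prod>j. 1 - 2 * q\<^sub>j / m) \<approx> exp (- 2 * Q / m)\<close> and \<open>Q\<close> is the expected number of sampled keys,
  no matter how large \<open>Q\<close> is.  On the last level whose normalised sum is at least \<open>1/2\<close>, the number of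
  factors \<open>1 - 1 / m\<close> needed to get down to that value is about \<open>2 * Q\<close>, and rescaling it estimates
  the weight.
\<close>

subsection \<open>Moment generating function\<close>

text \<open>Each sampled key goes to exactly one bucket, so the signs of a level are dependent and a
  Chernoff bound for independent summands does not apply; a bounded-difference bound would have a
  variance growing with the number of keys. Revealing the keys one at a time inside the moment
  generating function avoids both, because a quadratic exponent 4 m \<lambda>^2 is preserved by
  every key. The noise attenuates the mean by 1 / (2 n + 1), so accuracy of order \<beta> at that
  scale needs m of order L (2 n + 1)^2 / \<beta>^2; failure probability at most 1 / u^2 on each of L
  levels leaves 1 / u overall. If the selected level is the last one, its error is covered by the
  additive term 2 m. Otherwise the next level has an expected load of at least order m, so the same
  error is relative to the weight. The machine model shapes the rest: it has no logarithm, no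
  rounding and no biased coins, hence the integer threshold behind the noise and the counting of
  decay factors.\<close>

lemma cosh_sinh_bounds:
  fixes y :: real
  assumes "0 \<le> y" "y \<le> 1"
  shows "cosh y - 1 \<le> y\<^sup>2" "y \<le> sinh y" "sinh y \<le> y + y\<^sup>2"
proof -
  have u: "exp y \<le> 1 + y + y\<^sup>2" using exp_bound[of y] assms by simp
  have l: "1 + y + y\<^sup>2 / 2 \<le> exp y" using exp_lower_Taylor_quadratic[of y] assms by simp
  have e: "1 - y \<le> exp (-y)" using exp_ge_add_one_self[of "-y"] by simp
  \<comment> \<open>The upper bound on \<open>exp (-y)\<close> comes from multiplying the quadratic
    Taylor polynomials at \<open>-y\<close> and \<open>y\<close>: the product 1 + y^4 / 4 is at
    least 1.\<close>
  have "(1 - y + y\<^sup>2/2) * exp y \<ge> (1 - y + y\<^sup>2/2) * (1 + y + y\<^sup>2/2)"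
    using l assms by (intro mult_left_mono) auto
  also have "(1 - y + y\<^sup>2/2) * (1 + y + y\<^sup>2/2) = 1 + y^4/4"
    by (simp add: power2_eq_square power4_eq_xxxx algebra_simps)
  finally have "(1 - y + y\<^sup>2/2) * exp y \<ge> 1" using zero_le_power[OF assms(1), of 4] by linarith
  then have e': "exp (-y) \<le> 1 - y + y\<^sup>2/2" by (simp add: exp_minus field_simps)
  have y2: "0 \<le> y\<^sup>2" by simp
  have ch: "cosh y = (exp y + exp (-y)) / 2" and sh: "sinh y = (exp y - exp (-y)) / 2"
    by (simp_all add: cosh_def sinh_def)
  show "cosh y - 1 \<le> y\<^sup>2" 
  proof -
    have "a \<le> 1 + y + Y \<Longrightarrow> b \<le> 1 - y + Y / 2 \<Longrightarrow> 0 \<le> Y \<Longrightarrow> (a + b) / 2 - 1 \<le> Y" for a b Y :: real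
      by (simp add: field_simps)
    from this[OF u e' y2] show ?thesis unfolding ch .
  qed
  show "y \<le> sinh y" unfolding sh using l e' y2 by (simp add: field_simps)
  show "sinh y \<le> y + y\<^sup>2" 
  proof -
    have "a \<le> 1 + y + Y \<Longrightarrow> 1 - y \<le> b \<Longrightarrow> 0 \<le> Y \<Longrightarrow> (a - b) / 2 \<le> y + Y" for a b Y :: real
      by (simp add: field_simps)
    from this[OF u e y2] show ?thesis unfolding sh .
  qed
qed

text \<open>Bookkeeping for one key: the exponent \<open>m * t * l + 4 * m * l\<^sup>2\<close> must
  survive the passage from \<open>l\<close> to \<open>l'\<close>. The term with
  \<open>cosh (2 * l)\<close> costs at most 4 q l^2, and so does replacing
  \<open>sinh (2 * l)\<close> by 2 l in the linear term, because t <= 1. The square term shrinks by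
  at least 8 q l^2, so the coefficient 4 pays for both exactly.\<close>

lemma pullback_step:
  fixes l q m t :: real
  assumes l: "\<bar>l\<bar> \<le> 1/2" and q: "0 \<le> q" "q \<le> 1/2" and m: "2 \<le> m" and t: "0 \<le> t" "t \<le> 1"
  defines "l' \<equiv> l - q / m * sinh (2 * l)"
  shows "\<bar>l'\<bar> \<le> 1/2"
    and "q * (cosh (2 * l) - 1) + (m * t * l' + 4 * m * l'\<^sup>2) \<le> m * (t * (1 - 2 * q / m)) * l + 4 * m * l\<^sup>2"
proof -
  \<comment> \<open>As \<open>sinh\<close> is odd, \<open>l'\<close> equals plus or minus
    \<open>u - q / m * S\<close>, which reduces the estimates to a nonnegative parameter.\<close>
  define u where "u = \<bar>l\<bar>"
  define S where "S = sinh (2 * u)"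
  have u: "0 \<le> u" "u \<le> 1/2" using l by (auto simp: u_def)
  have c: "cosh (2 * u) - 1 \<le> (2 * u)\<^sup>2" and S1: "2 * u \<le> S" and S2: "S \<le> 2 * u + (2 * u)\<^sup>2"
    unfolding S_def using cosh_sinh_bounds[of "2 * u"] u by auto
  have "(2*u)\<^sup>2 \<le> 2 * u" using u power_decreasing[of 1 2 "2 * u"] by simp
  with S2 have S3: "S \<le> 4 * u" by simp
  have cl: "cosh (2 * l) = cosh (2 * u)" unfolding u_def by (cases "l \<ge> 0") auto
  have "l' = u - q / m * S \<or> l' = - (u - q / m * S)"
    unfolding u_def S_def l'_def by (cases "l \<ge> 0") auto
  then have sl: "\<bar>l'\<bar> = \<bar>u - q / m * S\<bar>" "l'\<^sup>2 = (u - q / m * S)\<^sup>2"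
    by (metis abs_minus_cancel, metis power2_minus)
  have qm: "0 \<le> q / m" "q / m \<le> 1/4" using q m by (auto simp: field_simps)
  \<comment> \<open>The shift does not overshoot 0, as q / m <= 1/4 and sinh (2 u) <= 4 u; this is
    what allows the comparison of squares below.\<close>
  have "q / m * S \<le> 1/4 * (4 * u)" using qm S3 S1 u by (intro mult_mono) auto
  then have p: "0 \<le> u - q / m * S" by simp
  have "q / m * (2 * u) \<le> q / m * S" using qm S1 by (intro mult_left_mono) auto
  then have p2: "u - q / m * S \<le> u * (1 - 2 * q / m)" by (simp add: algebra_simps)
  have f: "0 \<le> 1 - 2 * q / m" "1 - 2 * q / m \<le> 1" 
    using qm unfolding times_divide_eq_right[symmetric] by linarith+
  have "u * (1 - 2 * q / m) \<le> u" using f u by (simp add: mult_left_le)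
  then show "\<bar>l'\<bar> \<le> 1/2" using order_trans[OF order_trans[OF p2 _] u(2)]
    unfolding sl(1) abs_of_nonneg[OF p] by blast
  have "(u - q / m * S)\<^sup>2 \<le> (u * (1 - 2 * q / m))\<^sup>2" using p p2 by (intro power_mono)
  also have "\<dots> = u\<^sup>2 * (1 - 2 * q / m) * (1 - 2 * q / m)" by (simp add: power2_eq_square)
  also have "\<dots> \<le> u\<^sup>2 * (1 - 2 * q / m)" using f by (intro mult_left_le) auto
  finally have "4 * m * l'\<^sup>2 \<le> 4 * m * (u\<^sup>2 * (1 - 2 * q / m))"
    using sl m by (intro mult_left_mono) auto
  also have "\<dots> = 4 * m * u\<^sup>2 - 8 * q * u\<^sup>2" using m by (simp add: field_simps)
  finally have A: "4 * m * l'\<^sup>2 \<le> 4 * m * l\<^sup>2 - 8 * q * u\<^sup>2" by (simp add: u_def)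
  have B: "q * (cosh (2 * l) - 1) \<le> 4 * (q * u\<^sup>2)"
    unfolding cl using mult_left_mono[OF c q(1)] by (simp add: power2_eq_square)
  have "m * t * l' - m * (t * (1 - 2 * q / m)) * l = (t * q) * (2 * l - sinh (2 * l))"
    using m unfolding l'_def by (simp add: field_simps)
  also have "\<dots> \<le> (t * q) * (S - 2 * u)"
    using t q S1 unfolding u_def S_def
    by (intro mult_left_mono) (cases "l \<ge> 0"; simp)+
  also have "\<dots> \<le> 1 * q * (4 * u\<^sup>2)"
    using t q S1 S2 by (intro mult_mono) (auto simp: power2_eq_square)
  finally show "q * (cosh (2 * l) - 1) + (m * t * l' + 4 * m * l'\<^sup>2)
      \<le> m * (t * (1 - 2 * q / m)) * l + 4 * m * l\<^sup>2"
    using A B by (simp add: algebra_simps)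
qed

section \<open>Adding one key to a block of signs\<close>

lemma expectation_bind_finite:
  fixes f :: "'b \<Rightarrow> real"
  assumes "finite (set_pmf p)" and "\<And>x. x \<in> set_pmf p \<Longrightarrow> finite (set_pmf (q x))"
  shows "measure_pmf.expectation (bind_pmf p q) f =
    measure_pmf.expectation p (\<lambda>x. measure_pmf.expectation (q x) f)"
  using assms by (subst pmf_expectation_bind[of "set_pmf p"])
    (auto simp: integral_measure_pmf[of "set_pmf p"])

lemma expectation_mono_finite:
  fixes f g :: "'a \<Rightarrow> real"
  assumes "finite (set_pmf p)" and "\<And>x. x \<in> set_pmf p \<Longrightarrow> f x \<le> g x"
  shows "measure_pmf.expectation p f \<le> measure_pmf.expectation p g"
  using assms by (auto simp: integral_measure_pmf[of "set_pmf p"] intro!: sum_mono mult_left_mono)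

text \<open>Negating the sign \<open>s c\<close> changes the sum by -2 s_c, and exp (- 2 l s) = cosh
  (2 l) - s sinh (2 l) for s = 1 and for s = -1. Summing over c therefore leaves a factor that is
  affine in the sum of the signs.\<close>

lemma sum_exp_sign_flip:
  fixes s :: "nat \<Rightarrow> real"
  assumes s: "\<And>b. b < m \<Longrightarrow> s b = 1 \<or> s b = -1"
  shows "(\<Sum>c<m. exp (l * (\<Sum>b<m. s b * (if c = b then -1 else 1)))) =
    exp (l * (\<Sum>b<m. s b)) * (real m * cosh (2 * l) - (\<Sum>b<m. s b) * sinh (2 * l))"
proof -
  let ?Z = "\<Sum>b<m. s b"
  have "exp (l * (\<Sum>b<m. s b * (if c = b then -1 else 1))) =
      exp (l * ?Z) * (cosh (2 * l) - s c * sinh (2 * l))" if c: "c < m" for c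
  proof -
    have "(\<Sum>b<m. s b * (if c = b then -1 else 1)) = (\<Sum>b<m. s b - (if c = b then 2 * s b else 0))"
      by (intro sum.cong) auto
    also have "\<dots> = ?Z - 2 * s c" using c by (simp add: sum_subtractf sum.delta')
    finally have "exp (l * (\<Sum>b<m. s b * (if c = b then -1 else 1))) = exp (l * (?Z - 2 * s c))"
      by (rule arg_cong)
    also have "\<dots> = exp (l * ?Z) * exp (- 2 * l * s c)"
      by (simp add: exp_add[symmetric] algebra_simps)
    finally have "exp (l * (\<Sum>b<m. s b * (if c = b then -1 else 1))) = exp (l * ?Z) * exp (- 2 * l * s c)" .
    moreover have "exp (- 2 * l * s c) = cosh (2 * l) - s c * sinh (2 * l)"
      using s[OF c] by (auto simp: cosh_def sinh_def field_simps)
    ultimately show ?thesis by simp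
  qed
  then have "(\<Sum>c<m. exp (l * (\<Sum>b<m. s b * (if c = b then -1 else 1)))) =
      (\<Sum>c<m. exp (l * ?Z) * (cosh (2 * l) - s c * sinh (2 * l)))" by simp
  also have "\<dots> = exp (l * ?Z) * (real m * cosh (2 * l) - ?Z * sinh (2 * l))"
    by (simp add: sum_distrib_left[symmetric] sum_subtractf sum_distrib_right)
  finally show ?thesis .
qed

text \<open>
  One key negates a random sign with probability \<open>q\<close>.  The resulting factor is affine in the sum of
  the signs, so \<open>1 + x \<le> exp x\<close> turns it into a change of the parameter \<open>l\<close>.
\<close>

lemma mgf_key:
  fixes s :: "nat \<Rightarrow> real" and A :: "nat set" and m r :: nat
  assumes s: "\<And>b. b < m \<Longrightarrow> s b = 1 \<or> s b = -1" and m: "0 < m" and r: "0 < r"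
  defines "q \<equiv> real (card (A \<inter> {0..<r})) / real r"
  shows "measure_pmf.expectation (pmf_of_set {0..<r}) (\<lambda>a.
      measure_pmf.expectation (pmf_of_set {0..<m}) (\<lambda>c.
        exp (l * (\<Sum>b<m. s b * (if a \<in> A \<and> c = b then -1 else 1)))))
    \<le> exp (q * (cosh (2 * l) - 1)) * exp ((l - q / real m * sinh (2 * l)) * (\<Sum>b<m. s b))"
proof -
  let ?Z = "\<Sum>b<m. s b"
  let ?F = "cosh (2 * l) - ?Z / real m * sinh (2 * l)"
  have inner: "measure_pmf.expectation (pmf_of_set {0..<m}) (\<lambda>c.
        exp (l * (\<Sum>b<m. s b * (if a \<in> A \<and> c = b then -1 else 1)))) =
      exp (l * ?Z) * (if a \<in> A then ?F else 1)" for a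
  proof (cases "a \<in> A")
    case True
    have "measure_pmf.expectation (pmf_of_set {0..<m}) (\<lambda>c.
        exp (l * (\<Sum>b<m. s b * (if c = b then -1 else 1)))) =
        (\<Sum>c<m. exp (l * (\<Sum>b<m. s b * (if c = b then -1 else 1)))) / real m"
      using m by (subst integral_pmf_of_set) (auto simp: atLeast0LessThan)
    with True m sum_exp_sign_flip[of m s l, OF s] show ?thesis
      by (simp add: field_simps)
  next
    case False
    then show ?thesis using m by simp
  qed
  have "measure_pmf.expectation (pmf_of_set {0..<r}) (\<lambda>a.
      exp (l * ?Z) * (if a \<in> A then ?F else 1)) =
    exp (l * ?Z) * ((\<Sum>a\<in>{0..<r}. 1 + (if a \<in> A then ?F - 1 else 0)) / real r)"
    using r by (subst integral_pmf_of_set) (auto simp: sum_distrib_left[symmetric] intro!: sum.cong)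
  also have "(\<Sum>a\<in>{0..<r}. 1 + (if a \<in> A then ?F - 1 else 0)) = real r + real (card (A \<inter> {0..<r})) * (?F - 1)"
    by (simp add: sum.distrib sum.inter_restrict[symmetric] Int_commute)
  also have "\<dots> / real r = 1 + q * (?F - 1)" using r by (simp add: q_def field_simps)
  also have "exp (l * ?Z) * (1 + q * (?F - 1)) \<le> exp (l * ?Z) * exp (q * (?F - 1))"
    by (intro mult_left_mono) (auto simp: exp_ge_add_one_self)
  also have "\<dots> = exp (q * (cosh (2 * l) - 1)) * exp ((l - q / real m * sinh (2 * l)) * ?Z)"
    by (simp add: exp_add[symmetric] algebra_simps)
  finally show ?thesis by (simp only: inner)
qed


section \<open>Averaging over the hash values of all keys\<close>

lemma finite_set_Pi_pmf_of_set:
  assumes "finite A" and "\<And>x. x \<in> A \<Longrightarrow> 0 < r x"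
  shows "finite (set_pmf (Pi_pmf A d (\<lambda>x. pmf_of_set {0..<r x :: nat})))"
proof -
  have "set_pmf (Pi_pmf A d (\<lambda>x. pmf_of_set {0..<r x})) \<subseteq> PiE_dflt A d (\<lambda>x. {0..<r x})"
    using assms by (subst set_Pi_pmf) (auto simp: PiE_dflt_def)
  moreover have "finite (PiE_dflt A d (\<lambda>x. {0..<r x}))"
    using assms by (intro finite_PiE_dflt) auto
  ultimately show ?thesis by (rule finite_subset)
qed

text \<open>The key set is an arbitrary \<open>J\<close> instead of an initial segment, because the
  induction over keys passes through subsets of the universe.\<close>

abbreviation hash_pmf :: "(nat \<Rightarrow> nat) \<Rightarrow> nat set \<Rightarrow> (nat \<times> nat \<Rightarrow> nat) pmf" where
  "hash_pmf r J \<equiv> Pi_pmf ({0..<2} \<times> J) 0 (\<lambda>(f, j). pmf_of_set {0..<r f})"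

lemma finite_hash_pmf:
  assumes "finite J" "0 < r 0" "0 < r (1::nat)"
  shows "finite (set_pmf (hash_pmf r J))"
proof -
  have "0 < r (fst x)" if "x \<in> {0..<2} \<times> J" for x
    using that assms by (auto simp: less_2_cases_iff)
  from finite_set_Pi_pmf_of_set[of "{0..<2} \<times> J" "\<lambda>x. r (fst x)", OF _ this] assms(1)
  show ?thesis by (simp add: case_prod_unfold)
qed

text \<open>The values of the new key are averaged innermost, with the hash values of all other keys
  fixed; in this order the bound for a single key applies pointwise.\<close>

lemma expectation_hash_insert:
  fixes F :: "_ \<Rightarrow> real"
  assumes J: "finite J" "j \<notin> J" and r: "0 < r 0" "0 < r (1::nat)"
  shows "measure_pmf.expectation (hash_pmf r (insert j J)) F =
    measure_pmf.expectation (hash_pmf r J) (\<lambda>h.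
      measure_pmf.expectation (pmf_of_set {0..<r 0}) (\<lambda>a.
        measure_pmf.expectation (pmf_of_set {0..<r 1}) (\<lambda>c. F (h((1, j) := c, (0, j) := a)))))"
proof -
  have eq: "{0..<2::nat} \<times> insert j J = insert (0, j) (insert (1, j) ({0..<2} \<times> J))"
    by (auto simp: less_2_cases_iff)
  have "hash_pmf r (insert j J) =
      pmf_of_set {0..<r 0} \<bind> (\<lambda>a. pmf_of_set {0..<r 1} \<bind> (\<lambda>c. hash_pmf r J \<bind>
        (\<lambda>h. return_pmf (h((1, j) := c, (0, j) := a)))))"
    unfolding eq using J
    by (subst Pi_pmf_insert', simp, simp, subst Pi_pmf_insert')
       (auto simp: bind_assoc_pmf bind_return_pmf)
  also have "\<dots> = pmf_of_set {0..<r 0} \<bind> (\<lambda>a. hash_pmf r J \<bind> (\<lambda>h. pmf_of_set {0..<r 1} \<bind>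
        (\<lambda>c. return_pmf (h((1, j) := c, (0, j) := a)))))"
    by (subst bind_commute_pmf) simp
  also have "\<dots> = hash_pmf r J \<bind> (\<lambda>h. pmf_of_set {0..<r 0} \<bind> (\<lambda>a. pmf_of_set {0..<r 1} \<bind>
        (\<lambda>c. return_pmf (h((1, j) := c, (0, j) := a)))))"
    by (rule bind_commute_pmf)
  finally show ?thesis
    using finite_hash_pmf[OF J(1) r] r
    by (simp add: expectation_bind_finite)
qed

text \<open>Averaging over the last key first leaves the same expression for the other keys at the
  parameter \<open>l'\<close>, so the induction hypothesis has to hold for all \<open>l\<close> in
  the interval. \<open>base\<close> is the bound for the initial signs, later supplied by the noise;
  every key scales \<open>t\<close> by its factor 1 - 2 q_j / m.\<close>

lemma mgf_keys:
  fixes s0 :: "'x \<Rightarrow> nat \<Rightarrow> real" and A :: "nat \<Rightarrow> nat set" and r :: "nat \<Rightarrow> nat" and t :: real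
  defines "m \<equiv> r 1"
  defines "q \<equiv> \<lambda>j. real (card (A j \<inter> {0..<r 0})) / real (r 0)"
  assumes J: "finite J" and P: "finite (set_pmf P)"
    and s0: "\<And>x b. s0 x b = 1 \<or> s0 x b = -1"
    and m: "2 \<le> m" and r: "0 < r 0" and t: "0 \<le> t" "t \<le> 1"
    and q: "\<And>j. j \<in> J \<Longrightarrow> q j \<le> 1/2"
    and base: "\<And>l. \<bar>l\<bar> \<le> 1/2 \<Longrightarrow>
      measure_pmf.expectation P (\<lambda>x. exp (l * (\<Sum>b<m. s0 x b))) \<le> exp (real m * t * l + 4 * real m * l\<^sup>2)"
    and l: "\<bar>l\<bar> \<le> 1/2"
  shows "measure_pmf.expectation P (\<lambda>x. measure_pmf.expectation (hash_pmf r J) (\<lambda>h.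
      exp (l * (\<Sum>b<m. s0 x b * (\<Prod>j\<in>J. if h (0, j) \<in> A j \<and> h (1, j) = b then -1 else 1)))))
    \<le> exp (real m * (t * (\<Prod>j\<in>J. 1 - 2 * q j / real m)) * l + 4 * real m * l\<^sup>2)"
  using J q l
proof (induction J arbitrary: l rule: finite_induct)
  case empty
  then show ?case using base by simp
next
  case (insert j J)
  define S where "S x h b = s0 x b * (\<Prod>j\<in>J. if h (0, j) \<in> A j \<and> h (1, j) = b then -1 else 1)"
    for x :: 'x and h :: "nat \<times> nat \<Rightarrow> nat" and b :: nat
  define \<rho> where "\<rho> = (\<Prod>j\<in>J. 1 - 2 * q j / real m)"
  define l' where "l' = l - q j / real m * sinh (2 * l)"
  have S: "S x h b = 1 \<or> S x h b = -1" for x h b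
  proof -
    have "(\<Prod>j\<in>J. if h (0, j) \<in> A j \<and> h (1, j) = b then -1 else 1) \<in> {1, -1 :: real}"
      using insert(1) by (induction J rule: finite_induct) auto
    with s0[of x b] show ?thesis unfolding S_def by auto
  qed
  have q0: "0 \<le> q i" for i by (simp add: q_def)
  have \<rho>: "0 \<le> \<rho>" "\<rho> \<le> 1"
  proof -
    have "0 \<le> 1 - 2 * q i / real m \<and> 1 - 2 * q i / real m \<le> 1" if "i \<in> J" for i
      using insert.prems(1)[of i] that q0[of i] m by (auto simp: field_simps)
    then show "0 \<le> \<rho>" "\<rho> \<le> 1" unfolding \<rho>_def by (auto intro!: prod_nonneg prod_le_1)
  qed
  have t\<rho>: "0 \<le> t * \<rho>" "t * \<rho> \<le> 1" using t \<rho> by (auto intro: mult_le_one)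
  note step = pullback_step[OF insert.prems(2) q0 insert.prems(1)[of j] _ t\<rho>, of "real m"]
  have l': "\<bar>l'\<bar> \<le> 1/2" unfolding l'_def using step(1) m by simp
  have fin: "finite (set_pmf (hash_pmf r J))" using finite_hash_pmf[OF insert(1), of r] r m m_def by simp
  \<comment> \<open>Fresh hash values for \<open>j\<close> leave the factors of the keys in
    \<open>J\<close> untouched, so all old factors can be absorbed into the signs
    \<open>S\<close>.\<close>
  have upd: "s0 x b * (\<Prod>i\<in>insert j J. if (h((1, j) := c, (0, j) := a)) (0, i) \<in> A i \<and>
      (h((1, j) := c, (0, j) := a)) (1, i) = b then -1 else 1) =
      S x h b * (if a \<in> A j \<and> c = b then -1 else 1)" for x h a b c
  proof -
    have "(\<Prod>i\<in>J. if (h((1, j) := c, (0, j) := a)) (0, i) \<in> A i \<and>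
        (h((1, j) := c, (0, j) := a)) (1, i) = b then -1 else 1 :: real) =
      (\<Prod>i\<in>J. if h (0, i) \<in> A i \<and> h (1, i) = b then -1 else 1)"
      using insert(2) by (intro prod.cong) auto
    then show ?thesis using insert(1,2) by (simp add: S_def)
  qed
  have "measure_pmf.expectation P (\<lambda>x. measure_pmf.expectation (hash_pmf r (insert j J)) (\<lambda>h.
      exp (l * (\<Sum>b<m. s0 x b * (\<Prod>i\<in>insert j J. if h (0, i) \<in> A i \<and> h (1, i) = b then -1 else 1)))))
    = measure_pmf.expectation P (\<lambda>x. measure_pmf.expectation (hash_pmf r J) (\<lambda>h.
      measure_pmf.expectation (pmf_of_set {0..<r 0}) (\<lambda>a.
        measure_pmf.expectation (pmf_of_set {0..<m}) (\<lambda>c.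
          exp (l * (\<Sum>b<m. S x h b * (if a \<in> A j \<and> c = b then -1 else 1)))))))"
    using insert(1,2) r m by (subst expectation_hash_insert) (simp_all only: upd m_def not_False_eq_True)
  also have "\<dots> \<le> measure_pmf.expectation P (\<lambda>x. measure_pmf.expectation (hash_pmf r J) (\<lambda>h.
      exp (q j * (cosh (2 * l) - 1)) * exp (l' * (\<Sum>b<m. S x h b))))"
    unfolding l'_def q_def using m r
    by (intro expectation_mono_finite P fin mgf_key S) auto
  also have "\<dots> = exp (q j * (cosh (2 * l) - 1)) *
      measure_pmf.expectation P (\<lambda>x. measure_pmf.expectation (hash_pmf r J) (\<lambda>h. exp (l' * (\<Sum>b<m. S x h b))))"
    by simp
  also have "\<dots> \<le> exp (q j * (cosh (2 * l) - 1)) * exp (real m * (t * \<rho>) * l' + 4 * real m * l'\<^sup>2)"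
    unfolding S_def \<rho>_def by (rule mult_left_mono[OF insert.IH[OF insert.prems(1) l']]) auto
  also have "\<dots> \<le> exp (real m * ((t * \<rho>) * (1 - 2 * q j / real m)) * l + 4 * real m * l\<^sup>2)"
    using step(2) m by (simp add: exp_add[symmetric] l'_def)
  also have "(t * \<rho>) * (1 - 2 * q j / real m) = t * (\<Prod>j\<in>insert j J. 1 - 2 * q j / real m)"
    using insert(1,2) by (simp add: \<rho>_def mult_ac)
  finally show ?case .
qed

section \<open>Two-sided tail bound\<close>

lemma prob_eq_expectation_indicator:
  "measure_pmf.prob p S = measure_pmf.expectation p (indicator S)"
  by simp

lemma tail_bound_of_mgf:
  fixes Z :: "'a \<Rightarrow> real"
  assumes p: "finite (set_pmf p)" and d: "0 \<le> d" "d \<le> 4"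
    and mgf: "\<And>l. \<bar>l\<bar> \<le> 1/2 \<Longrightarrow>
      measure_pmf.expectation p (\<lambda>x. exp (l * Z x)) \<le> exp (\<mu> * l + 4 * m * l\<^sup>2)"
  shows "measure_pmf.prob p {x. d * m \<le> \<bar>Z x - \<mu>\<bar>} \<le> 2 * exp (- (m * d\<^sup>2 / 16))"
proof -
  have one: "measure_pmf.prob p {x. d * m \<le> \<sigma> * (Z x - \<mu>)} \<le> exp (- (m * d\<^sup>2 / 16))"
    if \<sigma>: "\<sigma> = 1 \<or> \<sigma> = -1" for \<sigma> :: real
  proof -
    \<comment> \<open>For m > 0 the exponent 4 m l^2 - d m \<bar>l\<bar> is smallest at
      \<bar>l\<bar> = d / 8, where it equals - m d^2 / 16; \<open>d \<le> 4\<close> keeps this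
      within the range of \<open>mgf\<close>. The sign \<open>\<sigma>\<close> selects the
      tail.\<close>
    define l where "l = \<sigma> * d / 8"
    have l: "\<bar>l\<bar> \<le> 1/2" using \<sigma> d by (auto simp: l_def)
    have l2: "l\<^sup>2 = d\<^sup>2 / 64" and ls: "l * \<sigma> = d / 8" using \<sigma> by (auto simp: l_def power2_eq_square)
    have "measure_pmf.prob p {x. d * m \<le> \<sigma> * (Z x - \<mu>)} =
        measure_pmf.expectation p (indicator {x. d * m \<le> \<sigma> * (Z x - \<mu>)})"
      by (rule prob_eq_expectation_indicator)
    also have "\<dots> \<le> measure_pmf.expectation p (\<lambda>x. exp (- l * \<mu> - d\<^sup>2 * m / 8) * exp (l * Z x))"
    proof (intro expectation_mono_finite p)
      fix x
      have "exp (- l * \<mu> - d\<^sup>2 * m / 8) * exp (l * Z x) = exp (d / 8 * (\<sigma> * (Z x - \<mu>) - d * m))"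
        by (simp add: exp_add[symmetric] l_def power2_eq_square algebra_simps)
      moreover have "d * m \<le> \<sigma> * (Z x - \<mu>) \<Longrightarrow> 0 \<le> d / 8 * (\<sigma> * (Z x - \<mu>) - d * m)"
        using d by (intro mult_nonneg_nonneg) auto
      ultimately show "indicator {x. d * m \<le> \<sigma> * (Z x - \<mu>)} x
          \<le> exp (- l * \<mu> - d\<^sup>2 * m / 8) * exp (l * Z x)"
        by (auto simp: indicator_def)
    qed
    also have "\<dots> = exp (- l * \<mu> - d\<^sup>2 * m / 8) * measure_pmf.expectation p (\<lambda>x. exp (l * Z x))"
      by simp
    also have "\<dots> \<le> exp (- l * \<mu> - d\<^sup>2 * m / 8) * exp (\<mu> * l + 4 * m * l\<^sup>2)"
      by (intro mult_left_mono mgf l) auto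
    also have "\<dots> = exp (- (m * d\<^sup>2 / 16))"
      by (simp add: exp_add[symmetric] l2 field_simps)
    finally show ?thesis .
  qed
  have "{x. d * m \<le> \<bar>Z x - \<mu>\<bar>} \<subseteq> {x. d * m \<le> 1 * (Z x - \<mu>)} \<union> {x. d * m \<le> (-1) * (Z x - \<mu>)}"
    by (auto simp: abs_if split: if_splits)
  then have "measure_pmf.prob p {x. d * m \<le> \<bar>Z x - \<mu>\<bar>}
      \<le> measure_pmf.prob p ({x. d * m \<le> 1 * (Z x - \<mu>)} \<union> {x. d * m \<le> (-1) * (Z x - \<mu>)})"
    by (intro measure_pmf.finite_measure_mono) auto
  also have "\<dots> \<le> measure_pmf.prob p {x. d * m \<le> 1 * (Z x - \<mu>)}
      + measure_pmf.prob p {x. d * m \<le> (-1) * (Z x - \<mu>)}"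
    by (intro measure_Un_le) auto
  also have "\<dots> \<le> 2 * exp (- (m * d\<^sup>2 / 16))" using one[of 1] one[of "-1"] by simp
  finally show ?thesis .
qed

subsection \<open>Inverting the expected decay\<close>

text \<open>Each x = 2 q_j / m is at most 1 / m, so - ln (1 - x) lies between x and x + 2 x^2 <= x
  (1 + 2 / m). Thus the decay depends on the individual rates only through their sum, up to a
  relative error of order 1 / m.\<close>

lemma neg_ln_prod_bounds:
  fixes q :: "'a \<Rightarrow> real" and m :: real
  assumes J: "finite J" and q: "\<And>j. j \<in> J \<Longrightarrow> 0 \<le> q j \<and> q j \<le> 1/2" and m: "2 \<le> m"
  defines "Q \<equiv> \<Sum>j\<in>J. q j" and "\<rho> \<equiv> \<Prod>j\<in>J. 1 - 2 * q j / m"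
  shows "0 < \<rho>" "2 * Q / m \<le> - ln \<rho>" "- ln \<rho> \<le> 2 * Q / m * (1 + 2 / m)"
proof -
  have x: "0 \<le> 2 * q j / m \<and> 2 * q j / m \<le> 1 / m \<and> 2 * q j / m \<le> 1/2" if "j \<in> J" for j
    using q[OF that] m by (auto simp: field_simps)
  have pos: "0 < 1 - 2 * q j / m" if "j \<in> J" for j using x[OF that] by linarith
  then show "0 < \<rho>" unfolding \<rho>_def by (intro prod_pos) auto
  have ln: "- ln \<rho> = (\<Sum>j\<in>J. - ln (1 - 2 * q j / m))"
    unfolding \<rho>_def using pos by (subst ln_prod[OF J]) (force simp: sum_negf)+
  have "2 * Q / m = (\<Sum>j\<in>J. 2 * q j / m)"
    by (simp add: Q_def sum_distrib_left sum_divide_distrib)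
  also have "\<dots> \<le> - ln \<rho>" unfolding ln
  proof (rule sum_mono)
    fix j assume "j \<in> J"
    then show "2 * q j / m \<le> - ln (1 - 2 * q j / m)"
      using ln_one_minus_pos_upper_bound[of "2 * q j / m"] x[of j] by fastforce
  qed
  finally show "2 * Q / m \<le> - ln \<rho>" .
  have "- ln \<rho> \<le> (\<Sum>j\<in>J. 2 * q j / m * (1 + 2 / m))" unfolding ln
  proof (rule sum_mono)
    fix j assume j: "j \<in> J"
    have "(2 * q j / m)\<^sup>2 \<le> 2 * q j / m * (1 / m)"
      unfolding power2_eq_square using x[OF j] by (intro mult_left_mono) auto
    then show "- ln (1 - 2 * q j / m) \<le> 2 * q j / m * (1 + 2 / m)"
      using ln_one_minus_pos_lower_bound[of "2 * q j / m"] x[OF j]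
      by (simp add: distrib_left)
  qed
  also have "\<dots> = 2 * Q / m * (1 + 2 / m)"
    by (simp add: Q_def sum_distrib_left sum_distrib_right sum_divide_distrib)
  finally show "- ln \<rho> \<le> 2 * Q / m * (1 + 2 / m)" .
qed

text \<open>A discrete logarithm, roughly - m ln R for R between 1/2 and 1, that can be computed
  with field operations and comparisons.\<close>

definition decay_steps :: "nat \<Rightarrow> real \<Rightarrow> nat" where
  "decay_steps m R = (LEAST N. (1 - 1 / real m) ^ N \<le> R)"

text \<open>Since (1 - 1 / m)^m <= exp (-1) <= 1/2, the search ends after at most m factors; this
  also bounds the running time of the search on one level.\<close>

lemma decay_steps:
  assumes m: "2 \<le> m" and R: "1/2 \<le> R"
  shows "(1 - 1 / real m) ^ decay_steps m R \<le> R" "decay_steps m R \<le> m"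
    and "\<And>i. i < decay_steps m R \<Longrightarrow> R < (1 - 1 / real m) ^ i"
proof -
  have "(1 - 1 / real m) ^ m \<le> exp (- 1 / real m) ^ m"
    using exp_ge_add_one_self[of "- 1 / real m"] m by (intro power_mono) (auto simp: field_simps)
  also have "\<dots> = exp (-1)" using m by (simp add: exp_of_nat_mult[symmetric])
  also have "\<dots> \<le> 1/2" using exp_ge_add_one_self[of 1] by (simp add: exp_minus field_simps)
  finally have *: "(1 - 1 / real m) ^ m \<le> R" using R by simp
  show "(1 - 1 / real m) ^ decay_steps m R \<le> R" unfolding decay_steps_def
    by (rule LeastI[of "\<lambda>N. (1 - 1 / real m) ^ N \<le> R", OF *])
  show "decay_steps m R \<le> m" unfolding decay_steps_def
    by (rule Least_le[of "\<lambda>N. (1 - 1 / real m) ^ N \<le> R", OF *])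
  show "R < (1 - 1 / real m) ^ i" if "i < decay_steps m R" for i
    using not_less_Least[of i "\<lambda>N. (1 - 1 / real m) ^ N \<le> R"] that
    unfolding decay_steps_def by simp
qed

text \<open>Three approximations are chained: N factors have total logarithm \<open>N * a\<close> up
  to sign, with \<open>a\<close> close to 1 / m; the first power not above \<open>R\<close> has a
  logarithm close to that of \<open>R\<close>; and \<open>ln\<close> is Lipschitz because
  \<open>R\<close> and \<open>\<rho>\<close> stay above 1/2 and 1/4. Rounding contributes 2 from
  below (the second-order part of \<open>a\<close> over at most m factors) and 4 + 2 from above (the
  error of \<open>- ln \<rho>\<close> and the last factor).\<close>

lemma decay_steps_error:
  fixes m :: nat and R \<rho> d Q :: real
  assumes m: "2 \<le> m" and \<rho>: "0 < \<rho>" "2 * Q / m \<le> - ln \<rho>" "- ln \<rho> \<le> 2 * Q / m * (1 + 2 / m)"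
    and Q: "0 \<le> Q" and R: "1/2 \<le> R" and d: "\<bar>R - \<rho>\<bar> \<le> d" "d \<le> 1/4"
  shows "\<bar>real (decay_steps m R) - 2 * Q\<bar> \<le> 6 + 4 * d * m"
proof -
  define N where "N = decay_steps m R"
  define a where "a = - ln (1 - 1 / real m)"
  define y where "y = - ln \<rho>"
  note N = decay_steps[OF m R, folded N_def]
  have \<rho>4: "1/4 \<le> \<rho>" using R d by linarith
  have m0: "0 < 1 - 1 / real m" "1 / real m \<le> 1/2" using m by (auto simp: field_simps)
  have a: "1 / real m \<le> a" "a \<le> 1 / real m + 2 * (1 / real m)\<^sup>2"
    using ln_one_minus_pos_lower_bound[of "1 / real m"] ln_one_minus_pos_upper_bound[of "1 / real m"] m m0
    by (auto simp: a_def)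
  have pw: "ln ((1 - 1 / real m) ^ i) = - (real i * a)" for i
    using m0 by (simp add: ln_realpow a_def)
  have "ln \<rho> \<ge> ln (1/4)" using \<rho>4 by simp
  moreover have "ln (4::real) \<le> 2" using ln_le_minus_one[of 2] ln_mult[of 2 "2::real"] by simp
  ultimately have y2: "y \<le> 2" unfolding y_def by (simp add: ln_div)
  have "0 \<le> 2 * Q / m" using Q by simp
  then have y0: "0 \<le> y" using \<rho>(2) by (simp add: y_def)
  have "ln \<rho> - ln R \<le> 2 * d"
  proof -
    have "ln \<rho> - ln R = ln (\<rho> / R)" using R \<rho> by (simp add: ln_div)
    also have "\<dots> \<le> \<rho> / R - 1" using R \<rho> by (intro ln_le_minus_one) auto
    also have "\<dots> = (\<rho> - R) / R" using R by (simp add: field_simps)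
    also have "\<dots> \<le> d / (1/2)" using R d by (intro frac_le) auto
    finally show ?thesis by simp
  qed
  then have up: "- ln R \<le> y + 2 * d" by (simp add: y_def)
  have "ln R - ln \<rho> \<le> 4 * d"
  proof -
    have "ln R - ln \<rho> = ln (R / \<rho>)" using R \<rho> by (simp add: ln_div)
    also have "\<dots> \<le> R / \<rho> - 1" using R \<rho> by (intro ln_le_minus_one) auto
    also have "\<dots> = (R - \<rho>) / \<rho>" using \<rho> by (simp add: field_simps)
    also have "\<dots> \<le> d / (1/4)" using \<rho>4 d by (intro frac_le) auto
    finally show ?thesis by simp
  qed
  then have lo: "y - 4 * d \<le> - ln R" by (simp add: y_def)
  have "ln ((1 - 1 / real m) ^ N) \<le> ln R" using N(1) m0 R by (subst ln_le_cancel_iff) auto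
  then have A: "y - 4 * d \<le> real N * a" using lo pw by simp
  \<comment> \<open>The power with exponent N - 1 still exceeds \<open>R\<close>, so N overshoots by
    at most one factor; for N = 0 the right-hand side is nonnegative.\<close>
  have B: "real N * a \<le> y + 2 * d + a"
  proof (cases N)
    case 0
    moreover have "0 \<le> a" using a(1) by (rule order_trans[rotated]) simp
    moreover have "0 \<le> d" using d(1) by (rule order_trans[rotated]) simp
    ultimately show ?thesis using y0 by simp
  next
    case (Suc i)
    have "ln R \<le> ln ((1 - 1 / real m) ^ i)" using N(3)[of i] Suc m0 R by (subst ln_le_cancel_iff) auto
    then have "real i * a \<le> y + 2 * d" using up pw by simp
    then show ?thesis using Suc by (simp add: algebra_simps)
  qed
  have "real N * a \<le> real N * (1 / real m + 2 * (1 / real m)\<^sup>2)" using a by (intro mult_left_mono) auto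
  also have "\<dots> = real N / real m + (real N / real m) * (2 / real m)"
    by (simp add: distrib_left power2_eq_square)
  also have "\<dots> \<le> real N / real m + 1 * (2 / real m)"
    using N(2) m by (intro add_left_mono mult_right_mono) auto
  finally have "y - 4 * d \<le> real N / real m + 2 / real m" using A by simp
  then have "2 * Q / m - 4 * d \<le> real N / real m + 2 / real m" using \<rho>(2) by (simp add: y_def)
  from mult_right_mono[OF this, of "real m"]
  have low: "2 * Q - 4 * d * m \<le> real N + 2" using m by (simp add: left_diff_distrib distrib_right)
  have "(2 * Q / m) * (2 / real m) \<le> 2 * (2 / real m)"
    using \<rho>(2) y2 m by (intro mult_right_mono) (auto simp: y_def)
  then have y3: "y \<le> 2 * Q / m + 4 / real m" using \<rho>(3) by (simp add: y_def distrib_left)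
  have "2 * (1 / real m)\<^sup>2 \<le> 1 / real m"
    using m0 m by (simp add: power2_eq_square field_simps)
  then have a2: "a \<le> 2 / real m" using a by (simp add: field_simps)
  have "real N * (1 / real m) \<le> real N * a" using a by (intro mult_left_mono) auto
  then have "real N / real m \<le> 2 * Q / m + 4 / real m + 2 * d + 2 / real m" using B y3 a2 by simp
  from mult_right_mono[OF this, of "real m"]
  have "real N \<le> 2 * Q + 6 + 2 * d * m" using m by (simp add: distrib_right)
  moreover have "0 \<le> d * m" using d by (intro mult_nonneg_nonneg) auto
  ultimately show ?thesis using low unfolding N_def[symmetric] by (simp add: abs_le_iff)
qed

text \<open>Higher levels take precedence, so the last one with ratio at least 1/2 decides. The
  count approximates 2 W 2^k / 2^L, which explains the scaling; \<open>2 ^ k + 2 ^ k\<close> mirrors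
  the program, whose integers can only be added and subtracted.\<close>

primrec level_estimate :: "(nat \<Rightarrow> real) \<Rightarrow> nat \<Rightarrow> nat \<Rightarrow> nat \<Rightarrow> real" where
  "level_estimate R m L 0 = 0"
| "level_estimate R m L (Suc k) = (if R k < 1/2 then level_estimate R m L k
     else real (decay_steps m (R k)) * 2 ^ L / (2 ^ k + 2 ^ k))"

text \<open>The failure of the level after the chosen one is recorded because it is what bounds the
  load from below and turns an additive error into a relative one.\<close>

lemma level_estimate_cases:
  assumes "0 < k" and "1/2 \<le> R 0"
  obtains l where "l < k" "1/2 \<le> R l" "Suc l = k \<or> R (Suc l) < 1/2"
    "level_estimate R m L k = real (decay_steps m (R l)) * 2 ^ L / (2 ^ l + 2 ^ l)"
proof -
  have "\<exists>l<k. 1/2 \<le> R l \<and> (Suc l = k \<or> R (Suc l) < 1/2) \<and>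
      level_estimate R m L k = real (decay_steps m (R l)) * 2 ^ L / (2 ^ l + 2 ^ l)"
    using assms(1)
  proof (induction k)
    case (Suc k)
    show ?case
    proof (cases "R k < 1/2")
      case True
      with assms(2) have "0 < k" by (cases k) auto
      from Suc.IH[OF this] obtain l where "l < k" "1/2 \<le> R l" "Suc l = k \<or> R (Suc l) < 1/2"
        "level_estimate R m L k = real (decay_steps m (R l)) * 2 ^ L / (2 ^ l + 2 ^ l)" by auto
      then show ?thesis using True by (intro exI[of _ l]) auto
    qed (auto intro: exI[of _ k])
  qed simp
  with that show thesis by blast
qed

text \<open>The count at the chosen level is off by at most 8 + \<beta> m / 64, and the scale
  \<open>s\<close> turns this into an error of the weight. At the last level s = 1, and 2 m absorbs
  the error. Elsewhere the next level has dropped below 1/2, so its load is at least m / 16; hence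
  \<open>s * m\<close> is at most 32 W and the error is at most \<beta> W.\<close>

lemma level_estimate_error:
  fixes W \<beta> :: real and Q \<rho> R :: "nat \<Rightarrow> real" and m L :: nat
  assumes L: "0 < L" and \<beta>: "0 < \<beta>" "\<beta> < 1" and m: "512 / \<beta> \<le> real m"
    and W: "0 \<le> W" "W \<le> 2 ^ L"
    and Q: "\<And>l. l < L \<Longrightarrow> W * 2 ^ l / 2 ^ L \<le> Q l \<and> Q l \<le> W * 2 ^ l / 2 ^ L + 1"
    and \<rho>: "\<And>l. l < L \<Longrightarrow> 0 < \<rho> l \<and> 2 * Q l / m \<le> - ln (\<rho> l) \<and>
      - ln (\<rho> l) \<le> 2 * Q l / m * (1 + 2 / m)"
    and R: "\<And>l. l < L \<Longrightarrow> \<bar>R l - \<rho> l\<bar> \<le> \<beta> / 256"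
  shows "\<bar>level_estimate R m L L - W\<bar> \<le> \<beta> * W + 2 * real m"
proof -
  have "512 < 512 / \<beta>" using \<beta> by (simp add: field_simps)
  with m have m512: "512 < real m" by linarith
  have m2: "2 \<le> m" using m512 by linarith
  have Q0: "0 \<le> Q l" if "l < L" for l
    using Q[OF that] W(1) by (meson divide_nonneg_nonneg mult_nonneg_nonneg order_trans zero_le_numeral zero_le_power)
  have "W / 2 ^ L \<le> 1" using W by simp
  then have "Q 0 \<le> 2" using Q[OF L] unfolding power_0 mult_1_right by linarith
  \<comment> \<open>Level 0 always qualifies: its load is at most 2, far below m, so
    \<open>\<rho> 0\<close> is at least 3/4.\<close>
  then have "2 * Q 0 / m * (1 + 2 / m) \<le> (4 / m) * 2"
    using m512 Q0[OF L] by (intro mult_mono) (auto simp: divide_right_mono)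
  also have "\<dots> \<le> 1/4" using m512 by (simp add: field_simps)
  finally have "ln (\<rho> 0) \<ge> - 1/4" using \<rho>[OF L] by linarith
  then have "\<rho> 0 \<ge> 3/4" using ln_le_minus_one[of "\<rho> 0"] \<rho>[OF L] by linarith
  then have R0: "1/2 \<le> R 0" using R[OF L] \<beta> by linarith
  obtain l where l: "l < L" "1/2 \<le> R l" "Suc l = L \<or> R (Suc l) < 1/2"
    "level_estimate R m L L = real (decay_steps m (R l)) * 2 ^ L / (2 ^ l + 2 ^ l)"
    using level_estimate_cases[of L R m L, OF L R0] by blast
  define N where "N = real (decay_steps m (R l))"
  define s where "s = (2::real) ^ L / (2 ^ l + 2 ^ l)"
  have s0: "0 < s" by (simp add: s_def)
  have Ws: "s * (2 * (W * 2 ^ l / 2 ^ L)) = W" by (simp add: s_def field_simps)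
  have "\<bar>N - 2 * Q l\<bar> \<le> 6 + 4 * (\<beta> / 256) * m"
    unfolding N_def using \<rho>[OF l(1)] R[OF l(1)] Q0[OF l(1)] \<beta> m2 l(2)
    by (intro decay_steps_error[of m "\<rho> l"]) auto
  \<comment> \<open>Twice the slack of 1 in \<open>Q\<close> raises the constant from 6 to
    8.\<close>
  then have "\<bar>N - 2 * (W * 2 ^ l / 2 ^ L)\<bar> \<le> 8 + \<beta> * m / 64"
    using Q[OF l(1)] by (simp add: abs_le_iff)
  then have "s * \<bar>N - 2 * (W * 2 ^ l / 2 ^ L)\<bar> \<le> s * (8 + \<beta> * m / 64)"
    using s0 by (intro mult_left_mono) auto
  also have "s * \<bar>N - 2 * (W * 2 ^ l / 2 ^ L)\<bar> = \<bar>s * (N - 2 * (W * 2 ^ l / 2 ^ L))\<bar>"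
    using s0 by (simp add: abs_mult)
  also have "s * (N - 2 * (W * 2 ^ l / 2 ^ L)) = level_estimate R m L L - W"
    using Ws l(4) by (simp add: N_def s_def right_diff_distrib)
  finally have err: "\<bar>level_estimate R m L L - W\<bar> \<le> s * (8 + \<beta> * m / 64)" .
  have bm: "0 \<le> \<beta> * m" "\<beta> * m \<le> m" using \<beta> by (auto simp: mult_le_cancel_right2)
  show ?thesis
  proof (cases "Suc l = L")
    case True
    then have "s = 1" unfolding s_def by (auto simp: field_simps)
    then have "\<bar>level_estimate R m L L - W\<bar> \<le> 8 + \<beta> * m / 64" using err by simp
    then have "\<bar>level_estimate R m L L - W\<bar> \<le> 2 * real m" using bm m512 by linarith
    moreover have "0 \<le> \<beta> * W" using W \<beta> by simp
    ultimately show ?thesis by linarith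
  next
    case False
    with l have l': "Suc l < L" "R (Suc l) < 1/2" by auto
    have "\<rho> (Suc l) < 3/4" using R[OF l'(1)] l'(2) \<beta> by linarith
    moreover have "ln (\<rho> (Suc l)) \<le> \<rho> (Suc l) - 1" using \<rho>[OF l'(1)] by (intro ln_le_minus_one) auto
    ultimately have "1/4 \<le> 2 * Q (Suc l) / m * (1 + 2 / m)" using \<rho>[OF l'(1)] by linarith
    also have "\<dots> \<le> 2 * Q (Suc l) / m * 2"
      using m512 Q0[OF l'(1)] by (intro mult_left_mono) auto
    finally have "real m \<le> 16 * Q (Suc l)" using m512 by (simp add: field_simps)
    then have "real m \<le> 32 * (W * 2 ^ Suc l / 2 ^ L)" using Q[OF l'(1)] m512 by linarith
    then have "s * real m \<le> s * (32 * (W * 2 ^ Suc l / 2 ^ L))" using s0 by (intro mult_left_mono) auto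
    also have "\<dots> = 32 * (s * (2 * (W * 2 ^ l / 2 ^ L)))" by simp
    also have "\<dots> = 32 * W" by (simp only: Ws)
    finally have sm: "s * m \<le> 32 * W" .
    \<comment> \<open>The lower bound on m makes the rounding error 8 no larger than the statistical
      error.\<close>
    have "8 \<le> \<beta> * m / 64" using m \<beta> by (simp add: field_simps)
    then have "s * (8 + \<beta> * m / 64) \<le> s * (\<beta> * m / 32)" using s0 by (intro mult_left_mono) auto
    also have "\<dots> = \<beta> / 32 * (s * m)" by simp
    also have "\<dots> \<le> \<beta> / 32 * (32 * W)" using sm \<beta> by (intro mult_left_mono) auto
    finally show ?thesis using err m512 by simp
  qed
qed

subsection \<open>Noise\<close>

text \<open>The samples stay integers until \<open>noise_vec\<close>: the machine draws only uniform
  integers, so the random phase of the sketching program fills its array with exactly this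
  distribution.\<close>

abbreviation raw_noise :: "nat \<Rightarrow> nat \<Rightarrow> (nat \<Rightarrow> nat) pmf" where
  "raw_noise n \<tau> \<equiv> Pi_pmf {0..<\<tau>} 0 (\<lambda>_. pmf_of_set {0..<2 * n + 1})"

definition noise_vec :: "nat \<Rightarrow> nat \<Rightarrow> (nat \<Rightarrow> nat) \<Rightarrow> bit vec" where
  "noise_vec n \<tau> g = vec \<tau> (\<lambda>i. of_bool (g i < n))"

lemma finite_raw_noise: "finite (set_pmf (raw_noise n \<tau>))"
  by (intro finite_set_Pi_pmf_of_set) auto

lemma expectation_threshold:
  fixes \<Phi> :: "bool \<Rightarrow> real"
  shows "measure_pmf.expectation (pmf_of_set {0..<2 * n + 1}) (\<lambda>v. \<Phi> (v < n)) =
    (real n * \<Phi> True + real (n + 1) * \<Phi> False) / real (2 * n + 1)"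
proof -
  have "{0..<2 * n + 1} = {0..<n} \<union> {n..<2 * n + 1}" by auto
  then have "(\<Sum>v\<in>{0..<2 * n + 1}. \<Phi> (v < n)) = (\<Sum>v\<in>{0..<n}. \<Phi> (v < n)) + (\<Sum>v\<in>{n..<2 * n + 1}. \<Phi> (v < n))"
    by (simp only: sum.union_disjoint[OF finite_atLeastLessThan finite_atLeastLessThan ivl_disj_int_two(3)])
  also have "\<dots> = real n * \<Phi> True + real (n + 1) * \<Phi> False" by simp
  finally show ?thesis by (subst integral_pmf_of_set) auto
qed

text \<open>The two outcomes have probabilities n / (2 n + 1) and (n + 1) / (2 n + 1), whose ratio
  is 1 + 1 / n <= 1 + \<epsilon> <= exp \<epsilon>.\<close>

lemma expectation_threshold_flip:
  fixes \<Phi> :: "bool \<Rightarrow> real"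
  assumes \<Phi>: "\<And>c. 0 \<le> \<Phi> c" and n: "0 < n" "1 / real n \<le> \<epsilon>"
  shows "measure_pmf.expectation (pmf_of_set {0..<2 * n + 1}) (\<lambda>v. \<Phi> (\<not> v < n))
    \<le> exp \<epsilon> * measure_pmf.expectation (pmf_of_set {0..<2 * n + 1}) (\<lambda>v. \<Phi> (v < n))"
proof -
  have e: "1 + 1 / real n \<le> exp \<epsilon>" using exp_ge_add_one_self[of \<epsilon>] n by linarith
  have "real n * \<Phi> False + real (n + 1) * \<Phi> True \<le>
      (1 + 1 / real n) * (real n * \<Phi> True + real (n + 1) * \<Phi> False)"
  proof -
    have "(1 + 1 / real n) * (real n * \<Phi> True + real (n + 1) * \<Phi> False) =
        real (n + 1) * \<Phi> True + (1 + 1 / real n) * real (n + 1) * \<Phi> False"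
      using n by (simp add: field_simps)
    moreover have "real n * \<Phi> False \<le> (1 + 1 / real n) * real (n + 1) * \<Phi> False"
      using n \<Phi>[of False] by (intro mult_right_mono) (auto simp: field_simps)
    ultimately show ?thesis by simp
  qed
  also have "\<dots> \<le> exp \<epsilon> * (real n * \<Phi> True + real (n + 1) * \<Phi> False)"
    using e \<Phi> by (intro mult_right_mono) auto
  finally have "(real n * \<Phi> False + real (n + 1) * \<Phi> True) / real (2 * n + 1)
      \<le> exp \<epsilon> * (real n * \<Phi> True + real (n + 1) * \<Phi> False) / real (2 * n + 1)"
    by (rule divide_right_mono) simp
  then show ?thesis
    using expectation_threshold[of n \<Phi>] expectation_threshold[of n "\<lambda>c. \<Phi> (\<not> c)"] by simp
qed

text \<open>Adding \<open>unit_vec \<tau> i\<close> has the same effect as complementing the noise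
  bit \<open>i\<close>. With all other noise bits fixed, the claim is the bound for one bit, which
  is then averaged.\<close>

lemma privacy_unit_shift:
  assumes n: "0 < n" "1 / real n \<le> \<epsilon>" and i: "i < \<tau>" and y: "y \<in> carrier_vec \<tau>"
  shows "measure_pmf.prob (map_pmf (\<lambda>\<phi>. (y + unit_vec \<tau> i) + \<phi>) (map_pmf (noise_vec n \<tau>) (raw_noise n \<tau>))) W
    \<le> exp \<epsilon> * measure_pmf.prob (map_pmf (\<lambda>\<phi>. y + \<phi>) (map_pmf (noise_vec n \<tau>) (raw_noise n \<tau>))) W"
proof -
  define B where "B = {0..<\<tau>} - {i}"
  define \<nu> where "\<nu> = pmf_of_set {0..<2 * n + 1}"
  define \<Phi> :: "(nat \<Rightarrow> nat) \<Rightarrow> bool \<Rightarrow> real" where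
    "\<Phi> f c = indicator W (y + vec \<tau> (\<lambda>k. if k = i then of_bool c else of_bool (f k < n)))" for f c
  have B: "{0..<\<tau>} = insert i B" "finite B" "i \<notin> B" using i by (auto simp: B_def)
  have "raw_noise n \<tau> = \<nu> \<bind> (\<lambda>v. Pi_pmf B 0 (\<lambda>_. \<nu>) \<bind> (\<lambda>f. return_pmf (f(i := v))))"
    unfolding B(1) \<nu>_def using B by (intro Pi_pmf_insert')
  also have "\<dots> = Pi_pmf B 0 (\<lambda>_. \<nu>) \<bind> (\<lambda>f. \<nu> \<bind> (\<lambda>v. return_pmf (f(i := v))))"
    by (rule bind_commute_pmf)
  finally have raw: "raw_noise n \<tau> = \<dots>" .
  have fin: "finite (set_pmf (Pi_pmf B 0 (\<lambda>_. \<nu>)))" unfolding \<nu>_def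
    using B by (intro finite_set_Pi_pmf_of_set) auto
  have fin': "finite (set_pmf \<nu>)" by (simp add: \<nu>_def)
  have E: "measure_pmf.prob (raw_noise n \<tau>) S =
      measure_pmf.expectation (Pi_pmf B 0 (\<lambda>_. \<nu>)) (\<lambda>f. measure_pmf.expectation \<nu> (\<lambda>v. indicator S (f(i := v))))"
    for S
    unfolding prob_eq_expectation_indicator raw using fin fin'
    by (simp add: expectation_bind_finite del: Bochner_Integration.integral_indicator)
  have 1: "y + noise_vec n \<tau> (f(i := v)) = y + vec \<tau> (\<lambda>k. if k = i then of_bool (v < n) else of_bool (f k < n))" for f v
    by (auto simp: noise_vec_def)
  have 2: "y + unit_vec \<tau> i + noise_vec n \<tau> (f(i := v)) =
      y + vec \<tau> (\<lambda>k. if k = i then of_bool (\<not> v < n) else of_bool (f k < n))" for f v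
    using y by (intro eq_vecI) (auto simp: noise_vec_def unit_vec_def)
  have "measure_pmf.prob (map_pmf (\<lambda>\<phi>. (y + unit_vec \<tau> i) + \<phi>) (map_pmf (noise_vec n \<tau>) (raw_noise n \<tau>))) W =
      measure_pmf.expectation (Pi_pmf B 0 (\<lambda>_. \<nu>)) (\<lambda>f. measure_pmf.expectation \<nu> (\<lambda>v. \<Phi> f (\<not> v < n)))"
    unfolding \<Phi>_def 2[symmetric] map_pmf_comp measure_map_pmf E by (simp add: indicator_def)
  also have "\<dots> \<le> measure_pmf.expectation (Pi_pmf B 0 (\<lambda>_. \<nu>)) (\<lambda>f. exp \<epsilon> * measure_pmf.expectation \<nu> (\<lambda>v. \<Phi> f (v < n)))"
    unfolding \<nu>_def using fin[unfolded \<nu>_def] n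
    by (intro expectation_mono_finite expectation_threshold_flip) (auto simp: \<Phi>_def)
  also have "\<dots> = exp \<epsilon> * measure_pmf.expectation (Pi_pmf B 0 (\<lambda>_. \<nu>)) (\<lambda>f. measure_pmf.expectation \<nu> (\<lambda>v. \<Phi> f (v < n)))"
    by simp
  also have "measure_pmf.expectation (Pi_pmf B 0 (\<lambda>_. \<nu>)) (\<lambda>f. measure_pmf.expectation \<nu> (\<lambda>v. \<Phi> f (v < n))) =
      measure_pmf.prob (map_pmf (\<lambda>\<phi>. y + \<phi>) (map_pmf (noise_vec n \<tau>) (raw_noise n \<tau>))) W"
    unfolding \<Phi>_def 1[symmetric] map_pmf_comp measure_map_pmf E by (simp add: indicator_def)
  finally show ?thesis .
qed

text \<open>In characteristic 2, inserting and deleting a key are both addition of the same unit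
  vector, so one equation covers the two directions of \<open>neighboring\<close>.\<close>

lemma set_vec01_neighboring:
  assumes "neighboring S T" "S \<subseteq> {0..<u}" "T \<subseteq> {0..<u}"
  obtains j where "j < u" "set_vec01 u S = set_vec01 u T + unit_vec u j"
proof -
  have one: "\<exists>j<u. j \<notin> S \<and> T = insert j S" if "S \<subseteq> T" "card T = card S + 1" "T \<subseteq> {0..<u}" for S T :: "nat set"
  proof -
    have fin: "finite S" "finite T" using that finite_subset[of _ "{0..<u}"] by auto
    have "card (T - S) = 1" using that fin by (subst card_Diff_subset) auto
    then obtain j where "T - S = {j}" by (auto simp: card_1_singleton_iff)
    with that show ?thesis by (intro exI[of _ j]) auto
  qed
  from assms consider j where "j < u" "j \<notin> S" "T = insert j S" | j where "j < u" "j \<notin> T" "S = insert j T"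
    unfolding neighboring_def using one[of S T] one[of T S] by metis
  then obtain j where "j < u" "j \<notin> S \<and> T = insert j S \<or> j \<notin> T \<and> S = insert j T" by metis
  then have "set_vec01 u S = set_vec01 u T + unit_vec u j"
    by (intro eq_vecI) (auto simp: set_vec01_def)
  with \<open>j < u\<close> that show thesis by blast
qed

text \<open>\<open>H\<close> maps a change of one key to the column of that key. A zero column
  leaves the output distribution as it is, and a unit column is a shift by one bit.\<close>

lemma private_unit_columns:
  assumes H: "H \<in> carrier_mat \<tau> u"
    and col: "\<And>j. j < u \<Longrightarrow> col H j = 0\<^sub>v \<tau> \<or> (\<exists>i<\<tau>. col H j = unit_vec \<tau> i)"
    and n: "0 < n" "1 / real n \<le> \<epsilon>"
  shows "differentially_private \<epsilon> {0..<u}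
    (\<lambda>S. map_pmf (\<lambda>\<phi>. H *\<^sub>v set_vec01 u S + \<phi>) (map_pmf (noise_vec n \<tau>) (raw_noise n \<tau>)))"
  unfolding differentially_private_def
proof safe
  fix S T :: "nat set" and W :: "bit vec set"
  assume *: "S \<subseteq> {0..<u}" "T \<subseteq> {0..<u}" "neighboring S T"
  from set_vec01_neighboring[OF *(3,1,2)] obtain j where
    j: "j < u" "set_vec01 u S = set_vec01 u T + unit_vec u j" .
  have T: "set_vec01 u T \<in> carrier_vec u" by (simp add: set_vec01_def)
  have HS: "H *\<^sub>v set_vec01 u S = H *\<^sub>v set_vec01 u T + col H j"
  proof -
    have "H *\<^sub>v unit_vec u j = col H j"
      using H j(1) by (intro eq_vecI) (auto simp: scalar_prod_right_unit[of j u])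
    then show ?thesis unfolding j(2) using H T by (simp add: mult_add_distrib_mat_vec)
  qed
  have HT: "H *\<^sub>v set_vec01 u T \<in> carrier_vec \<tau>" using H T by simp
  have "1 \<le> exp \<epsilon>" using n by (simp add: order_trans[OF _ n(2)])
  let ?N = "map_pmf (noise_vec n \<tau>) (raw_noise n \<tau>)"
  from col[OF j(1)] show "measure_pmf.prob (map_pmf (\<lambda>\<phi>. H *\<^sub>v set_vec01 u S + \<phi>) ?N) W
    \<le> exp \<epsilon> * measure_pmf.prob (map_pmf (\<lambda>\<phi>. H *\<^sub>v set_vec01 u T + \<phi>) ?N) W"
  proof (elim disjE exE conjE)
    assume "col H j = 0\<^sub>v \<tau>"
    then have "H *\<^sub>v set_vec01 u S = H *\<^sub>v set_vec01 u T" using HS HT by simp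
    then show ?thesis
      using mult_right_mono[OF \<open>1 \<le> exp \<epsilon>\<close>, of "measure_pmf.prob (map_pmf (\<lambda>\<phi>. H *\<^sub>v set_vec01 u T + \<phi>) ?N) W"]
      by (simp only: mult_1 measure_nonneg)
  next
    fix i assume "i < \<tau>" "col H j = unit_vec \<tau> i"
    then show ?thesis using HS privacy_unit_shift[OF n _ HT] by simp
  qed
qed

text \<open>This starts the induction over the keys: with no key inserted, the signs of a block are
  independent with mean t = 1 / (2 n + 1). One sign contributes cosh l + t sinh l <= exp (t l + 2
  l^2), within the coefficient 4 of the invariant.\<close>

lemma mgf_noise:
  fixes l :: real
  assumes n: "0 < n" and k: "k + m \<le> \<tau>" and l: "\<bar>l\<bar> \<le> 1/2"
  shows "measure_pmf.expectation (raw_noise n \<tau>) (\<lambda>g. exp (l * (\<Sum>b<m. if g (k + b) < n then -1 else 1)))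
    \<le> exp (real m * (1 / real (2 * n + 1)) * l + 4 * real m * l\<^sup>2)"
proof -
  define t where "t = 1 / real (2 * n + 1)"
  define \<nu> where "\<nu> = pmf_of_set {0..<2 * n + 1}"
  \<comment> \<open>Padding with the constant 1 outside the block lets the product formula for the
    whole noise vector be used.\<close>
  define f where "f i v = (if i \<in> {k..<k+m} then exp (l * (if v < n then -1 else 1)) else 1)" for i v :: nat
  have prod: "exp (l * (\<Sum>b<m. if g (k + b) < n then -1 else 1)) = (\<Prod>i\<in>{0..<\<tau>}. f i (g i))" for g
  proof -
    have "(\<Prod>i\<in>{0..<\<tau>}. f i (g i)) = (\<Prod>i\<in>{k..<k+m}. f i (g i))"
      using k by (intro prod.mono_neutral_right) (auto simp: f_def)
    also have "\<dots> = (\<Prod>b<m. f (k + b) (g (k + b)))"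
      by (rule prod.reindex_bij_witness[of _ "\<lambda>b. k + b" "\<lambda>i. i - k"]) auto
    also have "\<dots> = exp (\<Sum>b<m. l * (if g (k + b) < n then -1 else 1))"
      by (subst exp_sum) (auto simp: f_def intro!: prod.cong)
    finally show ?thesis by (simp add: sum_distrib_left)
  qed
  have one: "measure_pmf.expectation \<nu> (\<lambda>v. exp (l * (if v < n then -1 else 1))) \<le> exp (t * l + 2 * l\<^sup>2)"
  proof -
    have "measure_pmf.expectation \<nu> (\<lambda>v. exp (l * (if v < n then -1 else 1))) =
        (real n * exp (-l) + real (n + 1) * exp l) / real (2 * n + 1)"
      unfolding \<nu>_def using expectation_threshold[of n "\<lambda>c. exp (l * (if c then -1 else 1))"] by simp
    also have "\<dots> = cosh l + t * sinh l"
    proof -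
      have ch: "cosh l = (exp l + exp (-l)) / 2" and sh: "sinh l = (exp l - exp (-l)) / 2"
        by (simp_all add: cosh_def sinh_def)
      show ?thesis unfolding ch sh t_def by (simp add: field_simps)
    qed
    also have "\<dots> \<le> (1 + l\<^sup>2) + (t * l + l\<^sup>2)"
    proof (rule add_mono)
      have b: "cosh \<bar>l\<bar> - 1 \<le> \<bar>l\<bar>\<^sup>2" "\<bar>l\<bar> \<le> sinh \<bar>l\<bar>" "sinh \<bar>l\<bar> \<le> \<bar>l\<bar> + \<bar>l\<bar>\<^sup>2"
        using cosh_sinh_bounds[of "\<bar>l\<bar>"] l by auto
      have "cosh \<bar>l\<bar> = cosh l" by (cases "l \<ge> 0") auto
      then show "cosh l \<le> 1 + l\<^sup>2" using b(1) by simp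
      have t: "0 \<le> t" "t \<le> 1" by (auto simp: t_def)
      have "sinh l \<le> l + l\<^sup>2"
      proof (cases "l \<ge> 0")
        case False
        then have "sinh l \<le> l" using b(2) by simp
        then show ?thesis by (rule order_trans) simp
      qed (use b(3) in simp)
      then have "t * sinh l \<le> t * (l + l\<^sup>2)" using t by (intro mult_left_mono)
      also have "\<dots> \<le> t * l + 1 * l\<^sup>2" unfolding distrib_left using t by (intro add_left_mono mult_right_mono) auto
      finally show "t * sinh l \<le> t * l + l\<^sup>2" by simp
    qed
    also have "\<dots> = 1 + (t * l + 2 * l\<^sup>2)" by simp
    also have "\<dots> \<le> exp (t * l + 2 * l\<^sup>2)" by (rule exp_ge_add_one_self)
    finally show ?thesis .
  qed
  have "measure_pmf.expectation (raw_noise n \<tau>) (\<lambda>g. exp (l * (\<Sum>b<m. if g (k + b) < n then -1 else 1)))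
      = (\<Prod>i\<in>{0..<\<tau>}. measure_pmf.expectation \<nu> (f i))"
    unfolding prod \<nu>_def
    by (intro expectation_prod_Pi_pmf integrable_measure_pmf_finite) (auto simp: f_def)
  also have "\<dots> = (\<Prod>i\<in>{k..<k+m}. measure_pmf.expectation \<nu> (f i))"
  proof (intro prod.mono_neutral_right ballI)
    fix i assume "i \<in> {0..<\<tau>} - {k..<k+m}"
    then have "f i = (\<lambda>_. 1)" by (auto simp: f_def)
    then show "measure_pmf.expectation \<nu> (f i) = 1" by simp
  qed (use k in auto)
  also have "\<dots> \<le> (\<Prod>i\<in>{k..<k+m}. exp (t * l + 2 * l\<^sup>2))"
  proof (intro prod_mono conjI)
    fix i assume "i \<in> {k..<k+m}"
    then have "f i = (\<lambda>v. exp (l * (if v < n then -1 else 1)))" by (auto simp: f_def)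
    then show "0 \<le> measure_pmf.expectation \<nu> (f i)" "measure_pmf.expectation \<nu> (f i) \<le> exp (t * l + 2 * l\<^sup>2)"
      using one by (simp_all del: times_divide_eq_right)
  qed
  also have "\<dots> = exp (real m * (t * l + 2 * l\<^sup>2))" by (simp add: exp_of_nat_mult[symmetric])
  also have "\<dots> \<le> exp (real m * t * l + 4 * real m * l\<^sup>2)"
    by (simp add: algebra_simps)
  finally show ?thesis by (simp add: t_def)
qed

subsection \<open>The sketch matrix\<close>

text \<open>
  The hash value \<open>h (0, j)\<close> is uniform on \<open>{0..<2 ^ L}\<close>.  Key \<open>j\<close> is sampled at the level \<open>l\<close> with
  \<open>2 ^ l \<le> h (0, j) < 2 ^ (l + 1)\<close>, and only if \<open>h (0, j)\<close> lies in the initial part of this interval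
  that is proportional to the weight; \<open>h (1, j)\<close> is its bucket within the level.
\<close>

definition level_keys :: "real vec \<Rightarrow> nat \<Rightarrow> nat \<Rightarrow> nat set" where
  "level_keys w l j = {a. 2 ^ l \<le> a \<and> real (a - 2 ^ l) < w $ j * 2 ^ l}"

definition cell :: "real vec \<Rightarrow> nat \<Rightarrow> nat \<Rightarrow> (nat \<times> nat \<Rightarrow> nat) \<Rightarrow> nat \<Rightarrow> nat \<Rightarrow> bool" where
  "cell w L m h j i \<longleftrightarrow> (\<exists>l<L. h (0, j) \<in> level_keys w l j \<and> i = l * m + h (1, j))"

definition sketch_mat :: "real vec \<Rightarrow> nat \<Rightarrow> nat \<Rightarrow> nat \<Rightarrow> (nat \<times> nat \<Rightarrow> nat) \<Rightarrow> bit mat" where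
  "sketch_mat w L m u h = mat (L * m) u (\<lambda>(i, j). of_bool (cell w L m h j i))"

definition hash_range :: "nat \<Rightarrow> nat \<Rightarrow> nat \<Rightarrow> nat" where
  "hash_range L m f = (if f = 0 then 2 ^ L else m)"

lemma hash_functions_eq: "hash_functions 2 r u = hash_pmf r {0..<u}"
  by (simp add: hash_functions_def)

lemma hash_range_support:
  assumes "h \<in> set_pmf (hash_functions 2 (hash_range L m) u)" and "0 < m" and "j < u"
  shows "h (0, j) < 2 ^ L" "h (1, j) < m"
proof -
  have "h (f, j) \<in> {0..<hash_range L m f}" if "f < 2" for f
  proof -
    have "h \<in> PiE_dflt ({0..<2} \<times> {0..<u}) 0
        (\<lambda>x. set_pmf (case x of (f, j) \<Rightarrow> pmf_of_set {0..<hash_range L m f}))"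
      using assms(1) unfolding hash_functions_def by (subst (asm) set_Pi_pmf) (simp_all add: comp_def)
    then have "h (f, j) \<in> set_pmf (pmf_of_set {0..<hash_range L m f})"
      using that assms(3) by (force simp: PiE_dflt_def)
    moreover have "0 < hash_range L m f" using assms(2) by (simp add: hash_range_def)
    ultimately show ?thesis by (subst (asm) set_pmf_of_set) auto
  qed
  from this[of 0] this[of 1] show "h (0, j) < 2 ^ L" "h (1, j) < m"
    by (auto simp: hash_range_def)
qed

text \<open>A weight of at most 1 keeps the sampled values within one dyadic interval; the
  disjointness of these intervals confines a key to a single level.\<close>

lemma level_keys_interval:
  fixes w :: "real vec"
  assumes "a \<in> level_keys w l j" and "w $ j \<le> 1"
  shows "2 ^ l \<le> a" "a < 2 ^ Suc l"
proof -
  show "2 ^ l \<le> a" using assms by (simp add: level_keys_def)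
  have "w $ j * 2 ^ l \<le> 1 * 2 ^ l" using assms(2) by (intro mult_right_mono) auto
  then have "real (a - 2 ^ l) < real (2 ^ l)"
    using assms(1) unfolding level_keys_def mem_Collect_eq of_nat_power of_nat_numeral by linarith
  then show "a < 2 ^ Suc l" by (simp only: of_nat_less_iff) simp
qed

lemma interval_level_unique:
  fixes a :: nat
  assumes "2 ^ l \<le> a" "a < 2 ^ Suc l" "2 ^ k \<le> a" "a < 2 ^ Suc k"
  shows "l = k"
proof -
  have "\<not> l < k" if "2 ^ k \<le> a" "a < 2 ^ Suc l" for l k
    using that power_increasing[of "Suc l" k "2::nat"] by linarith
  with assms show ?thesis by (meson linorder_cases)
qed

text \<open>At most one \<open>l\<close> has the hash value of \<open>j\<close> in its interval, so
  \<open>cell\<close> holds for at most one row. The column is zero if the key is not sampled or if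
  that row lies outside the matrix.\<close>

lemma col_sketch_mat:
  fixes w :: "real vec"
  assumes "j < u" and "w $ j \<le> 1"
  shows "col (sketch_mat w L m u h) j = 0\<^sub>v (L * m) \<or>
    (\<exists>i<L * m. col (sketch_mat w L m u h) j = unit_vec (L * m) i)"
proof (cases "\<exists>i<L * m. cell w L m h j i")
  case True
  then obtain i where i: "i < L * m" "cell w L m h j i" by blast
  have "cell w L m h j k \<longleftrightarrow> k = i" for k
    using i(2) level_keys_interval[OF _ assms(2)] interval_level_unique
    unfolding cell_def by metis
  then have "col (sketch_mat w L m u h) j = unit_vec (L * m) i"
    using assms(1) by (intro eq_vecI) (auto simp: sketch_mat_def unit_vec_def)
  with i(1) show ?thesis by blast
next
  case False
  then have "col (sketch_mat w L m u h) j = 0\<^sub>v (L * m)"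
    using assms(1) by (intro eq_vecI) (auto simp: sketch_mat_def)
  then show ?thesis ..
qed

text \<open>Division by m with remainder recovers level and bucket from a row index, as both
  \<open>b\<close> and the bucket value are below m.\<close>

lemma cell_block:
  assumes "l < L" "b < m" "h (1, j) < m"
  shows "cell w L m h j (l * m + b) \<longleftrightarrow> h (0, j) \<in> level_keys w l j \<and> h (1, j) = b"
proof -
  have "l = k \<and> h (1, j) = b" if "l * m + b = k * m + h (1, j)" for k
  proof -
    have "(l * m + b) div m = (k * m + h (1, j)) div m" "(l * m + b) mod m = (k * m + h (1, j)) mod m"
      using that by simp_all
    then show ?thesis using assms by simp
  qed
  then show ?thesis using assms(1) unfolding cell_def by metis
qed

text \<open>The exact count is the ceiling of w_j 2^l. Rounding up costs at most one hash value per
  key, so all keys together change the expected load of a level by at most u / 2^L, which is at most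
  1 for the chosen L.\<close>

lemma card_level_keys:
  fixes w :: "real vec"
  assumes l: "l < L" and w: "0 < w $ j" "w $ j \<le> 1"
  defines "c \<equiv> real (card (level_keys w l j \<inter> {0..<2 ^ L}))"
  shows "w $ j * 2 ^ l \<le> c" "c \<le> w $ j * 2 ^ l + 1" "c \<le> 2 ^ l"
proof -
  define N where "N = nat \<lceil>w $ j * 2 ^ l\<rceil>"
  have "level_keys w l j \<subseteq> {0..<2 ^ L}"
  proof
    fix a assume "a \<in> level_keys w l j"
    from level_keys_interval(2)[OF this w(2)] have "a < 2 ^ Suc l" .
    also have "\<dots> \<le> 2 ^ L" using l by (intro power_increasing) auto
    finally show "a \<in> {0..<2 ^ L}" by simp
  qed
  then have eq: "level_keys w l j \<inter> {0..<2 ^ L} = level_keys w l j" by blast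
  have "level_keys w l j = (\<lambda>d. 2 ^ l + d) ` {..<N}"
  proof -
    have iff: "real d < w $ j * 2 ^ l \<longleftrightarrow> d < N" for d
    proof -
      have "real d < w $ j * 2 ^ l \<longleftrightarrow> int d < \<lceil>w $ j * 2 ^ l\<rceil>"
        by (simp add: less_ceiling_iff)
      then show ?thesis unfolding N_def by linarith
    qed
    have "a \<in> (\<lambda>d. 2 ^ l + d) ` {..<N}" if "2 ^ l \<le> a" "a - 2 ^ l < N" for a
      using that by (intro image_eqI[of _ _ "a - 2 ^ l"]) auto
    then show ?thesis unfolding level_keys_def iff by auto
  qed
  then have c: "c = real N" unfolding c_def eq by (simp add: card_image)
  have pos: "0 < w $ j * 2 ^ l" using w by simp
  show "w $ j * 2 ^ l \<le> c" unfolding c N_def using pos by (simp add: of_nat_nat)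
  show "c \<le> w $ j * 2 ^ l + 1" unfolding c N_def using pos by (simp add: of_nat_nat)
  have "w $ j * 2 ^ l \<le> 1 * 2 ^ l" using w by (intro mult_right_mono) auto
  then have "\<lceil>w $ j * 2 ^ l\<rceil> \<le> 2 ^ l" by (simp add: ceiling_le_iff)
  then have "real_of_int \<lceil>w $ j * 2 ^ l\<rceil> \<le> 2 ^ l" by (metis of_int_le_iff of_int_numeral of_int_power)
  then show "c \<le> 2 ^ l" unfolding c N_def using pos by (simp add: of_nat_nat)
qed

section \<open>Signs of the noisy sketch and their tail bound\<close>

definition bit_sign :: "bit \<Rightarrow> real" where
  "bit_sign b = (if b = 1 then -1 else 1)"

text \<open>\<open>bit_sign\<close> is the nontrivial character of the additive group of GF(2): it
  turns the sum that defines an entry of the sketch into a product with one factor per key.\<close>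

lemma bit_sign_add: "bit_sign (a + b) = bit_sign a * bit_sign b"
  by (cases a; cases b) (auto simp: bit_sign_def)

lemma bit_sign_sum: "finite J \<Longrightarrow> bit_sign (\<Sum>j\<in>J. f j) = (\<Prod>j\<in>J. bit_sign (f j))"
  by (induction J rule: finite_induct) (simp add: bit_sign_def, simp only: sum.insert prod.insert bit_sign_add not_False_eq_True)

text \<open>The first factor is the sum of the signs of level \<open>l\<close>; dividing by m and by
  the mean 1 / (2 n + 1) of a noise sign makes it an estimate of the decay. The bits come as a
  function on indices so that the array read by the estimation program can be inserted
  directly.\<close>

definition level_ratio :: "nat \<Rightarrow> nat \<Rightarrow> (nat \<Rightarrow> nat) \<Rightarrow> nat \<Rightarrow> real" where
  "level_ratio n m f l =
    (real m - 2 * real (\<Sum>b<m. f (l * m + b))) * real (2 * n + 1) / real m"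

text \<open>An entry 0 of \<open>x\<close> is modelled as a key that is never sampled, so products
  and sums can range over the whole universe.\<close>

definition active_keys :: "real vec \<Rightarrow> bit vec \<Rightarrow> nat \<Rightarrow> nat \<Rightarrow> nat set" where
  "active_keys w x l j = (if x $ j = 1 then level_keys w l j else {})"

definition sign_sum ::
  "real vec \<Rightarrow> bit vec \<Rightarrow> nat \<Rightarrow> nat \<Rightarrow> nat \<Rightarrow> nat \<Rightarrow> (nat \<times> nat \<Rightarrow> nat) \<Rightarrow> (nat \<Rightarrow> nat) \<Rightarrow> real" where
  "sign_sum w x n m u l h g = (\<Sum>b<m. (if g (l * m + b) < n then -1 else 1) *
     (\<Prod>j\<in>{0..<u}. if h (0, j) \<in> active_keys w x l j \<and> h (1, j) = b then -1 else 1))"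

text \<open>The character is applied to each entry of H x + \<phi>; the bound on the bucket values,
  known for \<open>h\<close> in the support, identifies the rows of the block with the
  buckets.\<close>

lemma level_ratio_sketch:
  assumes l: "l < L" and m: "0 < m" and x: "x \<in> carrier_vec u"
    and h: "h \<in> set_pmf (hash_functions 2 (hash_range L m) u)"
  shows "level_ratio n m (nth_default 0 (bits_of_vec (sketch_mat w L m u h *\<^sub>v x + noise_vec n (L * m) g))) l =
    sign_sum w x n m u l h g * real (2 * n + 1) / real m"
proof -
  define y where "y = sketch_mat w L m u h *\<^sub>v x + noise_vec n (L * m) g"
  have dim: "dim_vec y = L * m" by (simp add: y_def noise_vec_def)
  have lt: "l * m + b < L * m" if "b < m" for b
  proof -
    have "l * m + b < Suc l * m" using that by simp
    also have "\<dots> \<le> L * m" using l by (intro mult_right_mono) auto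
    finally show ?thesis .
  qed
  have bits: "nth_default 0 (bits_of_vec y) i = of_bool (y $ i = 1)" if "i < L * m" for i
    using that dim by (simp add: bits_of_vec_def nth_default_def list_of_vec_index)
  have sign: "1 - 2 * real (nth_default 0 (bits_of_vec y) (l * m + b)) =
      (if g (l * m + b) < n then -1 else 1) *
     (\<Prod>j\<in>{0..<u}. if h (0, j) \<in> active_keys w x l j \<and> h (1, j) = b then -1 else 1)"
    if b: "b < m" for b
  proof -
    have "1 - 2 * real (nth_default 0 (bits_of_vec y) (l * m + b)) = bit_sign (y $ (l * m + b))"
      using bits[OF lt[OF b]] by (simp add: bit_sign_def)
    also have "y $ (l * m + b) = (\<Sum>j\<in>{0..<u}. of_bool (cell w L m h j (l * m + b)) * x $ j)
        + of_bool (g (l * m + b) < n)"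
      using lt[OF b] x by (simp add: y_def noise_vec_def sketch_mat_def scalar_prod_def)
    also have "bit_sign \<dots> = (\<Prod>j\<in>{0..<u}. bit_sign (of_bool (cell w L m h j (l * m + b)) * x $ j)) *
        bit_sign (of_bool (g (l * m + b) < n))"
      by (simp only: bit_sign_add bit_sign_sum finite_atLeastLessThan)
    also have "bit_sign (of_bool (g (l * m + b) < n)) = (if g (l * m + b) < n then -1 else 1)"
      by (simp add: bit_sign_def)
    also have "(\<Prod>j\<in>{0..<u}. bit_sign (of_bool (cell w L m h j (l * m + b)) * x $ j)) =
        (\<Prod>j\<in>{0..<u}. if h (0, j) \<in> active_keys w x l j \<and> h (1, j) = b then -1 else 1)"
    proof (intro prod.cong refl)
      fix j assume "j \<in> {0..<u}"
      then have "h (1, j) < m" using hash_range_support(2)[OF h m] by simp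
      from cell_block[where h = h and j = j, OF l b this]
      show "bit_sign (of_bool (cell w L m h j (l * m + b)) * x $ j) =
          (if h (0, j) \<in> active_keys w x l j \<and> h (1, j) = b then -1 else 1)"
        by (auto simp: bit_sign_def active_keys_def)
    qed
    finally show ?thesis by (simp only: mult.commute)
  qed
  have "real m - 2 * real (\<Sum>b<m. nth_default 0 (bits_of_vec y) (l * m + b)) =
      (\<Sum>b<m. 1 - 2 * real (nth_default 0 (bits_of_vec y) (l * m + b)))"
    by (simp add: sum_subtractf sum_distrib_left)
  also have "\<dots> = sign_sum w x n m u l h g" unfolding sign_sum_def using sign by simp
  finally show ?thesis unfolding level_ratio_def y_def[symmetric] by (simp only:)
qed

definition key_rate :: "real vec \<Rightarrow> bit vec \<Rightarrow> nat \<Rightarrow> nat \<Rightarrow> nat \<Rightarrow> real" where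
  "key_rate w x L l j = real (card (active_keys w x l j \<inter> {0..<2 ^ L})) / 2 ^ L"

definition decay :: "real vec \<Rightarrow> bit vec \<Rightarrow> nat \<Rightarrow> nat \<Rightarrow> nat \<Rightarrow> nat \<Rightarrow> real" where
  "decay w x L m u l = (\<Prod>j\<in>{0..<u}. 1 - 2 * key_rate w x L l j / real m)"

lemma key_rate_bounds:
  fixes w :: "real vec" and x :: "bit vec"
  assumes "l < L" "0 < w $ j" "w $ j \<le> 1"
  shows "0 \<le> key_rate w x L l j" "key_rate w x L l j \<le> 1/2"
    and "of_bool (x $ j = 1) * w $ j * 2 ^ l / 2 ^ L \<le> key_rate w x L l j"
    and "key_rate w x L l j \<le> of_bool (x $ j = 1) * w $ j * 2 ^ l / 2 ^ L + 1 / 2 ^ L"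
proof -
  show "0 \<le> key_rate w x L l j" by (simp add: key_rate_def)
  \<comment> \<open>Levels end at L - 1, so a rate is at most 2^(L - 1) / 2^L = 1/2, as the bound
    for a single key demands.\<close>
  have "(2::real) ^ Suc l \<le> 2 ^ L" using assms(1) by (intro power_increasing) auto
  then have half: "(2::real) ^ l / 2 ^ L \<le> 1/2" by (simp add: field_simps)
  have "key_rate w x L l j \<le> 2 ^ l / 2 ^ L"
    using card_level_keys(3)[OF assms] unfolding key_rate_def active_keys_def
    by (auto intro: divide_right_mono)
  with half show "key_rate w x L l j \<le> 1/2" by linarith
  show "of_bool (x $ j = 1) * w $ j * 2 ^ l / 2 ^ L \<le> key_rate w x L l j"
    using card_level_keys(1)[OF assms] unfolding key_rate_def active_keys_def
    by (auto intro: divide_right_mono)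
  show "key_rate w x L l j \<le> of_bool (x $ j = 1) * w $ j * 2 ^ l / 2 ^ L + 1 / 2 ^ L"
    using divide_right_mono[OF card_level_keys(2)[OF assms], of "2 ^ L"]
    unfolding key_rate_def active_keys_def by (auto simp: add_divide_distrib)
qed

text \<open>The second component is made outermost: the noise provides the initial signs, and the
  hash values are averaged with the noise fixed.\<close>

lemma expectation_pair_finite:
  fixes f :: "'a \<times> 'b \<Rightarrow> real"
  assumes "finite (set_pmf p)" "finite (set_pmf q)"
  shows "measure_pmf.expectation (pair_pmf p q) f =
    measure_pmf.expectation q (\<lambda>y. measure_pmf.expectation p (\<lambda>x. f (x, y)))"
proof -
  have "pair_pmf p q = q \<bind> (\<lambda>y. p \<bind> (\<lambda>x. return_pmf (x, y)))"
    unfolding pair_pmf_def by (rule bind_commute_pmf)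
  then show ?thesis using assms by (simp add: expectation_bind_finite)
qed

text \<open>The noise scales the mean of the sum by \<open>t\<close>, so a deviation
  \<open>d\<close> of the normalised ratio is one of \<open>d * t * m\<close> for the sum. This is
  why m has to grow with the square of 2 n + 1.\<close>

lemma sign_sum_tail:
  fixes w :: "real vec"
  assumes l: "l < L" and m: "2 \<le> m" and n: "0 < n" and d: "0 \<le> d" "d \<le> 1"
    and w: "\<And>j. j < u \<Longrightarrow> 0 < w $ j \<and> w $ j \<le> 1"
  defines "t \<equiv> 1 / real (2 * n + 1)"
  shows "measure_pmf.prob (pair_pmf (hash_functions 2 (hash_range L m) u) (raw_noise n (L * m)))
      {z. d * t * real m \<le> \<bar>sign_sum w x n m u l (fst z) (snd z) - real m * (t * decay w x L m u l)\<bar>}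
    \<le> 2 * exp (- (real m * (d * t)\<^sup>2 / 16))"
proof (rule tail_bound_of_mgf)
  have fin1: "finite (set_pmf (hash_functions 2 (hash_range L m) u))"
    unfolding hash_functions_eq using m by (intro finite_hash_pmf) (auto simp: hash_range_def)
  then show "finite (set_pmf (pair_pmf (hash_functions 2 (hash_range L m) u) (raw_noise n (L * m))))"
    unfolding set_pair_pmf by (intro finite_cartesian_product finite_raw_noise)
  have t: "0 \<le> t" "t \<le> 1" by (auto simp: t_def)
  show "0 \<le> d * t" using d t by simp
  show "d * t \<le> 4" using mult_le_one[of d t] d t by simp
  fix c :: real assume c: "\<bar>c\<bar> \<le> 1/2"
  have lm: "l * m + m \<le> L * m"
    using l mult_le_mono1[of "Suc l" L m] by simp
  have rng: "hash_range L m 0 = 2 ^ L" "hash_range L m 1 = m" by (auto simp: hash_range_def)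
  have "measure_pmf.expectation (raw_noise n (L * m)) (\<lambda>g.
      measure_pmf.expectation (hash_pmf (hash_range L m) {0..<u}) (\<lambda>h.
        exp (c * (\<Sum>b<hash_range L m 1. (if g (l * m + b) < n then -1 else 1) *
          (\<Prod>j\<in>{0..<u}. if h (0, j) \<in> active_keys w x l j \<and> h (1, j) = b then -1 else 1)))))
    \<le> exp (real (hash_range L m 1) * (t * (\<Prod>j\<in>{0..<u}. 1 - 2 *
        (real (card (active_keys w x l j \<inter> {0..<hash_range L m 0})) / real (hash_range L m 0))
          / real (hash_range L m 1))) * c + 4 * real (hash_range L m 1) * c\<^sup>2)"
  proof (intro mgf_keys)
    show "real (card (active_keys w x l j \<inter> {0..<hash_range L m 0})) / real (hash_range L m 0) \<le> 1/2"
      if "j \<in> {0..<u}" for j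
      using key_rate_bounds(2)[OF l, of w j x] w[of j] that by (simp add: key_rate_def rng)
    show "measure_pmf.expectation (raw_noise n (L * m))
       (\<lambda>g. exp (k * (\<Sum>b<hash_range L m 1. if g (l * m + b) < n then - 1 else 1)))
      \<le> exp (real (hash_range L m 1) * t * k + 4 * real (hash_range L m 1) * k\<^sup>2)"
      if "\<bar>k\<bar> \<le> 1/2" for k
      unfolding rng t_def by (rule mgf_noise[OF n lm that])
    show "finite (set_pmf (raw_noise n (L * m)))" by (rule finite_raw_noise)
  qed (use m t c in \<open>auto simp: hash_range_def\<close>)
  then show "measure_pmf.expectation (pair_pmf (hash_functions 2 (hash_range L m) u) (raw_noise n (L * m)))
        (\<lambda>z. exp (c * sign_sum w x n m u l (fst z) (snd z)))
      \<le> exp (real m * (t * decay w x L m u l) * c + 4 * real m * c\<^sup>2)"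
    unfolding hash_functions_eq expectation_pair_finite[OF fin1[unfolded hash_functions_eq] finite_raw_noise]
      rng sign_sum_def decay_def key_rate_def by simp
qed

subsection \<open>Accuracy\<close>

definition sketch_estimate :: "nat \<Rightarrow> nat \<Rightarrow> nat \<Rightarrow> bit vec \<Rightarrow> real" where
  "sketch_estimate n m L y = level_estimate (level_ratio n m (nth_default 0 (bits_of_vec y))) m L L"

text \<open>From u <= 2^L <= exp L; the square leaves room for a union bound over at most u
  levels.\<close>

lemma exp_level_bound:
  assumes "0 < u" and "u \<le> 2 ^ L" and "0 < L"
  shows "2 * exp (- (4 * real L)) \<le> 1 / (real u)\<^sup>2"
proof -
  have "real u \<le> real (2 ^ L)" using assms(2) by (simp only: of_nat_le_iff)
  also have "\<dots> = 2 ^ L" by simp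
  also have "\<dots> \<le> exp 1 ^ L" using exp_ge_add_one_self[of 1] by (intro power_mono) auto
  also have "\<dots> = exp (real L)" by (simp add: exp_of_nat_mult[symmetric])
  finally have "(real u)\<^sup>2 \<le> exp (real L) ^ 2" by (intro power_mono) auto
  also have "\<dots> = exp (2 * real L)" by (simp add: exp_of_nat_mult[symmetric])
  finally have u: "(real u)\<^sup>2 \<le> exp (2 * real L)" .
  have "2 * exp (- (4 * real L)) * (real u)\<^sup>2 \<le> 2 * exp (- (4 * real L)) * exp (2 * real L)"
    using u by (intro mult_left_mono) auto
  also have "\<dots> = 2 * exp (- (2 * real L))" by (simp add: exp_add[symmetric])
  also have "\<dots> \<le> 2 * exp (- 1)" using assms(3) by simp
  also have "\<dots> \<le> 1" using exp_ge_add_one_self[of 1] by (simp add: exp_minus field_simps)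
  finally show ?thesis using assms(1) by (simp add: field_simps)
qed

lemma levels_concentrated:
  fixes w :: "real vec" and x :: "bit vec" and \<beta> :: real
  assumes u: "0 < u" "u \<le> 2 ^ L" "L \<le> u" "0 < L" and m: "2 \<le> m" and n: "0 < n"
    and \<beta>: "0 < \<beta>" "\<beta> < 1"
    and large: "2 ^ 22 * real L * (real (2 * n + 1))\<^sup>2 / \<beta>\<^sup>2 \<le> real m"
    and w: "\<And>j. j < u \<Longrightarrow> 0 < w $ j \<and> w $ j \<le> 1"
  shows "1 - 1 / real u \<le> measure_pmf.prob
    (pair_pmf (hash_functions 2 (hash_range L m) u) (raw_noise n (L * m)))
    {z. \<forall>l<L. \<bar>sign_sum w x n m u l (fst z) (snd z) * real (2 * n + 1) / real m - decay w x L m u l\<bar> \<le> \<beta> / 256}"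
    (is "_ \<le> measure_pmf.prob ?P ?G")
proof -
  define t where "t = 1 / real (2 * n + 1)"
  define d where "d = \<beta> / 256"
  define Bad where "Bad l = {z. d * t * real m \<le>
    \<bar>sign_sum w x n m u l (fst z) (snd z) - real m * (t * decay w x L m u l)\<bar>}" for l
  have t: "0 < t" by (simp add: t_def)
  have m0: "0 < real m" using m by simp
  \<comment> \<open>Origin of the constant: with d = \<beta> / 2^8, the exponent m (d t)^2 / 16
    reaches 4 L once m >= 2^(2 + 4 + 16) L / (\<beta> t)^2.\<close>
  have "2 ^ 22 * real L \<le> real m * (\<beta>\<^sup>2 * t\<^sup>2)"
  proof -
    have "2 ^ 22 * real L * (real (2 * n + 1))\<^sup>2 / \<beta>\<^sup>2 * (\<beta>\<^sup>2 * t\<^sup>2) \<le> real m * (\<beta>\<^sup>2 * t\<^sup>2)"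
      using large by (intro mult_right_mono) auto
    moreover have "2 ^ 22 * real L * (real (2 * n + 1))\<^sup>2 / \<beta>\<^sup>2 * (\<beta>\<^sup>2 * t\<^sup>2) = 2 ^ 22 * real L"
      using \<beta> unfolding t_def by (simp add: power_divide)
    ultimately show ?thesis by linarith
  qed
  then have expo: "4 * real L \<le> real m * (d * t)\<^sup>2 / 16"
    by (simp add: d_def power_mult_distrib power_divide)
  have bad: "measure_pmf.prob ?P (Bad l) \<le> 1 / (real u)\<^sup>2" if "l < L" for l
  proof -
    have "measure_pmf.prob ?P (Bad l) \<le> 2 * exp (- (real m * (d * t)\<^sup>2 / 16))"
      unfolding Bad_def t_def using \<beta> by (intro sign_sum_tail[OF that m n] w) (auto simp: d_def)
    also have "\<dots> \<le> 2 * exp (- (4 * real L))" using expo by simp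
    also have "\<dots> \<le> 1 / (real u)\<^sup>2" by (rule exp_level_bound[OF u(1,2,4)])
    finally show ?thesis .
  qed
  have "- ?G \<subseteq> (\<Union>l\<in>{..<L}. Bad l)"
  proof
    fix z assume "z \<in> - ?G"
    then obtain l where l: "l < L"
      "d < \<bar>sign_sum w x n m u l (fst z) (snd z) * real (2 * n + 1) / real m - decay w x L m u l\<bar>"
      by (auto simp: d_def not_le)
    let ?S = "sign_sum w x n m u l (fst z) (snd z)"
    have "?S - real m * (t * decay w x L m u l) = t * real m * (?S * real (2 * n + 1) / real m - decay w x L m u l)"
      using m0 unfolding t_def by (simp add: right_diff_distrib)
    then have "\<bar>?S - real m * (t * decay w x L m u l)\<bar> = t * real m * \<bar>?S * real (2 * n + 1) / real m - decay w x L m u l\<bar>"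
      using t m0 by (simp add: abs_mult)
    moreover have "t * real m * d \<le> t * real m * \<bar>?S * real (2 * n + 1) / real m - decay w x L m u l\<bar>"
      using l(2) t m0 by (intro mult_left_mono) auto
    ultimately have "z \<in> Bad l" unfolding Bad_def by (simp add: mult_ac)
    with l(1) show "z \<in> (\<Union>l\<in>{..<L}. Bad l)" by blast
  qed
  then have "measure_pmf.prob ?P (- ?G) \<le> measure_pmf.prob ?P (\<Union>l\<in>{..<L}. Bad l)"
    by (intro measure_pmf.finite_measure_mono) auto
  also have "\<dots> \<le> (\<Sum>l<L. measure_pmf.prob ?P (Bad l))"
    by (intro measure_pmf.finite_measure_subadditive_finite) auto
  also have "\<dots> \<le> (\<Sum>l<L. 1 / (real u)\<^sup>2)" using bad by (intro sum_mono) auto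
  also have "\<dots> = real L / (real u)\<^sup>2" by simp
  also have "\<dots> \<le> real u / (real u)\<^sup>2" using u(3) by (intro divide_right_mono) auto
  also have "\<dots> = 1 / real u" using u(1) by (simp add: power2_eq_square)
  finally have "measure_pmf.prob ?P (- ?G) \<le> 1 / real u" .
  moreover have "measure_pmf.prob ?P (- ?G) = 1 - measure_pmf.prob ?P ?G"
    using measure_pmf.prob_compl[of ?G ?P] by (simp add: Compl_eq_Diff_UNIV)
  ultimately show ?thesis by linarith
qed

lemma sketch_estimate_accurate:
  fixes w :: "real vec" and x :: "bit vec" and \<beta> :: real
  assumes u: "0 < u" "u \<le> 2 ^ L" "L \<le> u" "0 < L" and n: "0 < n"
    and \<beta>: "0 < \<beta>" "\<beta> < 1"
    and large: "2 ^ 22 * real L * (real (2 * n + 1))\<^sup>2 / \<beta>\<^sup>2 \<le> real m"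
    and w: "\<And>j. j < u \<Longrightarrow> 0 < w $ j \<and> w $ j \<le> 1"
    and x: "x \<in> carrier_vec u"
  defines "W \<equiv> l1_norm (real_vec x \<circ>\<^sub>H w)"
  shows "1 - 1 / real u \<le> measure_pmf.prob
    (pair_pmf (map_pmf (sketch_mat w L m u) (hash_functions 2 (hash_range L m) u))
      (map_pmf (noise_vec n (L * m)) (raw_noise n (L * m))))
    {(H, \<phi>). \<bar>sketch_estimate n m L (H *\<^sub>v x + \<phi>) - W\<bar> \<le> \<beta> * W + 2 * real m}"
proof -
  have "512 / \<beta> \<le> 2 ^ 22 * real L * (real (2 * n + 1))\<^sup>2 / \<beta>\<^sup>2"
  proof -
    have "512 * \<beta> \<le> 2 ^ 22 * 1 * 1" using \<beta> by simp
    also have "\<dots> \<le> 2 ^ 22 * real L * (real (2 * n + 1))\<^sup>2"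
      using u(4) by (intro mult_mono one_le_power) auto
    finally have "512 * \<beta> / \<beta>\<^sup>2 \<le> 2 ^ 22 * real L * (real (2 * n + 1))\<^sup>2 / \<beta>\<^sup>2"
      by (rule divide_right_mono) simp
    then show ?thesis using \<beta> by (simp add: power2_eq_square)
  qed
  with large have m512: "512 / \<beta> \<le> real m" by linarith
  have "512 < 512 / \<beta>" using \<beta> by (simp add: field_simps)
  with m512 have m2: "2 \<le> m" by linarith
  have W: "W = (\<Sum>j\<in>{0..<u}. of_bool (x $ j = 1) * w $ j)"
  proof -
    have "dim_vec x = u" using x by simp
    then have "W = (\<Sum>j<u. \<bar>of_bool (x $ j = 1) * w $ j\<bar>)"
      unfolding W_def l1_norm_def hadamard_def real_vec_def by simp
    also have "\<dots> = (\<Sum>j<u. of_bool (x $ j = 1) * w $ j)"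
      using w by (intro sum.cong) (auto simp: less_imp_le)
    finally show ?thesis by (simp add: atLeast0LessThan)
  qed
  have W0: "0 \<le> W" unfolding W using w by (intro sum_nonneg) (auto simp: less_imp_le)
  have "W \<le> (\<Sum>j\<in>{0..<u}. 1)" unfolding W
    using w by (intro sum_mono) auto
  then have Wu: "W \<le> real u" by simp
  have u2: "real u \<le> 2 ^ L" using u(2) by (metis of_nat_le_iff of_nat_numeral of_nat_power)
  define Q where "Q l = (\<Sum>j\<in>{0..<u}. key_rate w x L l j)" for l
  have Q: "W * 2 ^ l / 2 ^ L \<le> Q l \<and> Q l \<le> W * 2 ^ l / 2 ^ L + 1" if l: "l < L" for l
  proof
    have eq: "W * 2 ^ l / 2 ^ L = (\<Sum>j\<in>{0..<u}. of_bool (x $ j = 1) * w $ j * 2 ^ l / 2 ^ L)"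
      unfolding W by (simp only: sum_distrib_right sum_divide_distrib)
    show "W * 2 ^ l / 2 ^ L \<le> Q l" unfolding eq Q_def
      using w by (intro sum_mono key_rate_bounds(3)[OF l]) auto
    have "Q l \<le> (\<Sum>j\<in>{0..<u}. of_bool (x $ j = 1) * w $ j * 2 ^ l / 2 ^ L + 1 / 2 ^ L)" unfolding Q_def
      using w by (intro sum_mono key_rate_bounds(4)[OF l]) auto
    also have "\<dots> = W * 2 ^ l / 2 ^ L + real u / 2 ^ L" unfolding eq by (simp add: sum.distrib)
    also have "real u / 2 ^ L \<le> 1" using u2 by simp
    finally show "Q l \<le> W * 2 ^ l / 2 ^ L + 1" by simp
  qed
  have \<rho>: "0 < decay w x L m u l \<and> 2 * Q l / m \<le> - ln (decay w x L m u l) \<and>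
      - ln (decay w x L m u l) \<le> 2 * Q l / m * (1 + 2 / m)" if l: "l < L" for l
  proof -
    have r: "0 \<le> key_rate w x L l j \<and> key_rate w x L l j \<le> 1/2" if "j \<in> {0..<u}" for j
      using key_rate_bounds(1,2)[OF l, of w j x] w[of j] that by auto
    show ?thesis unfolding decay_def Q_def
      using neg_ln_prod_bounds[of "{0..<u}" "key_rate w x L l" "real m"] r m2 by simp
  qed
  let ?P = "pair_pmf (hash_functions 2 (hash_range L m) u) (raw_noise n (L * m))"
  let ?G = "{z. \<forall>l<L. \<bar>sign_sum w x n m u l (fst z) (snd z) * real (2 * n + 1) / real m - decay w x L m u l\<bar> \<le> \<beta> / 256}"
  let ?A = "{(H, \<phi>). \<bar>sketch_estimate n m L (H *\<^sub>v x + \<phi>) - W\<bar> \<le> \<beta> * W + 2 * real m}"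
  let ?f = "\<lambda>(h, g). (sketch_mat w L m u h, noise_vec n (L * m) g)"
  have "measure_pmf.prob ?P ?G \<le> measure_pmf.prob ?P (?f -` ?A)"
  \<comment> \<open>The events are compared almost everywhere, because the hash values are known to
    be in range only on the support.\<close>
  proof (rule measure_pmf.finite_measure_mono_AE)
    show "AE z in measure_pmf ?P. z \<in> ?G \<longrightarrow> z \<in> ?f -` ?A"
    proof (subst AE_measure_pmf_iff, intro ballI impI)
      fix z assume z: "z \<in> set_pmf ?P" "z \<in> ?G"
      obtain h g where hg: "z = (h, g)" by (cases z)
      have h: "h \<in> set_pmf (hash_functions 2 (hash_range L m) u)" using z(1) unfolding hg set_pair_pmf by blast
      let ?y = "sketch_mat w L m u h *\<^sub>v x + noise_vec n (L * m) g"
      have close: "\<bar>level_ratio n m (nth_default 0 (bits_of_vec ?y)) l - decay w x L m u l\<bar> \<le> \<beta> / 256" if l: "l < L" for l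
        using level_ratio_sketch[OF l _ x h, of n w g] m2 z(2) l unfolding hg by simp
      then have "\<bar>sketch_estimate n m L ?y - W\<bar> \<le> \<beta> * W + 2 * real m"
        unfolding sketch_estimate_def
        by (intro level_estimate_error[OF u(4) \<beta> m512 W0 order_trans[OF Wu u2] Q \<rho>])
      then show "z \<in> ?f -` ?A" unfolding hg by simp
    qed
  qed auto
  moreover have "1 - 1 / real u \<le> measure_pmf.prob ?P ?G"
    using w by (intro levels_concentrated u m2 n \<beta> large) auto
  moreover have "pair_pmf (map_pmf (sketch_mat w L m u) (hash_functions 2 (hash_range L m) u))
      (map_pmf (noise_vec n (L * m)) (raw_noise n (L * m))) = map_pmf ?f ?P"
    by (simp only: map_pair)
  ultimately show ?thesis by (simp only: measure_map_pmf)
qed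

subsection \<open>Deterministic programs\<close>

text \<open>Without loops and random choices the final state is an explicit function
  \<open>exec\<close>, so the verification of a loop body reduces to simplification.\<close>

primrec straight_line :: "com \<Rightarrow> bool" where
  "straight_line Skip = True"
| "straight_line (IStore a i e) = True"
| "straight_line (RStore a i x) = True"
| "straight_line (Hash a i f k) = True"
| "straight_line (Rand a i n) = False"
| "straight_line (Seq c d) = (straight_line c \<and> straight_line d)"
| "straight_line (Cond b c d) = (straight_line c \<and> straight_line d)"
| "straight_line (While b c) = False"

primrec exec :: "(nat \<times> nat \<Rightarrow> nat) \<Rightarrow> com \<Rightarrow> mstate \<Rightarrow> mstate" where
  "exec h Skip s = s"
| "exec h (IStore a i e) s = istore a (ieval s i) (ieval s e) s"
| "exec h (RStore a i x) s = rstore a (ieval s i) (reval s x) s"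
| "exec h (Hash a i f k) s = istore a (ieval s i) (h (ieval s f, ieval s k)) s"
| "exec h (Rand a i n) s = s"
| "exec h (Seq c d) s = exec h d (exec h c s)"
| "exec h (Cond b c d) s = (if beval s b then exec h c s else exec h d s)"
| "exec h (While b c) s = s"

primrec cost :: "com \<Rightarrow> nat" where
  "cost Skip = 1"
| "cost (IStore a i e) = 1"
| "cost (RStore a i x) = 1"
| "cost (Hash a i f k) = 1"
| "cost (Rand a i n) = 1"
| "cost (Seq c d) = cost c + cost d"
| "cost (Cond b c d) = max (cost c) (cost d) + 1"
| "cost (While b c) = 1"

lemma runs_straight_line:
  "straight_line c \<Longrightarrow> runs h c s (cost c) (return_pmf (exec h c s))"
proof (induction c arbitrary: s)
  case (Seq c d)
  have "runs h (Seq c d) s (cost c + cost d)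
    (bind_pmf (return_pmf (exec h c s)) (\<lambda>s'. return_pmf (exec h d s')))"
    using Seq by (intro runs_Seq) auto
  then show ?case by (simp add: bind_return_pmf)
next
  case (Cond b c d)
  show ?case
  proof (cases "beval s b")
    case True
    have "runs h c s (max (cost c) (cost d)) (return_pmf (exec h c s))"
      using Cond by (intro runs_weaken[OF Cond.IH(1)]) simp_all
    from runs_CondTrue[OF True this] show ?thesis using True by simp
  next
    case False
    have "runs h d s (max (cost c) (cost d)) (return_pmf (exec h d s))"
      using Cond by (intro runs_weaken[OF Cond.IH(2)]) simp_all
    from runs_CondFalse[OF False this] show ?thesis using False by simp
  qed
qed (use runs_Skip runs_IStore runs_RStore runs_Hash in \<open>simp_all del: One_nat_def\<close>)

text \<open>A total-correctness triple with a time bound, for runs whose final distribution is a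
  point mass.\<close>

definition halts :: "(nat \<times> nat \<Rightarrow> nat) \<Rightarrow> com \<Rightarrow> mstate \<Rightarrow> nat \<Rightarrow> (mstate \<Rightarrow> bool) \<Rightarrow> bool" where
  "halts h c s t Q \<longleftrightarrow> (\<exists>s'. runs h c s t (return_pmf s') \<and> Q s')"

lemma halts_straight_line:
  "straight_line c \<Longrightarrow> Q (exec h c s) \<Longrightarrow> cost c \<le> t \<Longrightarrow> halts h c s t Q"
  unfolding halts_def using runs_weaken[OF runs_straight_line] by metis

lemma halts_weaken:
  "halts h c s t Q \<Longrightarrow> t \<le> t' \<Longrightarrow> (\<And>s'. Q s' \<Longrightarrow> Q' s') \<Longrightarrow> halts h c s t' Q'"
  unfolding halts_def using runs_weaken by metis

lemma halts_Seq:
  assumes "halts h c s t Q" and "\<And>s'. Q s' \<Longrightarrow> halts h d s' t' Q'" and "t + t' \<le> t''"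
  shows "halts h (Seq c d) s t'' Q'"
proof -
  from assms(1) obtain s1 where 1: "runs h c s t (return_pmf s1)" "Q s1"
    by (auto simp: halts_def)
  from assms(2)[OF 1(2)] obtain s2 where 2: "runs h d s1 t' (return_pmf s2)" "Q' s2"
    by (auto simp: halts_def)
  have "runs h (Seq c d) s (t + t') (bind_pmf (return_pmf s1) (\<lambda>_. return_pmf s2))"
    using 1 2 by (intro runs_Seq) auto
  then have "runs h (Seq c d) s (t + t') (return_pmf s2)" by (simp add: bind_return_pmf)
  from runs_weaken[OF this assms(3)] show ?thesis using 2(2) unfolding halts_def by blast
qed

text \<open>The invariant is indexed by the number of finished iterations and forces the test to
  succeed as long as fewer than N are done, so the loop runs exactly N times. Every iteration costs
  its body and one test, and the final failing test adds 1.\<close>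

lemma halts_While:
  assumes step: "\<And>k s. k < N \<Longrightarrow> I k s \<Longrightarrow> beval s b \<and> halts h c s t (I (Suc k))"
    and exit: "\<And>s. I N s \<Longrightarrow> \<not> beval s b"
    and init: "I 0 s" and t': "N * (t + 1) + 1 \<le> t'"
  shows "halts h (While b c) s t' (I N)"
proof -
  have "k \<le> N \<Longrightarrow> \<forall>s. I k s \<longrightarrow> halts h (While b c) s ((N - k) * (t + 1) + 1) (I N)" for k
  proof (induction k rule: inc_induct)
    case base
    show ?case
    proof safe
      fix s assume "I N s"
      with exit[OF this] show "halts h (While b c) s ((N - N) * (t + 1) + 1) (I N)"
        using runs_WhileFalse[of s b h c] by (auto simp: halts_def)
    qed
  next
    case (step k)
    show ?case
    proof safe
      fix s assume "I k s"
      with assms(1) step(2) have b: "beval s b" and "halts h c s t (I (Suc k))" by auto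
      then obtain s1 where 1: "runs h c s t (return_pmf s1)" "I (Suc k) s1"
        by (auto simp: halts_def)
      then obtain s2 where 2: "runs h (While b c) s1 ((N - Suc k) * (t + 1) + 1) (return_pmf s2)"
        "I N s2" using step.IH by (auto simp: halts_def)
      have "runs h (While b c) s (t + ((N - Suc k) * (t + 1) + 1) + 1)
          (bind_pmf (return_pmf s1) (\<lambda>_. return_pmf s2))"
        using 1 2 b by (intro runs_WhileTrue) auto
      moreover have "t + ((N - Suc k) * (t + 1) + 1) + 1 = (N - k) * (t + 1) + 1"
        using Suc_diff_Suc[OF step(2)] by (metis add.assoc add.commute mult_Suc)
      ultimately show "halts h (While b c) s ((N - k) * (t + 1) + 1) (I N)"
        using 2(2) by (auto simp: halts_def bind_return_pmf)
    qed
  qed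
  from this[of 0] init have "halts h (While b c) s (N * (t + 1) + 1) (I N)" by simp
  then show ?thesis by (rule halts_weaken) (use t' in auto)
qed

lemma imem_istore [simp]:
  "imem (istore a i n s) = (imem s)(a := (imem s a)(i := n))"
  by (simp add: istore_def)

lemma imem_rstore [simp]: "imem (rstore a i x s) = imem s"
  by (simp add: rstore_def)

lemma rmem_rstore [simp]:
  "rmem (rstore a i x s) = (rmem s)(a := (rmem s a)(i := x))"
  by (simp add: rstore_def)

lemma rmem_istore [simp]: "rmem (istore a i n s) = rmem s"
  by (simp add: istore_def)

lemma computes_within_halts:
  assumes "halts h c s t (\<lambda>s'. out s' = y)" and "real t \<le> T"
  shows "computes_within h c s T out (return_pmf y)"
  using assms unfolding halts_def computes_within_def by force

text \<open>\<open>runs_Seq\<close> expects the continuation as a function of the intermediate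
  state, while the second phase is described in terms of the sample \<open>g\<close>. Uniqueness of
  the final distribution shows that samples with the same intermediate state have the same output,
  so \<open>E\<close> can be chosen per state.\<close>

lemma computes_within_bind:
  assumes "runs h c s t (map_pmf F P)"
    and "\<And>g. g \<in> set_pmf P \<Longrightarrow> halts h d (F g) t' (\<lambda>s'. out s' = G g)"
    and "real (t + t') \<le> T"
  shows "computes_within h (Seq c d) s T out (map_pmf G P)"
proof -
  define E where "E s' = (SOME s''. runs h d s' t' (return_pmf s'') \<and>
    (\<forall>g\<in>set_pmf P. F g = s' \<longrightarrow> out s'' = G g))" for s'
  have E: "runs h d (F g) t' (return_pmf (E (F g))) \<and> out (E (F g)) = G g"
    if g: "g \<in> set_pmf P" for g
  proof -
    obtain s'' where s'': "runs h d (F g) t' (return_pmf s'')" "out s'' = G g"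
      using assms(2)[OF g] by (auto simp: halts_def)
    have "out s'' = G g'" if g': "g' \<in> set_pmf P" "F g' = F g" for g'
    proof -
      obtain s3 where s3: "runs h d (F g') t' (return_pmf s3)" "out s3 = G g'"
        using assms(2)[OF g'(1)] by (auto simp: halts_def)
      have "return_pmf s'' = return_pmf s3"
        using runs_unique[OF s''(1)] s3(1) g'(2) by simp
      with s3(2) show ?thesis by simp
    qed
    with s'' have "\<exists>s''. runs h d (F g) t' (return_pmf s'') \<and>
      (\<forall>g'\<in>set_pmf P. F g' = F g \<longrightarrow> out s'' = G g')" by blast
    from someI_ex[OF this] show ?thesis unfolding E_def using g by blast
  qed
  have "runs h (Seq c d) s (t + t') (bind_pmf (map_pmf F P) (\<lambda>s'. return_pmf (E s')))"
    using assms(1) E by (intro runs_Seq) auto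
  moreover have "map_pmf out (bind_pmf (map_pmf F P) (\<lambda>s'. return_pmf (E s'))) = map_pmf G P"
    using E by (auto simp: map_bind_pmf bind_map_pmf map_pmf_def[of G] intro!: bind_pmf_cong)
  ultimately show ?thesis using assms(3) unfolding computes_within_def by blast
qed

lemma computes_within_Seq:
  assumes "halts h c s t Q" and "\<And>s'. Q s' \<Longrightarrow> computes_within h d s' T out P"
    and "real t + T \<le> T'"
  shows "computes_within h (Seq c d) s T' out P"
proof -
  from assms(1) obtain s1 where 1: "runs h c s t (return_pmf s1)" "Q s1"
    by (auto simp: halts_def)
  from assms(2)[OF 1(2)] obtain t' D where 2: "runs h d s1 t' D" "real t' \<le> T" "map_pmf out D = P"
    unfolding computes_within_def by auto
  have "runs h (Seq c d) s (t + t') (bind_pmf (return_pmf s1) (\<lambda>_. D))"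
    using 1 2 by (intro runs_Seq) auto
  then show ?thesis using 2 assms(3) unfolding computes_within_def
    by (intro exI[of _ "t + t'"] exI[of _ D]) (auto simp: bind_return_pmf)
qed

subsection \<open>The sketching program\<close>

abbreviation var :: "nat \<Rightarrow> iexp" where "var a \<equiv> ILoad a (INum 0)"
abbreviation assign :: "nat \<Rightarrow> iexp \<Rightarrow> com" where "assign a e \<equiv> IStore a (INum 0) e"
abbreviation incr :: "nat \<Rightarrow> com" where "incr a \<equiv> assign a (IPlus (var a) (INum 1))"

text \<open>The frame condition of the programs: \<open>X\<close> and \<open>Y\<close> list the
  integer and the real arrays that may be written.\<close>

definition agree :: "nat set \<Rightarrow> nat set \<Rightarrow> mstate \<Rightarrow> mstate \<Rightarrow> bool" where
  "agree X Y s s' \<longleftrightarrow> (\<forall>a. a \<notin> X \<longrightarrow> imem s' a = imem s a) \<and> (\<forall>a. a \<notin> Y \<longrightarrow> rmem s' a = rmem s a)"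

text \<open>
  The integer variables 3, 4, 6 and 7 receive \<open>2 ^ L\<close>, \<open>L\<close>, \<open>m\<close> and \<open>n\<close>; as the machine cannot
  divide, \<open>m\<close> is recovered from \<open>\<tau> = L * m\<close> by repeated addition.
\<close>

definition levels_prog :: com where
  "levels_prog = Seq (Seq (assign 3 (INum 1)) (assign 4 (INum 0)))
     (While (ILess (var 3) (var 0)) (Seq (assign 3 (IPlus (var 3) (var 3))) (incr 4)))"

definition buckets_prog :: com where
  "buckets_prog = Seq (Seq (assign 5 (INum 0)) (assign 6 (INum 0)))
     (While (ILess (var 5) (ILoad 0 (INum 1))) (Seq (assign 5 (IPlus (var 5) (var 4))) (incr 6)))"

text \<open>Reals cannot be converted to integers, so the ceiling of 1 / \<epsilon> is found by
  counting; this takes O(n) steps, and n is at most m for the final parameters.\<close>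

definition bias_prog :: com where
  "bias_prog = Seq (assign 7 (INum 0))
     (While (RLess (RTimes (RInt (var 7)) (RLoad 0 (INum 1))) (RInt (INum 1))) (incr 7))"

definition params_prog :: com where
  "params_prog = Seq levels_prog (Seq buckets_prog bias_prog)"

lemma halts_levels_prog:
  assumes "imem s0 0 0 = u" and "\<And>k. k < L \<Longrightarrow> 2 ^ k < u" and "u \<le> 2 ^ L"
  shows "halts h levels_prog s0 (3 * L + 3)
    (\<lambda>s. agree {3, 4} {} s0 s \<and> imem s 3 0 = 2 ^ L \<and> imem s 4 0 = L)"
  unfolding levels_prog_def
proof (rule halts_Seq)
  let ?I = "\<lambda>k s. agree {3, 4} {} s0 s \<and> imem s 3 0 = 2 ^ k \<and> imem s 4 0 = k"
  show "halts h (Seq (assign 3 (INum 1)) (assign 4 (INum 0))) s0 2 (?I 0)"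
    by (rule halts_straight_line) (auto simp: agree_def)
  show "halts h (While (ILess (var 3) (var 0)) (Seq (assign 3 (IPlus (var 3) (var 3))) (incr 4)))
      s (L * (2 + 1) + 1) (?I L)" if "?I 0 s" for s
  proof (rule halts_While[where I = ?I])
    fix k s assume k: "k < L" and I: "?I k s"
    show "beval s (ILess (var 3) (var 0)) \<and>
        halts h (Seq (assign 3 (IPlus (var 3) (var 3))) (incr 4)) s 2 (?I (Suc k))"
      using I k assms by (intro conjI halts_straight_line) (auto simp: agree_def)
  next
    fix s assume "?I L s"
    then show "\<not> beval s (ILess (var 3) (var 0))" using assms by (auto simp: agree_def)
  qed (use that in auto)
qed simp

lemma halts_buckets_prog:
  assumes "imem s0 0 1 = L * m" and "imem s0 4 0 = L" and "0 < L"
  shows "halts h buckets_prog s0 (3 * m + 3) (\<lambda>s. agree {5, 6} {} s0 s \<and> imem s 6 0 = m)"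
  unfolding buckets_prog_def
proof (rule halts_Seq)
  let ?I = "\<lambda>k s. agree {5, 6} {} s0 s \<and> imem s 5 0 = L * k \<and> imem s 6 0 = k"
  show "halts h (Seq (assign 5 (INum 0)) (assign 6 (INum 0))) s0 2 (?I 0)"
    by (rule halts_straight_line) (auto simp: agree_def)
  show "halts h (While (ILess (var 5) (ILoad 0 (INum 1))) (Seq (assign 5 (IPlus (var 5) (var 4))) (incr 6)))
      s (m * (2 + 1) + 1) (\<lambda>s. agree {5, 6} {} s0 s \<and> imem s 6 0 = m)" if "?I 0 s" for s
  proof (rule halts_weaken[OF halts_While[where I = ?I and N = m and t = 2]])
    fix k s assume k: "k < m" and I: "?I k s"
    show "beval s (ILess (var 5) (ILoad 0 (INum 1))) \<and>
        halts h (Seq (assign 5 (IPlus (var 5) (var 4))) (incr 6)) s 2 (?I (Suc k))"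
      using I k assms by (intro conjI halts_straight_line) (auto simp: agree_def)
  next
    fix s assume "?I m s"
    then show "\<not> beval s (ILess (var 5) (ILoad 0 (INum 1)))" using assms by (auto simp: agree_def)
  qed (use that in auto)
qed simp

lemma halts_bias_prog:
  assumes "rmem s0 0 1 = \<epsilon>" and "\<And>k. k < n \<Longrightarrow> real k * \<epsilon> < 1" and "1 \<le> real n * \<epsilon>"
  shows "halts h bias_prog s0 (2 * n + 2) (\<lambda>s. agree {7} {} s0 s \<and> imem s 7 0 = n)"
  unfolding bias_prog_def
proof (rule halts_Seq)
  let ?I = "\<lambda>k s. agree {7} {} s0 s \<and> imem s 7 0 = k"
  let ?b = "RLess (RTimes (RInt (var 7)) (RLoad 0 (INum 1))) (RInt (INum 1))"
  show "halts h (assign 7 (INum 0)) s0 1 (?I 0)"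
    by (rule halts_straight_line) (auto simp: agree_def)
  show "halts h (While ?b (incr 7)) s (n * (1 + 1) + 1) (?I n)" if "?I 0 s" for s
  proof (rule halts_While[where I = ?I])
    fix k s assume k: "k < n" and I: "?I k s"
    show "beval s ?b \<and> halts h (incr 7) s 1 (?I (Suc k))"
      using I k assms by (intro conjI halts_straight_line) (auto simp: agree_def)
  next
    fix s assume "?I n s"
    then show "\<not> beval s ?b" using assms by (auto simp: agree_def)
  qed (use that in auto)
qed simp

lemma halts_params_prog:
  assumes u: "imem s0 0 0 = u" "\<And>k. k < L \<Longrightarrow> 2 ^ k < u" "u \<le> 2 ^ L" "0 < L"
    and \<tau>: "imem s0 0 1 = L * m"
    and \<epsilon>: "rmem s0 0 1 = \<epsilon>" "\<And>k. k < n \<Longrightarrow> real k * \<epsilon> < 1" "1 \<le> real n * \<epsilon>"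
  shows "halts h params_prog s0 (3 * L + 3 * m + 2 * n + 8) (\<lambda>s. agree {3, 4, 5, 6, 7} {} s0 s \<and>
    imem s 3 0 = 2 ^ L \<and> imem s 4 0 = L \<and> imem s 6 0 = m \<and> imem s 7 0 = n)"
  unfolding params_prog_def
proof (rule halts_Seq[OF halts_levels_prog[OF u(1-3)]])
  fix s1 assume s1: "agree {3, 4} {} s0 s1 \<and> imem s1 3 0 = 2 ^ L \<and> imem s1 4 0 = L"
  show "halts h (Seq buckets_prog bias_prog) s1 (3 * m + 3 + (2 * n + 2)) (\<lambda>s. agree {3, 4, 5, 6, 7} {} s0 s \<and>
    imem s 3 0 = 2 ^ L \<and> imem s 4 0 = L \<and> imem s 6 0 = m \<and> imem s 7 0 = n)"
  proof (rule halts_Seq)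
    show "halts h buckets_prog s1 (3 * m + 3) (\<lambda>s. agree {5, 6} {} s1 s \<and> imem s 6 0 = m)"
      using s1 \<tau> u(4) by (intro halts_buckets_prog[of _ L]) (auto simp: agree_def)
    fix s2 assume s2: "agree {5, 6} {} s1 s2 \<and> imem s2 6 0 = m"
    have "halts h bias_prog s2 (2 * n + 2) (\<lambda>s. agree {7} {} s2 s \<and> imem s 7 0 = n)"
      using s1 s2 \<epsilon> by (intro halts_bias_prog[of _ \<epsilon>]) (auto simp: agree_def)
    then show "halts h bias_prog s2 (2 * n + 2) (\<lambda>s. agree {3, 4, 5, 6, 7} {} s0 s \<and>
      imem s 3 0 = 2 ^ L \<and> imem s 4 0 = L \<and> imem s 6 0 = m \<and> imem s 7 0 = n)"
      by (rule halts_weaken) (use s1 s2 in \<open>auto simp: agree_def\<close>)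
  qed simp
qed simp_all

definition rand_loop :: com where
  "rand_loop = While (ILess (var 8) (ILoad 0 (INum 1)))
     (Seq (Rand 12 (var 8) (IPlus (IPlus (var 7) (var 7)) (INum 1))) (incr 8))"

text \<open>The memory after a loop that starts at index \<open>k\<close>, as a function of one
  sample for all remaining indices; in this form the outcome of the loop is the image of a product
  distribution.\<close>

definition rand_state :: "nat \<Rightarrow> nat \<Rightarrow> mstate \<Rightarrow> (nat \<Rightarrow> nat) \<Rightarrow> mstate" where
  "rand_state k \<tau> s g = s\<lparr>imem := (imem s)(8 := (imem s 8)(0 := \<tau>),
     12 := \<lambda>i. if k \<le> i \<and> i < \<tau> then g i else imem s 12 i)\<rparr>"

text \<open>By downward induction: the iteration at \<open>k\<close> contributes one independent
  coordinate of the product, and the rest of the loop starts from \<open>Suc k\<close>.\<close>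

lemma runs_rand_loop_from:
  assumes "k \<le> \<tau>" "imem s 8 0 = k" "imem s 0 1 = \<tau>" "imem s 7 0 = n"
  shows "runs h rand_loop s ((\<tau> - k) * 3 + 1)
    (map_pmf (rand_state k \<tau> s) (Pi_pmf {k..<\<tau>} 0 (\<lambda>_. pmf_of_set {0..<2 * n + 1})))"
  using assms
proof (induction k arbitrary: s rule: inc_induct)
  case base
  have "imem s = (imem s)(8 := (imem s 8)(0 := \<tau>), 12 := \<lambda>i. if \<tau> \<le> i \<and> i < \<tau> then 0 else imem s 12 i)"
    using base by (intro ext) auto
  then have "rand_state \<tau> \<tau> s (\<lambda>_. 0) = s" by (simp add: rand_state_def)
  moreover have "runs h rand_loop s 1 (return_pmf s)"
    unfolding rand_loop_def using base by (intro runs_WhileFalse) simp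
  ultimately show ?case by simp
next
  case (step k)
  define U where "U = pmf_of_set {0..<2 * n + 1}"
  define F where "F v = istore 8 0 (Suc k) (istore 12 k v s)" for v
  have U: "U = pmf_of_set {0..<ieval s (IPlus (IPlus (var 7) (var 7)) (INum 1))}"
    using step.prems by (simp add: U_def mult_2)
  have "runs h (Rand 12 (var 8) (IPlus (IPlus (var 7) (var 7)) (INum 1))) s 1
      (map_pmf (\<lambda>v. istore 12 (ieval s (var 8)) v s) U)"
    unfolding U by (rule runs_Rand) simp
  then have "runs h (Rand 12 (var 8) (IPlus (IPlus (var 7) (var 7)) (INum 1))) s 1
      (map_pmf (\<lambda>v. istore 12 k v s) U)" using step.prems by simp
  from runs_Seq[OF this runs_straight_line[of "incr 8"]]
  have "runs h (Seq (Rand 12 (var 8) (IPlus (IPlus (var 7) (var 7)) (INum 1))) (incr 8)) s (1 + 1)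
      (map_pmf (\<lambda>v. istore 12 k v s) U \<bind> (\<lambda>s'. return_pmf (exec h (incr 8) s')))" by simp
  also have "map_pmf (\<lambda>v. istore 12 k v s) U \<bind> (\<lambda>s'. return_pmf (exec h (incr 8) s')) = map_pmf F U"
    using step.prems by (simp add: map_pmf_def bind_assoc_pmf bind_return_pmf F_def)
  finally have body: "runs h (Seq (Rand 12 (var 8) (IPlus (IPlus (var 7) (var 7)) (INum 1))) (incr 8)) s (1 + 1) (map_pmf F U)" .
  have rest: "runs h rand_loop s' ((\<tau> - Suc k) * 3 + 1)
      (map_pmf (rand_state (Suc k) \<tau> s') (Pi_pmf {Suc k..<\<tau>} 0 (\<lambda>_. U)))" if "s' \<in> set_pmf (map_pmf F U)" for s'
    unfolding U_def using that step.prems by (intro step.IH) (auto simp: F_def)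
  have "runs h rand_loop s (1 + 1 + ((\<tau> - Suc k) * 3 + 1) + 1)
      (map_pmf F U \<bind> (\<lambda>s'. map_pmf (rand_state (Suc k) \<tau> s') (Pi_pmf {Suc k..<\<tau>} 0 (\<lambda>_. U))))"
    unfolding rand_loop_def
    by (rule runs_WhileTrue[OF _ body rest[unfolded rand_loop_def]]) (use step in auto)
  moreover have "1 + 1 + ((\<tau> - Suc k) * 3 + 1) + 1 = (\<tau> - k) * 3 + 1" using step.hyps by simp
  moreover have "map_pmf F U \<bind> (\<lambda>s'. map_pmf (rand_state (Suc k) \<tau> s') (Pi_pmf {Suc k..<\<tau>} 0 (\<lambda>_. U))) =
      map_pmf (rand_state k \<tau> s) (Pi_pmf {k..<\<tau>} 0 (\<lambda>_. U))"
  proof -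
    have st: "rand_state (Suc k) \<tau> (F v) g = rand_state k \<tau> s (g(k := v))" for v g
      unfolding rand_state_def F_def istore_def using step.hyps
      by (auto intro!: mstate.equality ext simp: le_Suc_eq Suc_le_eq)
    have "{k..<\<tau>} = insert k {Suc k..<\<tau>}" using step.hyps by auto
    then have "Pi_pmf {k..<\<tau>} 0 (\<lambda>_. U) =
        U \<bind> (\<lambda>v. Pi_pmf {Suc k..<\<tau>} 0 (\<lambda>_. U) \<bind> (\<lambda>g. return_pmf (g(k := v))))"
      using Pi_pmf_insert'[of "{Suc k..<\<tau>}" k 0 "\<lambda>_. U"] by simp
    then show ?thesis
      by (simp add: map_pmf_def bind_assoc_pmf bind_return_pmf st)
  qed
  ultimately show ?case by (simp only: U_def)
qed

definition threshold_prog :: com where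
  "threshold_prog = Seq (assign 8 (INum 0)) (While (ILess (var 8) (ILoad 0 (INum 1)))
     (Seq (Cond (ILess (ILoad 12 (var 8)) (var 7)) (IStore 2 (var 8) (INum 1)) Skip) (incr 8)))"

lemma halts_threshold_prog:
  assumes "imem s0 0 1 = \<tau>" "imem s0 7 0 = n" "imem s0 2 = (\<lambda>_. 0)"
  shows "halts h threshold_prog s0 (4 * \<tau> + 2) (\<lambda>s. agree {2, 8} {} s0 s \<and>
    imem s 2 = (\<lambda>i. of_bool (i < \<tau> \<and> imem s0 12 i < n)))"
  unfolding threshold_prog_def
proof (rule halts_Seq)
  let ?I = "\<lambda>k s. agree {2, 8} {} s0 s \<and> imem s 8 0 = k \<and>
    imem s 2 = (\<lambda>i. of_bool (i < k \<and> imem s0 12 i < n))"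
  let ?b = "ILess (var 8) (ILoad 0 (INum 1))"
  let ?c = "Seq (Cond (ILess (ILoad 12 (var 8)) (var 7)) (IStore 2 (var 8) (INum 1)) Skip) (incr 8)"
  show "halts h (assign 8 (INum 0)) s0 1 (?I 0)"
    using assms by (intro halts_straight_line) (auto simp: agree_def)
  show "halts h (While ?b ?c) s (\<tau> * (3 + 1) + 1) (\<lambda>s. agree {2, 8} {} s0 s \<and>
    imem s 2 = (\<lambda>i. of_bool (i < \<tau> \<and> imem s0 12 i < n)))" if "?I 0 s" for s
  proof (rule halts_weaken[OF halts_While[where I = ?I and N = \<tau> and t = 3]])
    fix k s assume k: "k < \<tau>" and I: "?I k s"
    show "beval s ?b \<and> halts h ?c s 3 (?I (Suc k))"
      using I k assms by (intro conjI halts_straight_line) (auto simp: agree_def less_Suc_eq)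
  next
    fix s assume "?I \<tau> s"
    then show "\<not> beval s ?b" using assms by (auto simp: agree_def)
  qed (use that in auto)
qed simp

text \<open>Doubling \<open>var 10\<close> until the hash value is below twice that number finds the
  level, and adding m to \<open>var 11\<close> in each round produces the row without a
  multiplication. The test for a positive hash value matters: for the value 0 the loop stops at
  level 0, where truncated subtraction yields 0 and the test against a positive weight would
  succeed.\<close>

definition key_prog :: com where
  "key_prog = Seq (Seq (assign 13 (ILoad 1 (var 8))) (Seq (Hash 9 (INum 0) (INum 0) (var 13))
       (Seq (Hash 11 (INum 0) (INum 1) (var 13)) (assign 10 (INum 1)))))
     (Seq (While (BNot (ILess (var 9) (IPlus (var 10) (var 10))))
         (Seq (assign 10 (IPlus (var 10) (var 10))) (assign 11 (IPlus (var 11) (var 6)))))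
       (Seq (Cond (BAnd (ILess (INum 0) (var 9))
             (RLess (RInt (IMinus (var 9) (var 10))) (RTimes (RLoad 1 (var 13)) (RInt (var 10)))))
           (IStore 2 (var 11) (IMinus (INum 1) (ILoad 2 (var 11)))) Skip)
         (incr 8)))"

definition keys_prog :: com where
  "keys_prog = Seq (assign 8 (INum 0)) (While (ILess (var 8) (ILoad 0 (INum 2))) key_prog)"

text \<open>The value 0 lies in no dyadic interval and is assigned l = 0, hence the condition on the
  lower bound.\<close>

lemma obtain_level:
  fixes a :: nat
  assumes "a < 2 ^ L" "0 < L"
  obtains l where "l < L" "a < 2 ^ Suc l" "0 < a \<Longrightarrow> 2 ^ l \<le> a" "\<And>i. i < l \<Longrightarrow> 2 ^ Suc i \<le> a"
proof -
  define l where "l = (LEAST l. a < 2 ^ Suc l)"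
  have ex: "a < 2 ^ Suc (L - 1)" using assms by simp
  have 1: "a < 2 ^ Suc l" unfolding l_def by (rule LeastI[of "\<lambda>l. a < 2 ^ Suc l", OF ex])
  have "l \<le> L - 1" unfolding l_def by (rule Least_le[of "\<lambda>l. a < 2 ^ Suc l", OF ex])
  then have 2: "l < L" using assms(2) by simp
  have 3: "2 ^ Suc i \<le> a" if "i < l" for i
    using not_less_Least[of i "\<lambda>l. a < 2 ^ Suc l"] that unfolding l_def by (simp add: not_less)
  have "2 ^ l \<le> a" if "0 < a" using that 3[of "l - 1"] by (cases l) auto
  with 1 2 3 that show thesis by blast
qed

text \<open>\<open>base\<close> stands for the current contents of the output array, so that the
  effects of successive keys can be added up over GF(2).\<close>

lemma halts_key_prog:
  fixes w :: "real vec" and base :: "nat \<Rightarrow> bit"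
  assumes j: "j = imem s 1 (imem s 8 0)" "w $ j \<le> 1" "rmem s 1 j = w $ j"
    and h: "h (0, j) < 2 ^ L" and L: "0 < L"
    and m: "imem s 6 0 = m" and out: "imem s 2 = (\<lambda>i. of_bool (base i = 1))"
  shows "halts h key_prog s (3 * L + 8) (\<lambda>s'. agree {2, 8, 9, 10, 11, 13} {} s s' \<and>
    imem s' 8 0 = Suc (imem s 8 0) \<and>
    imem s' 2 = (\<lambda>i. of_bool (base i + of_bool (cell w L m h j i) = 1)))"
  unfolding key_prog_def
proof (rule halts_Seq)
  obtain l where l: "l < L" "h (0, j) < 2 ^ Suc l" "0 < h (0, j) \<Longrightarrow> 2 ^ l \<le> h (0, j)"
    "\<And>i. i < l \<Longrightarrow> 2 ^ Suc i \<le> h (0, j)" using obtain_level[OF h L] by blast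
  let ?I = "\<lambda>k s'. agree {9, 10, 11, 13} {} s s' \<and> imem s' 9 0 = h (0, j) \<and> imem s' 13 0 = j \<and>
    imem s' 10 0 = 2 ^ k \<and> imem s' 11 0 = k * m + h (1, j)"
  let ?b = "BNot (ILess (var 9) (IPlus (var 10) (var 10)))"
  let ?c = "Seq (assign 10 (IPlus (var 10) (var 10))) (assign 11 (IPlus (var 11) (var 6)))"
  show "halts h (Seq (assign 13 (ILoad 1 (var 8))) (Seq (Hash 9 (INum 0) (INum 0) (var 13))
       (Seq (Hash 11 (INum 0) (INum 1) (var 13)) (assign 10 (INum 1))))) s 4 (?I 0)"
    using j by (intro halts_straight_line) (auto simp: agree_def)
  fix s1 assume s1: "?I 0 s1"
  let ?d = "Seq (Cond (BAnd (ILess (INum 0) (var 9))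
             (RLess (RInt (IMinus (var 9) (var 10))) (RTimes (RLoad 1 (var 13)) (RInt (var 10)))))
           (IStore 2 (var 11) (IMinus (INum 1) (ILoad 2 (var 11)))) Skip) (incr 8)"
  show "halts h (Seq (While ?b ?c) ?d) s1 (3 * L + 4) (\<lambda>s'. agree {2, 8, 9, 10, 11, 13} {} s s' \<and>
    imem s' 8 0 = Suc (imem s 8 0) \<and>
    imem s' 2 = (\<lambda>i. of_bool (base i + of_bool (cell w L m h j i) = 1)))"
  proof (rule halts_Seq)
    show "halts h (While ?b ?c) s1 (3 * l + 1) (?I l)"
    proof (rule halts_While[where I = ?I and t = 2])
      fix k s' assume k: "k < l" and I: "?I k s'"
      have "imem s' 6 0 = m" using I m by (simp add: agree_def)
      then show "beval s' ?b \<and> halts h ?c s' 2 (?I (Suc k))"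
        using I k l(4)[OF k] by (intro conjI halts_straight_line) (auto simp: agree_def)
    next
      fix s' assume "?I l s'"
      then show "\<not> beval s' ?b" using l(2) by auto
    qed (use s1 in auto)
    fix s2 assume s2: "?I l s2"
    have mem: "0 < h (0, j) \<and> real (h (0, j) - 2 ^ l) < w $ j * 2 ^ l \<longleftrightarrow> h (0, j) \<in> level_keys w l j"
      using l(3) unfolding level_keys_def by (auto intro: less_le_trans[of 0 "2 ^ l"])
    have cell: "cell w L m h j i \<longleftrightarrow> h (0, j) \<in> level_keys w l j \<and> i = l * m + h (1, j)" for i
    proof -
      have "k = l" if "h (0, j) \<in> level_keys w k j" for k
      proof -
        note k = level_keys_interval[OF that j(2)]
        then have "0 < h (0, j)" by (auto intro: less_le_trans[of 0 "2 ^ k"])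
        from interval_level_unique[OF k l(3)[OF this] l(2)] show ?thesis .
      qed
      then show ?thesis using l(1) unfolding cell_def by blast
    qed
    have eq: "imem s2 2 = (\<lambda>i. of_bool (base i = 1))" "imem s2 8 = imem s 8" "rmem s2 1 j = w $ j"
      using s2 out j(3) by (auto simp: agree_def)
    show "halts h ?d s2 3 (\<lambda>s'. agree {2, 8, 9, 10, 11, 13} {} s s' \<and>
      imem s' 8 0 = Suc (imem s 8 0) \<and>
      imem s' 2 = (\<lambda>i. of_bool (base i + of_bool (cell w L m h j i) = 1)))"
    proof (rule halts_straight_line)
      show "agree {2, 8, 9, 10, 11, 13} {} s (exec h ?d s2) \<and>
        imem (exec h ?d s2) 8 0 = Suc (imem s 8 0) \<and>
        imem (exec h ?d s2) 2 = (\<lambda>i. of_bool (base i + of_bool (cell w L m h j i) = 1))"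
      proof (cases "h (0, j) \<in> level_keys w l j")
        case True
        then have "exec h ?d s2 = exec h (incr 8) (istore 2 (l * m + h (1, j)) (1 - imem s2 2 (l * m + h (1, j))) s2)"
          using mem s2 eq by simp
        then show ?thesis using s2 eq True by (auto simp: agree_def cell)
      next
        case False
        then have "exec h ?d s2 = exec h (incr 8) s2" using mem s2 eq by auto
        then show ?thesis using s2 eq False by (auto simp: agree_def cell)
      qed
    qed auto
  qed (use l(1) in simp)
qed simp

lemma halts_keys_prog:
  fixes w :: "real vec" and base :: "nat \<Rightarrow> bit"
  assumes zs: "imem s0 1 = nth_default 0 zs" "imem s0 0 2 = length zs" "set zs \<subseteq> {..<u}"
    and w: "w \<in> carrier_vec u" "\<And>j. j < u \<Longrightarrow> w $ j \<le> 1" "rmem s0 1 = nth_default 0 (list_of_vec w)"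
    and h: "\<And>j. j < u \<Longrightarrow> h (0, j) < 2 ^ L" and L: "0 < L"
    and m: "imem s0 6 0 = m" and out: "imem s0 2 = (\<lambda>i. of_bool (base i = 1))"
  shows "halts h keys_prog s0 (length zs * (3 * L + 9) + 2) (\<lambda>s.
    imem s 2 = (\<lambda>i. of_bool (base i + (\<Sum>j\<leftarrow>zs. of_bool (cell w L m h j i)) = 1)))"
  unfolding keys_prog_def
proof (rule halts_Seq)
  let ?I = "\<lambda>k s. agree {2, 8, 9, 10, 11, 13} {} s0 s \<and> imem s 8 0 = k \<and>
    imem s 2 = (\<lambda>i. of_bool (base i + (\<Sum>j\<leftarrow>take k zs. of_bool (cell w L m h j i)) = 1))"
  let ?b = "ILess (var 8) (ILoad 0 (INum 2))"
  show "halts h (assign 8 (INum 0)) s0 1 (?I 0)"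
    using out by (intro halts_straight_line) (auto simp: agree_def)
  show "halts h (While ?b key_prog) s (length zs * (3 * L + 8 + 1) + 1) (\<lambda>s.
    imem s 2 = (\<lambda>i. of_bool (base i + (\<Sum>j\<leftarrow>zs. of_bool (cell w L m h j i)) = 1)))" if "?I 0 s" for s
  proof (rule halts_weaken[OF halts_While[where I = ?I and N = "length zs" and t = "3 * L + 8"]])
    fix k s assume k: "k < length zs" and I: "?I k s"
    let ?j = "zs ! k"
    have ju: "?j < u" using k zs(3) by (auto dest: nth_mem)
    have dim: "dim_vec w = u" using w(1) by simp
    have 1: "?j = imem s 1 (imem s 8 0)" using I zs(1) k by (simp add: agree_def nth_default_nth)
    have 2: "rmem s 1 ?j = w $ ?j"
      using I w(3) ju dim by (simp add: agree_def nth_default_def list_of_vec_index)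
    have 3: "imem s 6 0 = m" using I m by (simp add: agree_def)
    have "halts h key_prog s (3 * L + 8) (\<lambda>s'. agree {2, 8, 9, 10, 11, 13} {} s s' \<and>
      imem s' 8 0 = Suc (imem s 8 0) \<and>
      imem s' 2 = (\<lambda>i. of_bool (base i + (\<Sum>j\<leftarrow>take k zs. of_bool (cell w L m h j i))
        + of_bool (cell w L m h ?j i) = 1)))"
      using I by (intro halts_key_prog[where h = h, OF 1 w(2)[OF ju] 2 h[OF ju] L 3]) blast
    then have "halts h key_prog s (3 * L + 8) (?I (Suc k))"
      by (rule halts_weaken)
        (use I k in \<open>auto simp: agree_def take_Suc_conv_app_nth add.assoc simp del: add_bit_eq_xor\<close>)
    then show "beval s ?b \<and> halts h key_prog s (3 * L + 8) (?I (Suc k))"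
      using I k zs(2) by (simp add: agree_def)
  next
    fix s assume "?I (length zs) s"
    then show "\<not> beval s ?b" using zs(2) by (auto simp: agree_def)
  qed (use that in auto)
qed simp

definition sketcher_prog :: com where
  "sketcher_prog = Seq (Seq params_prog (assign 8 (INum 0)))
     (Seq rand_loop (Seq threshold_prog keys_prog))"

text \<open>The zero entries of \<open>x\<close> drop out of the row sum, so toggling the bits of
  the listed keys on top of the noise yields the noisy matrix product.\<close>

lemma sketch_bits:
  fixes w :: "real vec"
  assumes x: "x \<in> carrier_vec u" and zs: "sparse_rep x zs" and i: "i < L * m"
  shows "bits_of_vec (sketch_mat w L m u h *\<^sub>v x + noise_vec n (L * m) g) ! i =
    of_bool (of_bool (g i < n) + (\<Sum>j\<leftarrow>zs. of_bool (cell w L m h j i)) = (1 :: bit))"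
proof -
  let ?y = "sketch_mat w L m u h *\<^sub>v x + noise_vec n (L * m) g"
  have dim: "dim_vec x = u" using x by simp
  have Z: "set zs = {j. j < u \<and> x $ j \<noteq> 0}" "distinct zs" using zs unfolding sparse_rep_def dim by blast+
  have "bits_of_vec ?y ! i = of_bool (?y $ i = 1)"
    using i by (simp add: bits_of_vec_def list_of_vec_index noise_vec_def)
  also have "?y $ i = (\<Sum>j\<in>{0..<u}. of_bool (cell w L m h j i) * x $ j) + of_bool (g i < n)"
    using i x by (simp add: noise_vec_def sketch_mat_def scalar_prod_def)
  also have "(\<Sum>j\<in>{0..<u}. of_bool (cell w L m h j i) * x $ j) = (\<Sum>j\<in>set zs. of_bool (cell w L m h j i))"
  proof (rule sum.mono_neutral_cong_right)
    show "set zs \<subseteq> {0..<u}" unfolding Z(1) by auto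
    show "\<forall>j\<in>{0..<u} - set zs. of_bool (cell w L m h j i) * x $ j = 0"
      unfolding Z(1) by auto
    show "of_bool (cell w L m h j i) * x $ j = of_bool (cell w L m h j i)" if "j \<in> set zs" for j
      using that unfolding Z(1) by auto
  qed simp
  also have "\<dots> = (\<Sum>j\<leftarrow>zs. of_bool (cell w L m h j i))"
    by (rule sum_list_distinct_conv_sum_set[OF Z(2), symmetric])
  finally show ?thesis by (simp only: add.commute)
qed

text \<open>The output array is initialised with the noise bits, and the keys toggle them in place.
  Noise takes 7 steps per entry of the sketch (3 for drawing, 4 for thresholding), and a key takes 3
  L + 9 steps for finding its level and flipping its bit.\<close>

lemma computes_sketcher_prog:
  fixes w :: "real vec"
  assumes u: "\<And>k. k < L \<Longrightarrow> 2 ^ k < u" "u \<le> 2 ^ L" "0 < L" and m: "0 < m"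
    and \<epsilon>: "\<And>k. k < n \<Longrightarrow> real k * \<epsilon> < 1" "1 \<le> real n * \<epsilon>"
    and w: "w \<in> carrier_vec u" "\<And>j. j < u \<Longrightarrow> w $ j \<le> 1"
    and h: "h \<in> set_pmf (hash_functions 2 (hash_range L m) u)"
    and x: "x \<in> carrier_vec u" and zs: "sparse_rep x zs"
    and T: "real (3 * L + 3 * m + 2 * n + 14 + 7 * (L * m) + length zs * (3 * L + 9)) \<le> T"
  shows "computes_within h sketcher_prog (input_state u w \<beta> \<epsilon> (L * m) zs) T (vec_output (L * m))
    (map_pmf (\<lambda>\<phi>. bits_of_vec (sketch_mat w L m u h *\<^sub>v x + \<phi>))
      (map_pmf (noise_vec n (L * m)) (raw_noise n (L * m))))"
proof -
  let ?s0 = "input_state u w \<beta> \<epsilon> (L * m) zs"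
  let ?\<tau> = "L * m"
  have s0: "imem ?s0 0 0 = u" "imem ?s0 0 1 = L * m" "imem ?s0 0 2 = length zs" "imem ?s0 1 = nth_default 0 zs"
      "imem ?s0 2 = (\<lambda>_. 0)" "rmem ?s0 0 1 = \<epsilon>" "rmem ?s0 1 = nth_default 0 (list_of_vec w)"
    by (simp_all add: input_state_def nth_default_def)
  have zsu: "set zs \<subseteq> {..<u}" using zs x by (auto simp: sparse_rep_def)
  let ?Q = "\<lambda>s. agree {3, 4, 5, 6, 7, 8} {} ?s0 s \<and> imem s 6 0 = m \<and> imem s 7 0 = n \<and> imem s 8 0 = 0"
  show ?thesis unfolding sketcher_prog_def
  proof (rule computes_within_Seq)
    show "halts h (Seq params_prog (assign 8 (INum 0))) ?s0 (3 * L + 3 * m + 2 * n + 8 + 1) ?Q"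
      by (rule halts_Seq[OF halts_params_prog[of ?s0 u L m \<epsilon> n]])
        (use s0 u \<epsilon> in \<open>auto intro!: halts_straight_line simp: agree_def\<close>)
    fix s1 assume s1: "?Q s1"
    then have mem1: "imem s1 0 = imem ?s0 0" "imem s1 1 = imem ?s0 1" "imem s1 2 = imem ?s0 2" "rmem s1 = rmem ?s0"
      by (auto simp: agree_def)
    have "computes_within h (Seq rand_loop (Seq threshold_prog keys_prog)) s1
        (real (?\<tau> * 3 + 1 + (4 * ?\<tau> + 2 + (length zs * (3 * L + 9) + 2)))) (vec_output ?\<tau>)
        (map_pmf (\<lambda>g. bits_of_vec (sketch_mat w L m u h *\<^sub>v x + noise_vec n ?\<tau> g)) (raw_noise n ?\<tau>))"
    proof (rule computes_within_bind)
      show "runs h rand_loop s1 (?\<tau> * 3 + 1) (map_pmf (rand_state 0 ?\<tau> s1) (raw_noise n ?\<tau>))"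
        using runs_rand_loop_from[of 0 ?\<tau> s1 n h] s1 mem1 s0 by simp
      fix g
      let ?s2 = "rand_state 0 ?\<tau> s1 g"
      define base :: "nat \<Rightarrow> bit" where "base i = of_bool (i < ?\<tau> \<and> g i < n)" for i
      have mem2: "imem ?s2 0 = imem ?s0 0" "imem ?s2 1 = imem ?s0 1" "imem ?s2 2 = imem ?s0 2" "rmem ?s2 = rmem ?s0"
          "imem ?s2 6 0 = m" "imem ?s2 7 0 = n" "\<And>i. i < ?\<tau> \<Longrightarrow> imem ?s2 12 i = g i"
        using mem1 s1 by (simp_all add: rand_state_def)
      let ?R = "\<lambda>s. agree {2, 8} {} ?s2 s \<and> imem s 2 = (\<lambda>i. of_bool (i < ?\<tau> \<and> imem ?s2 12 i < n))"
      show "halts h (Seq threshold_prog keys_prog) ?s2 (4 * ?\<tau> + 2 + (length zs * (3 * L + 9) + 2))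
          (\<lambda>s'. vec_output ?\<tau> s' = bits_of_vec (sketch_mat w L m u h *\<^sub>v x + noise_vec n ?\<tau> g))"
      proof (rule halts_Seq)
        show "halts h threshold_prog ?s2 (4 * ?\<tau> + 2) ?R"
          using mem2 s0 by (intro halts_threshold_prog) auto
        fix s3 assume s3: "?R s3"
        then have mem3: "imem s3 0 = imem ?s0 0" "imem s3 1 = imem ?s0 1" "rmem s3 = rmem ?s0" "imem s3 6 0 = m"
          using mem2 by (auto simp: agree_def)
        have base: "imem s3 2 = (\<lambda>i. of_bool (base i = 1))"
          using s3 mem2(7) by (auto simp: base_def fun_eq_iff)
        have "halts h keys_prog s3 (length zs * (3 * L + 9) + 2) (\<lambda>s.
            imem s 2 = (\<lambda>i. of_bool (base i + (\<Sum>j\<leftarrow>zs. of_bool (cell w L m h j i)) = 1)))"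
          using s0 mem3 zsu w hash_range_support(1)[OF h m] u(3) base
          by (intro halts_keys_prog[of _ _ u]) auto
        then show "halts h keys_prog s3 (length zs * (3 * L + 9) + 2)
          (\<lambda>s'. vec_output ?\<tau> s' = bits_of_vec (sketch_mat w L m u h *\<^sub>v x + noise_vec n ?\<tau> g))"
        proof (rule halts_weaken)
          fix s' :: mstate assume s': "imem s' 2 = (\<lambda>i. of_bool (base i + (\<Sum>j\<leftarrow>zs. of_bool (cell w L m h j i)) = 1))"
          show "vec_output ?\<tau> s' = bits_of_vec (sketch_mat w L m u h *\<^sub>v x + noise_vec n ?\<tau> g)"
          proof (rule nth_equalityI)
            show "length (vec_output ?\<tau> s') = length (bits_of_vec (sketch_mat w L m u h *\<^sub>v x + noise_vec n ?\<tau> g))"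
              by (simp add: vec_output_def bits_of_vec_def noise_vec_def)
            fix i assume "i < length (vec_output ?\<tau> s')"
            then have i: "i < ?\<tau>" by (simp add: vec_output_def)
            then have "vec_output ?\<tau> s' ! i = imem s' 2 i" by (simp add: vec_output_def)
            then show "vec_output ?\<tau> s' ! i = bits_of_vec (sketch_mat w L m u h *\<^sub>v x + noise_vec n ?\<tau> g) ! i"
              unfolding sketch_bits[OF x zs i] s' using i by (simp only: base_def simp_thms)
          qed
        qed simp
      qed simp
    qed simp
    then show "computes_within h (Seq rand_loop (Seq threshold_prog keys_prog)) s1
        (real (?\<tau> * 3 + 1 + (4 * ?\<tau> + 2 + (length zs * (3 * L + 9) + 2)))) (vec_output ?\<tau>)
        (map_pmf (\<lambda>\<phi>. bits_of_vec (sketch_mat w L m u h *\<^sub>v x + \<phi>))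
      (map_pmf (noise_vec n (L * m)) (raw_noise n (L * m))))"
      by (simp only: map_pmf_comp)
  next
    show "real (3 * L + 3 * m + 2 * n + 8 + 1) +
        real (?\<tau> * 3 + 1 + (4 * ?\<tau> + 2 + (length zs * (3 * L + 9) + 2))) \<le> T"
      using T by simp
  qed
qed

subsection \<open>The estimation program\<close>

text \<open>\<open>var 9\<close> is not reset between levels: it walks through all bits of the
  sketch, so level k starts at k m without a multiplication. The search loop also tests that the
  ratio is at least 1/2, which guarantees that it makes at most m rounds.\<close>

definition level_prog :: com where
  "level_prog = Seq (Seq (assign 11 (INum 0)) (assign 12 (INum 0)))
    (Seq (While (ILess (var 11) (var 6))
        (Seq (assign 12 (IPlus (var 12) (ILoad 1 (var 9)))) (Seq (incr 9) (incr 11))))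
    (Seq (Seq (RStore 3 (INum 0) (RDivide (RTimes
            (RMinus (RInt (var 6)) (RInt (IPlus (var 12) (var 12))))
            (RInt (IPlus (IPlus (var 7) (var 7)) (INum 1)))) (RInt (var 6))))
          (Seq (RStore 4 (INum 0) (RInt (INum 1))) (assign 13 (INum 0))))
    (Seq (While (BAnd (RLess (RLoad 3 (INum 0)) (RLoad 4 (INum 0)))
            (BNot (RLess (RLoad 3 (INum 0)) (RDivide (RInt (INum 1)) (RInt (INum 2))))))
          (Seq (RStore 4 (INum 0) (RTimes (RLoad 4 (INum 0))
              (RMinus (RInt (INum 1)) (RDivide (RInt (INum 1)) (RInt (var 6))))))
            (incr 13)))
      (Seq (Cond (RLess (RLoad 3 (INum 0)) (RDivide (RInt (INum 1)) (RInt (INum 2)))) Skip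
          (RStore 2 (INum 0) (RDivide (RTimes (RInt (var 13)) (RInt (var 3))) (RInt (IPlus (var 10) (var 10))))))
        (Seq (assign 10 (IPlus (var 10) (var 10))) (incr 8))))))"

definition estimator_prog :: com where
  "estimator_prog = Seq params_prog (Seq (Seq (assign 8 (INum 0)) (Seq (assign 9 (INum 0)) (assign 10 (INum 1))))
     (While (ILess (var 8) (var 4)) level_prog))"

abbreviation level_frame :: "mstate \<Rightarrow> mstate \<Rightarrow> bool" where
  "level_frame \<equiv> agree {8, 9, 10, 11, 12, 13} {2, 3, 4}"

lemma halts_level_prog:
  assumes p: "imem s 3 0 = 2 ^ L" "imem s 6 0 = m" "imem s 7 0 = n" and m: "2 \<le> m"
    and k: "imem s 8 0 = k" "imem s 9 0 = k * m" "imem s 10 0 = 2 ^ k"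
  defines "R \<equiv> level_ratio n m (imem s 1)"
  assumes e: "rmem s 2 0 = level_estimate R m L k"
  shows "halts h level_prog s (7 * m + 12) (\<lambda>s'. level_frame s s' \<and>
    imem s' 8 0 = Suc k \<and> imem s' 9 0 = Suc k * m \<and> imem s' 10 0 = 2 ^ Suc k \<and>
    rmem s' 2 0 = level_estimate R m L (Suc k))" (is "halts h _ s _ ?Q")
proof -
  let ?F = "\<lambda>s'. level_frame s s' \<and> imem s' 8 0 = k \<and> imem s' 10 0 = 2 ^ k \<and> rmem s' 2 0 = rmem s 2 0"
  let ?I1 = "\<lambda>b s'. ?F s' \<and> imem s' 11 0 = b \<and> imem s' 9 0 = k * m + b \<and>
    imem s' 12 0 = (\<Sum>b<b. imem s 1 (k * m + b))"
  \<comment> \<open>The number of iterations of the search loop: a level below the threshold skips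
    it.\<close>
  define N where "N = (if R k < 1/2 then 0 else decay_steps m (R k))"
  have Nm: "N \<le> m" unfolding N_def using decay_steps(2)[OF m, of "R k"] by auto
  let ?I2 = "\<lambda>i s'. ?F s' \<and> imem s' 9 0 = Suc k * m \<and> rmem s' 3 0 = R k \<and>
    rmem s' 4 0 = (1 - 1 / real m) ^ i \<and> imem s' 13 0 = i"
  let ?b1 = "ILess (var 11) (var 6)"
  let ?c1 = "Seq (assign 12 (IPlus (var 12) (ILoad 1 (var 9)))) (Seq (incr 9) (incr 11))"
  let ?init = "Seq (RStore 3 (INum 0) (RDivide (RTimes
            (RMinus (RInt (var 6)) (RInt (IPlus (var 12) (var 12))))
            (RInt (IPlus (IPlus (var 7) (var 7)) (INum 1)))) (RInt (var 6))))
          (Seq (RStore 4 (INum 0) (RInt (INum 1))) (assign 13 (INum 0)))"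
  let ?b = "BAnd (RLess (RLoad 3 (INum 0)) (RLoad 4 (INum 0)))
    (BNot (RLess (RLoad 3 (INum 0)) (RDivide (RInt (INum 1)) (RInt (INum 2)))))"
  let ?c = "Seq (RStore 4 (INum 0) (RTimes (RLoad 4 (INum 0))
      (RMinus (RInt (INum 1)) (RDivide (RInt (INum 1)) (RInt (var 6)))))) (incr 13)"
  let ?d = "Seq (Cond (RLess (RLoad 3 (INum 0)) (RDivide (RInt (INum 1)) (RInt (INum 2)))) Skip
          (RStore 2 (INum 0) (RDivide (RTimes (RInt (var 13)) (RInt (var 3))) (RInt (IPlus (var 10) (var 10))))))
        (Seq (assign 10 (IPlus (var 10) (var 10))) (incr 8))"
  show ?thesis unfolding level_prog_def
  proof (rule halts_Seq[where t = 2 and t' = "7 * m + 10" and Q = "?I1 0"])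
    show "halts h (Seq (assign 11 (INum 0)) (assign 12 (INum 0))) s 2 (?I1 0)"
      using k by (intro halts_straight_line) (auto simp: agree_def)
  next
    fix s1 assume s1: "?I1 0 s1"
    show "halts h (Seq (While ?b1 ?c1) (Seq ?init (Seq (While ?b ?c) ?d))) s1 (7 * m + 10) ?Q"
    proof (rule halts_Seq[where t = "4 * m + 1" and t' = "3 * m + 8" and Q = "?I1 m"])
      show "halts h (While ?b1 ?c1) s1 (4 * m + 1) (?I1 m)"
      proof (rule halts_While[where I = ?I1 and t = 3])
        fix b s' assume b: "b < m" and I: "?I1 b s'"
        have "imem s' 6 0 = m" "imem s' 1 = imem s 1" using I p by (simp_all add: agree_def)
        then show "beval s' ?b1 \<and>
          halts h ?c1 s' 3 (?I1 (Suc b))"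
          using I b by (intro conjI halts_straight_line) (auto simp: agree_def)
      next
        fix s' assume I: "?I1 m s'"
        have "imem s' 6 0 = m" using I p by (simp add: agree_def)
        then show "\<not> beval s' ?b1" using I by simp
      qed (use s1 in auto)
    next
      fix s2 assume s2: "?I1 m s2"
      then have p2: "imem s2 6 0 = m" "imem s2 7 0 = n" using p by (simp_all add: agree_def)
      show "halts h (Seq ?init (Seq (While ?b ?c) ?d)) s2 (3 * m + 8) ?Q"
      proof (rule halts_Seq[where t = 3 and t' = "3 * m + 5" and Q = "?I2 0"])
        show "halts h ?init s2 3 (?I2 0)"
        proof (rule halts_straight_line)
          let ?S = "\<Sum>b<m. imem s 1 (k * m + b)"
          have "R k = (real m - real (?S + ?S)) * real (n + n + 1) / real m"
            unfolding R_def level_ratio_def by (simp only: mult_2 of_nat_add)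
          then show "?I2 0 (exec h ?init s2)"
            using s2 p2 by (simp add: agree_def)
        qed auto
      next
        fix s3 assume s3: "?I2 0 s3"
        show "halts h (Seq (While ?b ?c) ?d) s3 (3 * m + 5) ?Q"
        proof (rule halts_Seq[where t = "3 * m + 1" and t' = 4 and Q = "?I2 N"])
          show "halts h (While ?b ?c) s3 (3 * m + 1) (?I2 N)"
          proof (rule halts_While[where I = ?I2 and t = 2])
            fix i s' assume i: "i < N" and I: "?I2 i s'"
            have R: "1/2 \<le> R k" "i < decay_steps m (R k)" using i by (auto simp: N_def split: if_splits)
            have "imem s' 6 0 = m" using I p by (simp add: agree_def)
            then show "beval s' ?b \<and> halts h ?c s' 2 (?I2 (Suc i))"
              using I R decay_steps(3)[OF m R] by (intro conjI halts_straight_line) (auto simp: agree_def)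
          next
            fix s' assume I: "?I2 N s'"
            show "\<not> beval s' ?b"
              using I decay_steps(1)[OF m, of "R k"] by (auto simp: N_def split: if_splits)
          qed (use s3 Nm in auto)
        next
          fix s4 assume s4: "?I2 N s4"
          then have "imem s4 3 0 = 2 ^ L" using p by (simp add: agree_def)
          then show "halts h ?d s4 4 ?Q"
            using s4 e by (intro halts_straight_line) (auto simp: agree_def N_def)
        qed simp
      qed simp
    qed simp
  qed simp
qed

lemma computes_estimator_prog:
  assumes u: "\<And>k. k < L \<Longrightarrow> 2 ^ k < u" "u \<le> 2 ^ L" "0 < L" and m: "2 \<le> m"
    and \<epsilon>: "\<And>k. k < n \<Longrightarrow> real k * \<epsilon> < 1" "1 \<le> real n * \<epsilon>"
    and T: "real (3 * L + 3 * m + 2 * n + 12 + L * (7 * m + 13)) \<le> T"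
  shows "computes_within h estimator_prog (input_state u w \<beta> \<epsilon> (L * m) (bits_of_vec y)) T
    real_output (return_pmf (sketch_estimate n m L y))"
proof (rule computes_within_halts[OF _ T])
  let ?s0 = "input_state u w \<beta> \<epsilon> (L * m) (bits_of_vec y)"
  define R where "R = level_ratio n m (nth_default 0 (bits_of_vec y))"
  have s0: "imem ?s0 0 0 = u" "imem ?s0 0 1 = L * m" "imem ?s0 1 = nth_default 0 (bits_of_vec y)"
      "rmem ?s0 2 0 = 0" "rmem ?s0 0 1 = \<epsilon>"
    by (simp_all add: input_state_def nth_default_def)
  show "halts h estimator_prog ?s0 (3 * L + 3 * m + 2 * n + 12 + L * (7 * m + 13))
      (\<lambda>s'. real_output s' = sketch_estimate n m L y)"
    unfolding estimator_prog_def
  proof (rule halts_Seq[OF halts_params_prog[of ?s0 u L m \<epsilon> n]])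
    fix s1 assume s1: "agree {3, 4, 5, 6, 7} {} ?s0 s1 \<and>
      imem s1 3 0 = 2 ^ L \<and> imem s1 4 0 = L \<and> imem s1 6 0 = m \<and> imem s1 7 0 = n"
    let ?I = "\<lambda>k s'. level_frame s1 s' \<and> imem s' 8 0 = k \<and> imem s' 9 0 = k * m \<and>
      imem s' 10 0 = 2 ^ k \<and> rmem s' 2 0 = level_estimate R m L k"
    show "halts h (Seq (Seq (assign 8 (INum 0)) (Seq (assign 9 (INum 0)) (assign 10 (INum 1))))
        (While (ILess (var 8) (var 4)) level_prog)) s1 (3 + (L * (7 * m + 12 + 1) + 1))
        (\<lambda>s'. real_output s' = sketch_estimate n m L y)"
    proof (rule halts_Seq[where Q = "?I 0"])
      show "halts h (Seq (assign 8 (INum 0)) (Seq (assign 9 (INum 0)) (assign 10 (INum 1)))) s1 3 (?I 0)"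
        using s1 s0 by (intro halts_straight_line) (auto simp: agree_def)
      fix s2 assume s2: "?I 0 s2"
      show "halts h (While (ILess (var 8) (var 4)) level_prog) s2 (L * (7 * m + 12 + 1) + 1)
        (\<lambda>s'. real_output s' = sketch_estimate n m L y)"
      proof (rule halts_weaken[OF halts_While[where I = ?I and N = L and t = "7 * m + 12"]])
        fix k s' assume k: "k < L" and I: "?I k s'"
        have p: "imem s' 3 0 = 2 ^ L" "imem s' 4 0 = L" "imem s' 6 0 = m" "imem s' 7 0 = n"
          "imem s' 1 = nth_default 0 (bits_of_vec y)"
          using I s1 s0 by (simp_all add: agree_def)
        have "halts h level_prog s' (7 * m + 12) (\<lambda>s''. level_frame s' s'' \<and>
          imem s'' 8 0 = Suc k \<and> imem s'' 9 0 = Suc k * m \<and> imem s'' 10 0 = 2 ^ Suc k \<and>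
          rmem s'' 2 0 = level_estimate R m L (Suc k))"
          using halts_level_prog[OF p(1,3,4) m, of k h] I unfolding p(5) R_def[symmetric] by blast
        then have "halts h level_prog s' (7 * m + 12) (?I (Suc k))"
          by (rule halts_weaken) (use I in \<open>auto simp: agree_def\<close>)
        then show "beval s' (ILess (var 8) (var 4)) \<and> halts h level_prog s' (7 * m + 12) (?I (Suc k))"
          using I p k by simp
      next
        fix s' assume I: "?I L s'"
        have "imem s' 4 0 = L" using I s1 by (simp add: agree_def)
        then show "\<not> beval s' (ILess (var 8) (var 4))" using I by simp
      qed (use s2 in \<open>auto simp: real_output_def sketch_estimate_def R_def\<close>)
    qed simp
  qed (use s0 u \<epsilon> in auto)
qed

subsection \<open>Choice of the parameters\<close>

text \<open>L is the ceiling of log u. From 2^(L - 1) < u it follows that L < log u + 1, and log u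
  >= 1 turns this into the multiplicative bound.\<close>

lemma obtain_levels:
  assumes "2 \<le> u"
  obtains L :: nat where "\<And>k. k < L \<Longrightarrow> 2 ^ k < u" "u \<le> 2 ^ L" "0 < L" "L \<le> u" "real L \<le> 2 * log 2 (real u)"
proof -
  define L where "L = (LEAST L. u \<le> 2 ^ L)"
  have ex: "u \<le> 2 ^ u" using less_exp[of u] by simp
  have up: "u \<le> 2 ^ L" unfolding L_def by (rule LeastI[of "\<lambda>L. u \<le> 2 ^ L", OF ex])
  have le: "L \<le> u" unfolding L_def by (rule Least_le[of "\<lambda>L. u \<le> 2 ^ L", OF ex])
  have low: "2 ^ k < u" if "k < L" for k
    using not_less_Least[of k "\<lambda>L. u \<le> 2 ^ L"] that unfolding L_def by (simp add: not_le)
  have pos: "0 < L" using up assms by (cases L) auto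
  have "real (2 ^ (L - 1)) < real u" using low[of "L - 1"] pos by (simp only: of_nat_less_iff)
  then have "2 ^ (L - 1) < real u" by simp
  then have "log 2 (2 ^ (L - 1)) < log 2 (real u)" using assms by (subst log_less_cancel_iff) auto
  moreover have "log 2 2 \<le> log 2 (real u)" using assms by (subst log_le_cancel_iff) auto
  ultimately have "real L \<le> 2 * log 2 (real u)" using pos by (simp add: log_nat_power of_nat_diff)
  with that low up pos le show thesis by blast
qed

text \<open>n is the ceiling of 1 / \<epsilon>. The bound
  \<open>\<epsilon> \<le> \<epsilon>\<^sub>0\<close> enters here: 2 n + 1 <= 2 / \<epsilon> + 3, and
  the summand 3 is at most \<open>3 * \<epsilon>\<^sub>0 / \<epsilon>\<close>.\<close>

lemma obtain_bias:
  fixes \<epsilon> \<epsilon>\<^sub>0 :: real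
  assumes "0 < \<epsilon>" "\<epsilon> \<le> \<epsilon>\<^sub>0"
  obtains n :: nat where "0 < n" "\<And>k. k < n \<Longrightarrow> real k * \<epsilon> < 1" "1 \<le> real n * \<epsilon>"
    "real (2 * n + 1) \<le> (3 * \<epsilon>\<^sub>0 + 2) / \<epsilon>"
proof -
  define n where "n = nat \<lceil>1 / \<epsilon>\<rceil>"
  have n: "real n = of_int \<lceil>1 / \<epsilon>\<rceil>" using assms by (simp add: n_def of_nat_nat)
  have lo: "1 / \<epsilon> \<le> real n" unfolding n by simp
  have hi: "real n < 1 / \<epsilon> + 1" unfolding n by linarith
  have "0 < 1 / \<epsilon>" using assms by simp
  with lo have n0: "0 < n" by (metis of_nat_0_less_iff less_le_trans)
  have 1: "real k * \<epsilon> < 1" if "k < n" for k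
  proof -
    have "real k + 1 \<le> real n" using that by simp
    with hi have "real k < 1 / \<epsilon>" by linarith
    then show ?thesis using assms by (simp add: field_simps)
  qed
  have 2: "1 \<le> real n * \<epsilon>" using lo assms by (simp add: field_simps)
  have "real (2 * n + 1) \<le> 2 / \<epsilon> + 3" using hi by simp
  also have "\<dots> = (3 * \<epsilon> + 2) / \<epsilon>" using assms by (simp add: field_simps)
  also have "\<dots> \<le> (3 * \<epsilon>\<^sub>0 + 2) / \<epsilon>" using assms by (intro divide_right_mono) auto
  finally show thesis using that n0 1 2 by blast
qed

text \<open>m is the value demanded by the concentration bound, rounded up. Origin of the constant:
  L <= 2 lg gives 2^23, rounding at most doubles the value, and the error term 2 m doubles it once
  more. \<open>n \<le> m\<close> keeps the counting loop for n within the time bounds.\<close>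

lemma obtain_bucket_count:
  fixes \<epsilon> \<beta> a lg :: real
  assumes L: "0 < L" "real L \<le> 2 * lg" and \<beta>: "0 < \<beta>" "\<beta> < 1" and n: "real (2 * n + 1) \<le> a / \<epsilon>" and \<epsilon>: "0 < \<epsilon>"
  obtains m :: nat where "2 ^ 22 * real L * (real (2 * n + 1))\<^sup>2 / \<beta>\<^sup>2 \<le> real m" "2 \<le> m" "n \<le> m"
    "2 * real m \<le> 2 ^ 25 * a\<^sup>2 * (lg / (\<epsilon>\<^sup>2 * \<beta>\<^sup>2))"
    "real (L * m) \<le> 2 ^ 25 * a\<^sup>2 * (lg\<^sup>2 / (\<epsilon>\<^sup>2 * \<beta>\<^sup>2))"
proof -
  define X where "X = 2 ^ 22 * real L * (real (2 * n + 1))\<^sup>2 / \<beta>\<^sup>2"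
  define m where "m = nat \<lceil>X\<rceil>"
  have lg: "0 \<le> lg" using L by simp
  have "\<beta>\<^sup>2 \<le> 1" using \<beta> by (simp add: power_le_one)
  then have "1 \<le> 1 / \<beta>\<^sup>2" using \<beta> by simp
  have n2: "real (2 * n + 1) \<le> (real (2 * n + 1))\<^sup>2"
    using power_increasing[of 1 2 "real (2 * n + 1)"] by simp
  have "(2 ^ 22 * 1 * real (2 * n + 1)) * 1 \<le> (2 ^ 22 * real L * (real (2 * n + 1))\<^sup>2) * (1 / \<beta>\<^sup>2)"
    using L \<open>1 \<le> 1 / \<beta>\<^sup>2\<close> n2 by (intro mult_mono) auto
  then have X: "2 ^ 22 * real (2 * n + 1) \<le> X" by (simp add: X_def)
  then have X1: "2 + real n \<le> X" by simp
  have rm: "real m = of_int \<lceil>X\<rceil>" using X1 by (simp add: m_def of_nat_nat)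
  have m1: "X \<le> real m" unfolding rm by simp
  have "real m \<le> X + 1" unfolding rm by linarith
  with X1 have "real m \<le> 2 * X" by linarith
  have m2: "2 \<le> m" "n \<le> m" using m1 X1 by linarith+
  have "X \<le> 2 ^ 22 * (2 * lg) * (a / \<epsilon>)\<^sup>2 / \<beta>\<^sup>2"
    unfolding X_def using L n lg by (intro divide_right_mono mult_mono power_mono) auto
  also have "\<dots> = 2 ^ 23 * a\<^sup>2 * (lg / (\<epsilon>\<^sup>2 * \<beta>\<^sup>2))" by (simp add: power_divide)
  finally have bound: "2 * real m \<le> 2 ^ 25 * a\<^sup>2 * (lg / (\<epsilon>\<^sup>2 * \<beta>\<^sup>2))"
    using \<open>real m \<le> 2 * X\<close> by simp
  \<comment> \<open>With L / 2 <= lg, the bound on \<open>2 * real m\<close> can be reused.\<close>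
  have "real (L * m) = real L / 2 * (2 * real m)" by simp
  also have "\<dots> \<le> lg * (2 ^ 25 * a\<^sup>2 * (lg / (\<epsilon>\<^sup>2 * \<beta>\<^sup>2)))"
    by (rule mult_mono[OF _ bound]) (use L lg in auto)
  also have "\<dots> = 2 ^ 25 * a\<^sup>2 * (lg\<^sup>2 / (\<epsilon>\<^sup>2 * \<beta>\<^sup>2))" by (simp add: power2_eq_square)
  finally show thesis using that m1 m2 bound unfolding X_def by blast
qed

lemma l0_norm_sparse_rep: "sparse_rep x zs \<Longrightarrow> l0_norm x = length zs"
  unfolding sparse_rep_def l0_norm_def by (metis distinct_card)

text \<open>Both programs and \<open>C\<close> are fixed before u, w, \<beta> and \<epsilon>, which
  is why the programs have to recompute L, m and n from u, \<tau> and \<epsilon>.\<close>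

theorem theorem1:
  fixes \<epsilon>\<^sub>0 :: real
  assumes "0 < \<epsilon>\<^sub>0"
  shows "\<exists>(C::real) (estimator::com) (sketcher::com). 0 < C \<and>
    (\<forall>(u::nat) (w::real vec) (\<beta>::real) (\<epsilon>::real).
      2 \<le> u \<and> w \<in> carrier_vec u \<and> (\<forall>j<u. 0 < w $ j \<and> w $ j \<le> 1) \<and>
      0 < \<beta> \<and> \<beta> < 1 \<and> 0 < \<epsilon> \<and> \<epsilon> \<le> \<epsilon>\<^sub>0 \<longrightarrow>
      (\<exists>(\<tau>::nat) (\<H>::bit mat pmf) (\<N>::bit vec pmf)
          (k::nat) (r::nat \<Rightarrow> nat) (mat_of::(nat \<times> nat \<Rightarrow> nat) \<Rightarrow> bit mat)
          (est::bit vec \<Rightarrow> real).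
        real \<tau> \<le> C * ((log 2 (real u))\<^sup>2 / (\<epsilon>\<^sup>2 * \<beta>\<^sup>2)) \<and>
        set_pmf \<H> \<subseteq> carrier_mat \<tau> u \<and>
        set_pmf \<N> \<subseteq> carrier_vec \<tau> \<and>
        (\<forall>f<k. 0 < r f) \<and>
        \<H> = map_pmf mat_of (hash_functions k r u) \<and>
        (\<forall>y\<in>carrier_vec \<tau>.
          computes_within (\<lambda>_. 0) estimator
            (input_state u w \<beta> \<epsilon> \<tau> (bits_of_vec y)) (C * real \<tau>)
            real_output (return_pmf (est y))) \<and>
        (\<forall>x\<in>carrier_vec u.
          measure_pmf.prob (pair_pmf \<H> \<N>)
            {(H, \<phi>). \<bar>est (H *\<^sub>v x + \<phi>) - l1_norm (real_vec x \<circ>\<^sub>H w)\<bar>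
               < \<beta> * l1_norm (real_vec x \<circ>\<^sub>H w) + C * (log 2 (real u) / (\<epsilon>\<^sup>2 * \<beta>\<^sup>2))}
          \<ge> 1 - 1 / real u) \<and>
        (\<forall>H\<in>set_pmf \<H>.
          differentially_private \<epsilon> {0..<u}
            (\<lambda>S. map_pmf (\<lambda>\<phi>. H *\<^sub>v set_vec01 u S + \<phi>) \<N>)) \<and>
        (\<forall>h\<in>set_pmf (hash_functions k r u). \<forall>x\<in>carrier_vec u. \<forall>zs. sparse_rep x zs \<longrightarrow>
          computes_within h sketcher
            (input_state u w \<beta> \<epsilon> \<tau> zs) (C * (real (l0_norm x) * log 2 (real u) + real \<tau>))
            (vec_output \<tau>)
            (map_pmf (\<lambda>\<phi>. bits_of_vec (mat_of h *\<^sub>v x + \<phi>)) \<N>))))"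
proof -
  define a where "a = 3 * \<epsilon>\<^sub>0 + 2"
  \<comment> \<open>The first summand covers the dimension and the additive error, 100 the step
    counts of the programs. The sum strictly exceeds the first summand, which makes the final error
    inequality strict.\<close>
  define C where "C = 2 ^ 25 * a\<^sup>2 + 100"
  have C: "100 \<le> C" "0 < C" "2 ^ 25 * a\<^sup>2 < C" unfolding C_def by (auto simp: add_nonneg_pos)
  show ?thesis
  proof (rule exI[of _ C], rule exI[of _ estimator_prog], rule exI[of _ sketcher_prog], intro conjI allI impI)
    show "0 < C" by (rule C(2))
    fix u :: nat and w :: "real vec" and \<beta> \<epsilon> :: real
    assume *: "2 \<le> u \<and> w \<in> carrier_vec u \<and> (\<forall>j<u. 0 < w $ j \<and> w $ j \<le> 1) \<and>
      0 < \<beta> \<and> \<beta> < 1 \<and> 0 < \<epsilon> \<and> \<epsilon> \<le> \<epsilon>\<^sub>0"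
    define lg where "lg = log 2 (real u)"
    have w: "0 < w $ j \<and> w $ j \<le> 1" "w $ j \<le> 1" if "j < u" for j using * that by auto
    have wc: "w \<in> carrier_vec u" and \<beta>: "0 < \<beta>" "\<beta> < 1" and \<epsilon>: "0 < \<epsilon>" "\<epsilon> \<le> \<epsilon>\<^sub>0" and u2: "2 \<le> u"
      using * by auto
    obtain L where L: "\<And>k. k < L \<Longrightarrow> 2 ^ k < u" "u \<le> 2 ^ L" "0 < L" "L \<le> u" "real L \<le> 2 * lg"
      using obtain_levels[OF u2] unfolding lg_def by blast
    obtain n where n: "0 < n" "\<And>k. k < n \<Longrightarrow> real k * \<epsilon> < 1" "1 \<le> real n * \<epsilon>" "real (2 * n + 1) \<le> a / \<epsilon>"
      using obtain_bias[OF \<epsilon>] unfolding a_def by blast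
    obtain m where m: "2 ^ 22 * real L * (real (2 * n + 1))\<^sup>2 / \<beta>\<^sup>2 \<le> real m" "2 \<le> m" "n \<le> m"
      "2 * real m \<le> 2 ^ 25 * a\<^sup>2 * (lg / (\<epsilon>\<^sup>2 * \<beta>\<^sup>2))"
      "real (L * m) \<le> 2 ^ 25 * a\<^sup>2 * (lg\<^sup>2 / (\<epsilon>\<^sup>2 * \<beta>\<^sup>2))"
      using obtain_bucket_count[OF L(3,5) \<beta> n(4) \<epsilon>(1)] by blast
    have "1 = log 2 2" by simp
    also have "\<dots> \<le> lg" unfolding lg_def using u2 by (subst log_le_cancel_iff) auto
    finally have lg: "1 \<le> lg" .
    have \<tau>1: "L \<le> L * m" "m \<le> L * m" "1 \<le> L * m" using L(3) m(2) by auto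
    let ?\<H> = "map_pmf (sketch_mat w L m u) (hash_functions 2 (hash_range L m) u)"
    let ?\<N> = "map_pmf (noise_vec n (L * m)) (raw_noise n (L * m))"
    have dp: "1 / real n \<le> \<epsilon>" using n(1,3) by (simp add: field_simps)
    have 1: "real (L * m) \<le> C * ((log 2 (real u))\<^sup>2 / (\<epsilon>\<^sup>2 * \<beta>\<^sup>2))"
    proof -
      have "2 ^ 25 * a\<^sup>2 * (lg\<^sup>2 / (\<epsilon>\<^sup>2 * \<beta>\<^sup>2)) \<le> C * (lg\<^sup>2 / (\<epsilon>\<^sup>2 * \<beta>\<^sup>2))"
        using C(3) by (intro mult_right_mono) auto
      with m(5) show ?thesis unfolding lg_def by linarith
    qed
    have 2: "set_pmf ?\<H> \<subseteq> carrier_mat (L * m) u" by (auto simp: sketch_mat_def)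
    have 3: "set_pmf ?\<N> \<subseteq> carrier_vec (L * m)" by (auto simp: noise_vec_def)
    have 4: "\<forall>f<2. 0 < hash_range L m f" using m(2) by (simp add: hash_range_def)
    have 5: "computes_within (\<lambda>_. 0) estimator_prog
        (input_state u w \<beta> \<epsilon> (L * m) (bits_of_vec y)) (C * real (L * m))
        real_output (return_pmf (sketch_estimate n m L y))" for y
    proof (rule computes_estimator_prog[OF L(1,2,3) m(2) n(2,3)])
      have "3 * L + 3 * m + 2 * n + 12 + L * (7 * m + 13) \<le> 100 * (L * m)"
      proof -
        have "L * (7 * m + 13) = 7 * (L * m) + 13 * L" by (simp add: algebra_simps)
        then show ?thesis using \<tau>1 m(3) by linarith
      qed
      then have "real (3 * L + 3 * m + 2 * n + 12 + L * (7 * m + 13)) \<le> 100 * real (L * m)"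
        by (metis of_nat_le_iff of_nat_mult of_nat_numeral)
      also have "\<dots> \<le> C * real (L * m)" using C by (intro mult_right_mono) auto
      finally show "real (3 * L + 3 * m + 2 * n + 12 + L * (7 * m + 13)) \<le> C * real (L * m)" .
    qed
    have 6: "1 - 1 / real u \<le> measure_pmf.prob (pair_pmf ?\<H> ?\<N>)
        {(H, \<phi>). \<bar>sketch_estimate n m L (H *\<^sub>v x + \<phi>) - l1_norm (real_vec x \<circ>\<^sub>H w)\<bar>
           < \<beta> * l1_norm (real_vec x \<circ>\<^sub>H w) + C * (log 2 (real u) / (\<epsilon>\<^sup>2 * \<beta>\<^sup>2))}"
      if x: "x \<in> carrier_vec u" for x
    proof -
      have "0 < lg / (\<epsilon>\<^sup>2 * \<beta>\<^sup>2)" using lg \<beta> \<epsilon> by simp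
      then have "2 ^ 25 * a\<^sup>2 * (lg / (\<epsilon>\<^sup>2 * \<beta>\<^sup>2)) < C * (lg / (\<epsilon>\<^sup>2 * \<beta>\<^sup>2))"
        using C(3) by (intro mult_strict_right_mono)
      with m(4) have add: "2 * real m < C * (log 2 (real u) / (\<epsilon>\<^sup>2 * \<beta>\<^sup>2))" unfolding lg_def by linarith
      have u0: "0 < u" using u2 by simp
      show ?thesis
        by (rule order_trans[OF sketch_estimate_accurate[OF u0 L(2,4,3) n(1) \<beta> m(1) w(1) x]
              measure_pmf.finite_measure_mono]) (use add in auto)
    qed
    have 7: "differentially_private \<epsilon> {0..<u} (\<lambda>S. map_pmf (\<lambda>\<phi>. H *\<^sub>v set_vec01 u S + \<phi>) ?\<N>)"
      if H: "H \<in> set_pmf ?\<H>" for H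
    proof -
      obtain h where h: "H = sketch_mat w L m u h" using H by auto
      show ?thesis
        by (rule private_unit_columns[OF _ _ n(1) dp])
          (use 2 H col_sketch_mat[OF _ w(2)] in \<open>auto simp: h\<close>)
    qed
    have 8: "computes_within h sketcher_prog (input_state u w \<beta> \<epsilon> (L * m) zs)
        (C * (real (l0_norm x) * log 2 (real u) + real (L * m))) (vec_output (L * m))
        (map_pmf (\<lambda>\<phi>. bits_of_vec (sketch_mat w L m u h *\<^sub>v x + \<phi>)) ?\<N>)"
      if h: "h \<in> set_pmf (hash_functions 2 (hash_range L m) u)" and x: "x \<in> carrier_vec u" and zs: "sparse_rep x zs" for h x zs
    proof -
      have m0: "0 < m" using m(2) by simp
      have "3 * L + 3 * m + 2 * n + 14 + 7 * (L * m) \<le> 100 * (L * m)" using \<tau>1 m(3) by linarith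
      then have a: "real (3 * L + 3 * m + 2 * n + 14 + 7 * (L * m)) \<le> 100 * real (L * m)"
        by (metis of_nat_le_iff of_nat_mult of_nat_numeral)
      have "real (3 * L + 9) \<le> 100 * lg" using L(5) lg by simp
      then have b: "real (length zs * (3 * L + 9)) \<le> 100 * (real (length zs) * lg)"
        using mult_left_mono[of "real (3 * L + 9)" "100 * lg" "real (length zs)"] by (simp add: mult_ac)
      have "real (3 * L + 3 * m + 2 * n + 14 + 7 * (L * m) + length zs * (3 * L + 9)) \<le>
          100 * (real (l0_norm x) * lg + real (L * m))"
        using add_mono[OF a b] l0_norm_sparse_rep[OF zs] by (simp add: distrib_left)
      also have "\<dots> \<le> C * (real (l0_norm x) * lg + real (L * m))"
        using C lg by (intro mult_right_mono) auto
      finally show ?thesis unfolding lg_def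
        by (intro computes_sketcher_prog[OF L(1,2,3) m0 n(2,3) wc w(2) h x zs])
    qed
    show "\<exists>(\<tau>::nat) (\<H>::bit mat pmf) (\<N>::bit vec pmf)
          (k::nat) (r::nat \<Rightarrow> nat) (mat_of::(nat \<times> nat \<Rightarrow> nat) \<Rightarrow> bit mat)
          (est::bit vec \<Rightarrow> real).
        real \<tau> \<le> C * ((log 2 (real u))\<^sup>2 / (\<epsilon>\<^sup>2 * \<beta>\<^sup>2)) \<and>
        set_pmf \<H> \<subseteq> carrier_mat \<tau> u \<and>
        set_pmf \<N> \<subseteq> carrier_vec \<tau> \<and>
        (\<forall>f<k. 0 < r f) \<and>
        \<H> = map_pmf mat_of (hash_functions k r u) \<and>
        (\<forall>y\<in>carrier_vec \<tau>.
          computes_within (\<lambda>_. 0) estimator_prog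
            (input_state u w \<beta> \<epsilon> \<tau> (bits_of_vec y)) (C * real \<tau>)
            real_output (return_pmf (est y))) \<and>
        (\<forall>x\<in>carrier_vec u.
          measure_pmf.prob (pair_pmf \<H> \<N>)
            {(H, \<phi>). \<bar>est (H *\<^sub>v x + \<phi>) - l1_norm (real_vec x \<circ>\<^sub>H w)\<bar>
               < \<beta> * l1_norm (real_vec x \<circ>\<^sub>H w) + C * (log 2 (real u) / (\<epsilon>\<^sup>2 * \<beta>\<^sup>2))}
          \<ge> 1 - 1 / real u) \<and>
        (\<forall>H\<in>set_pmf \<H>.
          differentially_private \<epsilon> {0..<u}
            (\<lambda>S. map_pmf (\<lambda>\<phi>. H *\<^sub>v set_vec01 u S + \<phi>) \<N>)) \<and>
        (\<forall>h\<in>set_pmf (hash_functions k r u). \<forall>x\<in>carrier_vec u. \<forall>zs. sparse_rep x zs \<longrightarrow>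
          computes_within h sketcher_prog
            (input_state u w \<beta> \<epsilon> \<tau> zs) (C * (real (l0_norm x) * log 2 (real u) + real \<tau>))
            (vec_output \<tau>)
            (map_pmf (\<lambda>\<phi>. bits_of_vec (mat_of h *\<^sub>v x + \<phi>)) \<N>))"
      by (rule exI[of _ "L * m"], rule exI[of _ ?\<H>], rule exI[of _ ?\<N>], rule exI[of _ 2],
          rule exI[of _ "hash_range L m"], rule exI[of _ "sketch_mat w L m u"], rule exI[of _ "sketch_estimate n m L"],
          intro conjI ballI allI impI 1 2 3 4 refl 5 6 7 8)
  qed
qed

end
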